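(* Let $G$ be a real, connected, compact, semisimple Lie group of dimension $3$. Then: (i) for every right invariant vector field $X$ on $G$, every orbit of the invariant flow $\exp(tX)$ that is not a fixed point is periodic; (ii) for every linear vector field $\mathcal{X}$ on $G$ with linear flow $\varphi_t$, every orbit of $\varphi_t$ that is not a fixed point is periodic.
   Context: A vector field $\mathcal{X}$ on a Lie group $G$ is called linear if its flow $(\varphi_t)_{t\in\mathbb{R}}$ is a family of automorphisms of the Lie group $G$; $\varphi_t$ is then called the linear flow. The invariant flow of a right invariant vector field $X$ (identified with an element of the Lie algebra) is $g\mapsto\exp(tX)g$. An orbit is periodic if its orbit curve $c$ satisfies $c(t+s)=c(t)$ for all $t\in\mathbb{R}$, for some $s>0$. *)

theory Defs
  imports "HOL-Analysis.Analysis" "HOL-Algebra.Group" "HOL-Library.Function_Algebras"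
begin

text \<open>A map is $C^k$ on an open set if its iterated directional derivatives up to order $k$
  exist and are continuous, the map being Frechet differentiable at each intermediate stage.\<close>

primrec Ck_on :: "nat \<Rightarrow> 'a::euclidean_space set \<Rightarrow> ('a \<Rightarrow> 'b::euclidean_space) \<Rightarrow> bool" where
  "Ck_on 0 S f \<longleftrightarrow> continuous_on S f"
| "Ck_on (Suc k) S f \<longleftrightarrow>
     (\<forall>x\<in>S. f differentiable (at x)) \<and> (\<forall>v. Ck_on k S (\<lambda>x. frechet_derivative f (at x) v))"

definition smooth_on :: "'a::euclidean_space set \<Rightarrow> ('a \<Rightarrow> 'b::euclidean_space) \<Rightarrow> bool" where
  "smooth_on S f \<longleftrightarrow> (\<forall>k. Ck_on k S f)"

text \<open>A chart is a domain together with a coordinate map; only the values of the coordinate map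
  on the domain matter. An atlas need not be maximal.\<close>

type_synonym ('a, 'b) chart = "'a set \<times> ('a \<Rightarrow> 'b)"

definition smooth_atlas :: "('a::topological_space, 'b::euclidean_space) chart set \<Rightarrow> bool" where
  "smooth_atlas A \<longleftrightarrow>
     (\<Union>(U, c)\<in>A. U) = UNIV \<and>
     (\<forall>(U, c)\<in>A. open U \<and> open (c ` U) \<and> homeomorphism U (c ` U) c (inv_into U c)) \<and>
     (\<forall>(U, c)\<in>A. \<forall>(V, d)\<in>A. smooth_on (c ` (U \<inter> V)) (d \<circ> inv_into U c))"

definition std_atlas :: "('b::euclidean_space, 'b) chart set" where
  "std_atlas = {(UNIV, id)}"

definition prod_atlas ::
  "('a, 'b) chart set \<Rightarrow> ('c, 'd) chart set \<Rightarrow> ('a \<times> 'c, 'b \<times> 'd) chart set" where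
  "prod_atlas A B = {(U \<times> V, map_prod c d) | U c V d. (U, c) \<in> A \<and> (V, d) \<in> B}"

definition smooth_map ::
  "('a::topological_space, 'b::euclidean_space) chart set \<Rightarrow>
   ('c::topological_space, 'd::euclidean_space) chart set \<Rightarrow> ('a \<Rightarrow> 'c) \<Rightarrow> bool" where
  "smooth_map A B f \<longleftrightarrow>
     continuous_on UNIV f \<and>
     (\<forall>(U, c)\<in>A. \<forall>(V, d)\<in>B. smooth_on (c ` (U \<inter> f -` V)) (d \<circ> f \<circ> inv_into U c))"

abbreviation smooth_fun ::
  "('a::topological_space, 'b::euclidean_space) chart set \<Rightarrow> ('a \<Rightarrow> real) \<Rightarrow> bool" where
  "smooth_fun A \<equiv> smooth_map A std_atlas"

text \<open>Tangent vectors at \<open>p\<close> are the derivations at \<open>p\<close> of the algebra of smooth functions. They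
  are made to vanish on all other functions, so that equality of functions in HOL is equality of
  tangent vectors. Sums and products of functions are pointwise.\<close>

definition tangent_space ::
  "('a::topological_space, 'b::euclidean_space) chart set \<Rightarrow> 'a \<Rightarrow> (('a \<Rightarrow> real) \<Rightarrow> real) set" where
  "tangent_space A p = {v.
     (\<forall>f g. smooth_fun A f \<longrightarrow> smooth_fun A g \<longrightarrow> v (f + g) = v f + v g) \<and>
     (\<forall>r f. smooth_fun A f \<longrightarrow> v (\<lambda>x. r * f x) = r * v f) \<and>
     (\<forall>f g. smooth_fun A f \<longrightarrow> smooth_fun A g \<longrightarrow> v (f * g) = f p * v g + g p * v f) \<and>
     (\<forall>f. \<not> smooth_fun A f \<longrightarrow> v f = 0)}"

text \<open>A vector field is represented by its action on functions: \<open>X f p\<close> is the value of the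
  tangent vector of \<open>X\<close> at \<open>p\<close> on the function \<open>f\<close>.\<close>

type_synonym 'a vfield = "('a \<Rightarrow> real) \<Rightarrow> 'a \<Rightarrow> real"

definition vector_field ::
  "('a::topological_space, 'b::euclidean_space) chart set \<Rightarrow> 'a vfield \<Rightarrow> bool" where
  "vector_field A X \<longleftrightarrow>
     (\<forall>p. (\<lambda>f. X f p) \<in> tangent_space A p) \<and> (\<forall>f. smooth_fun A f \<longrightarrow> smooth_fun A (X f))"

definition vf_scale :: "real \<Rightarrow> 'a vfield \<Rightarrow> 'a vfield" where
  "vf_scale r X = (\<lambda>f p. r * X f p)"

definition vf_bracket :: "'a vfield \<Rightarrow> 'a vfield \<Rightarrow> 'a vfield" where
  "vf_bracket X Y = X \<circ> Y - Y \<circ> X"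

lemma vector_space_vf_scale: "vector_space vf_scale"
  by unfold_locales (auto simp: vf_scale_def fun_eq_iff algebra_simps)

definition integral_curve ::
  "('a::topological_space, 'b::euclidean_space) chart set \<Rightarrow> 'a vfield \<Rightarrow> (real \<Rightarrow> 'a) \<Rightarrow> bool" where
  "integral_curve A X \<gamma> \<longleftrightarrow>
     smooth_map std_atlas A \<gamma> \<and>
     (\<forall>t f. smooth_fun A f \<longrightarrow> ((\<lambda>s. f (\<gamma> s)) has_real_derivative X f (\<gamma> t)) (at t))"

definition is_flow ::
  "('a::topological_space, 'b::euclidean_space) chart set \<Rightarrow> 'a vfield \<Rightarrow> (real \<Rightarrow> 'a \<Rightarrow> 'a) \<Rightarrow> bool" where
  "is_flow A X \<phi> \<longleftrightarrow> (\<forall>g. \<phi> 0 g = g \<and> integral_curve A X (\<lambda>t. \<phi> t g))"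

definition fixed_point :: "(real \<Rightarrow> 'a \<Rightarrow> 'a) \<Rightarrow> 'a \<Rightarrow> bool" where
  "fixed_point \<phi> g \<longleftrightarrow> (\<forall>t. \<phi> t g = g)"

definition periodic_orbit :: "(real \<Rightarrow> 'a \<Rightarrow> 'a) \<Rightarrow> 'a \<Rightarrow> bool" where
  "periodic_orbit \<phi> g \<longleftrightarrow> (\<exists>s>0. \<forall>t. \<phi> (t + s) g = \<phi> t g)"

text \<open>The underlying set of a manifold is a whole type, which carries the topology. The type
  constraints are the usual Hausdorff and second countability requirements, and the dimension of
  the manifold is \<open>DIM('b)\<close>.\<close>

definition lie_group ::
  "'a::{t2_space, second_countable_topology} monoid \<Rightarrow> ('a, 'b::euclidean_space) chart set \<Rightarrow> bool" where
  "lie_group G A \<longleftrightarrow>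
     group G \<and> carrier G = UNIV \<and> smooth_atlas A \<and>
     smooth_map (prod_atlas A A) A (\<lambda>(x, y). x \<otimes>\<^bsub>G\<^esub> y) \<and>
     smooth_map A A (\<lambda>x. inv\<^bsub>G\<^esub> x)"

definition lie_automorphism ::
  "'a::topological_space monoid \<Rightarrow> ('a, 'b::euclidean_space) chart set \<Rightarrow> ('a \<Rightarrow> 'a) \<Rightarrow> bool" where
  "lie_automorphism G A \<psi> \<longleftrightarrow>
     \<psi> \<in> iso G G \<and> smooth_map A A \<psi> \<and> smooth_map A A (inv_into UNIV \<psi>)"

text \<open>The differential of the right translation by \<open>h\<close> maps the value of \<open>X\<close> at \<open>g\<close> to the value
  of \<open>X\<close> at \<open>g \<otimes> h\<close>.\<close>

definition right_invariant ::
  "'a::topological_space monoid \<Rightarrow> ('a, 'b::euclidean_space) chart set \<Rightarrow> 'a vfield \<Rightarrow> bool" where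
  "right_invariant G A X \<longleftrightarrow>
     vector_field A X \<and>
     (\<forall>f g h. smooth_fun A f \<longrightarrow> X (\<lambda>x. f (x \<otimes>\<^bsub>G\<^esub> h)) g = X f (g \<otimes>\<^bsub>G\<^esub> h))"

definition lie_algebra ::
  "'a::topological_space monoid \<Rightarrow> ('a, 'b::euclidean_space) chart set \<Rightarrow> 'a vfield set" where
  "lie_algebra G A = {X. right_invariant G A X}"

definition lie_exp ::
  "'a::topological_space monoid \<Rightarrow> ('a, 'b::euclidean_space) chart set \<Rightarrow> 'a vfield \<Rightarrow> 'a" where
  "lie_exp G A X = (THE \<gamma>. \<gamma> 0 = \<one>\<^bsub>G\<^esub> \<and> integral_curve A X \<gamma>) 1"

definition invariant_flow ::
  "'a::topological_space monoid \<Rightarrow> ('a, 'b::euclidean_space) chart set \<Rightarrow> 'a vfield \<Rightarrow> real \<Rightarrow> 'a \<Rightarrow> 'a" where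
  "invariant_flow G A X t g = lie_exp G A (vf_scale t X) \<otimes>\<^bsub>G\<^esub> g"

definition linear_vector_field ::
  "'a::topological_space monoid \<Rightarrow> ('a, 'b::euclidean_space) chart set \<Rightarrow> 'a vfield \<Rightarrow> bool" where
  "linear_vector_field G A X \<longleftrightarrow>
     vector_field A X \<and> (\<exists>\<phi>. is_flow A X \<phi> \<and> (\<forall>t. lie_automorphism G A (\<phi> t)))"

definition lie_ideal ::
  "'a::topological_space monoid \<Rightarrow> ('a, 'b::euclidean_space) chart set \<Rightarrow> 'a vfield set \<Rightarrow> bool" where
  "lie_ideal G A I \<longleftrightarrow>
     I \<subseteq> lie_algebra G A \<and> module.subspace vf_scale I \<and>
     (\<forall>X\<in>lie_algebra G A. \<forall>Y\<in>I. vf_bracket X Y \<in> I)"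

primrec derived_series :: "'a vfield set \<Rightarrow> nat \<Rightarrow> 'a vfield set" where
  "derived_series I 0 = I"
| "derived_series I (Suc n) =
     module.span vf_scale
       {vf_bracket X Y | X Y. X \<in> derived_series I n \<and> Y \<in> derived_series I n}"

definition solvable :: "'a vfield set \<Rightarrow> bool" where
  "solvable I \<longleftrightarrow> (\<exists>n. derived_series I n = {0})"

definition semisimple ::
  "'a::topological_space monoid \<Rightarrow> ('a, 'b::euclidean_space) chart set \<Rightarrow> bool" where
  "semisimple G A \<longleftrightarrow> (\<forall>I. lie_ideal G A I \<and> solvable I \<longrightarrow> I = {0})"

end

theory Submission
  imports Defs
begin

text \<open>
  The adjoint representation of a compact group is bounded. For a bounded one-parameter group of
  linear maps of a three-dimensional space with generator $h \neq 0$, the Cayley-Hamilton theorem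
  reduces to $h^3 = -\sigma h$ with $\sigma > 0$, so the group is periodic with period
  $2\pi/\sqrt\sigma$. Semisimplicity enters only through the triviality of the centre of the Lie
  algebra: it makes $\mathrm{ad}_x \neq 0$ for $x \neq 0$, whence $q(x) = \sigma(\mathrm{ad}_x)$ is a
  positive definite quadratic form. Every automorphism preserves $q$, so the differentials of a
  linear flow $\varphi_t$ form a bounded one-parameter group, one of them with $t > 0$ is the
  identity, and then $\varphi_t$ is the identity because the group is connected. Applied to the
  conjugations by $\exp(tX)$ this yields some $t > 0$ with $\exp(tX)$ central. The centre is
  discrete, since the adjoint representation is locally injective, hence finite by compactness, and
  a power of $\exp(tX)$ is the identity.
\<close>

section \<open>Calculus of $C^k$ maps\<close>

text \<open>The definitions make each time map of a linear flow an automorphism and each orbit a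
  smooth curve, but state nothing jointly in time and point. Continuity in \<open>t\<close> of the
  differentials is therefore extracted from one-parameter subgroups, whose lifetime in the chart and
  quadratic remainder are uniform over the unit ball of directions. Continuity alone then yields a
  generator. The reduction of Cayley-Hamilton rests on odd dimension: a real eigenvalue exists,
  boundedness in both time directions forces it to be 0, and with it the determinant vanishes. A
  nonzero trace and a nonpositive \<open>\<sigma>\<close> are excluded by bounded functions whose
  derivative stays away from 0. Vector fields act on global functions, so their brackets are awkward
  in coordinates. The bracket used is the derivative of \<open>Ad\<close> at the unit; it is
  compared with the bracket of fields only for directions in which it vanishes identically, which is
  what triviality of the centre requires. Bump functions are the passage from global derivations to
  coordinates.\<close>

lemma Ck_on_cong:
  assumes "open S" "\<And>x. x \<in> S \<Longrightarrow> f x = g x" "Ck_on k S f"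
  shows "Ck_on k S g"
  using assms(2,3)
proof (induction k arbitrary: f g)
  case 0
  then show ?case by (simp cong: continuous_on_cong)
next
  case (Suc k)
  have d: "(g has_derivative frechet_derivative f (at x)) (at x)" if "x \<in> S" for x
    using Suc.prems that assms(1) has_derivative_transform_within_open[of f _ x UNIV S g]
    by (simp add: frechet_derivative_works)
  then have "frechet_derivative g (at x) = frechet_derivative f (at x)" if "x \<in> S" for x
    using that frechet_derivative_at[symmetric] by blast
  then have "Ck_on k S (\<lambda>x. frechet_derivative g (at x) v)" for v
    using Suc.IH[of "\<lambda>x. frechet_derivative f (at x) v" "\<lambda>x. frechet_derivative g (at x) v"] Suc.prems
    by simp
  with d show ?case
    by (auto simp: differentiable_def)
qed

lemma Ck_on_subset: "Ck_on k S f \<Longrightarrow> T \<subseteq> S \<Longrightarrow> Ck_on k T f"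
  by (induction k arbitrary: f) (auto intro: continuous_on_subset)

lemma Ck_on_SucI:
  assumes "open S" "\<And>x. x \<in> S \<Longrightarrow> (f has_derivative f' x) (at x)" "\<And>v. Ck_on k S (\<lambda>x. f' x v)"
  shows "Ck_on (Suc k) S f"
proof -
  have "frechet_derivative f (at x) = f' x" if "x \<in> S" for x
    using that assms(2) frechet_derivative_at[symmetric] by blast
  then have "Ck_on k S (\<lambda>x. frechet_derivative f (at x) v)" for v
    using Ck_on_cong[OF assms(1) _ assms(3)[of v]] by simp
  then show ?thesis using assms(2) by (auto simp: differentiable_def)
qed

lemma Ck_on_has_derivative:
  "Ck_on (Suc k) S f \<Longrightarrow> x \<in> S \<Longrightarrow> (f has_derivative frechet_derivative f (at x)) (at x)"
  by (simp add: frechet_derivative_works)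

lemma Ck_on_imp_continuous_on: "Ck_on k S f \<Longrightarrow> continuous_on S f"
  by (cases k) (auto simp: continuous_on_eq_continuous_within differentiable_imp_continuous_within
      intro: continuous_at_imp_continuous_at_within)

lemma Ck_on_SucD: "Ck_on (Suc k) S f \<Longrightarrow> Ck_on k S f"
proof (induction k arbitrary: f)
  case 0
  then show ?case using Ck_on_imp_continuous_on by fastforce
next
  case (Suc k)
  show ?case unfolding Ck_on.simps(2)[of k] using Suc.prems Suc.IH Ck_on.simps(2) by blast
qed

text \<open>Derivatives see only a neighbourhood of the point. This glues the different formulas
  that a function has in different charts.\<close>

lemma Ck_on_local:
  assumes "\<And>x. x \<in> S \<Longrightarrow> \<exists>T. open T \<and> x \<in> T \<and> Ck_on k T f"
  shows "Ck_on k S f"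
  using assms
proof (induction k arbitrary: f)
  case 0
  have "isCont f x" if "x \<in> S" for x
    using 0[OF that] continuous_on_eq_continuous_at by fastforce
  then show ?case by (simp add: continuous_at_imp_continuous_on)
next
  case (Suc k)
  show ?case unfolding Ck_on.simps
  proof (intro conjI allI ballI)
    show "f differentiable at x" if "x \<in> S" for x
      using Suc.prems[OF that] by auto
    show "Ck_on k S (\<lambda>x. frechet_derivative f (at x) v)" for v
      by (rule Suc.IH) (use Suc.prems Ck_on.simps(2) in metis)
  qed
qed

lemma Ck_on_const: "Ck_on k S (\<lambda>x. c)"
  by (induction k arbitrary: c) (auto simp: frechet_derivative_const)

lemma Ck_on_bounded_linear:
  assumes "bounded_linear f" shows "Ck_on k S f"
proof (cases k)
  case 0
  then show ?thesis using assms by (simp add: linear_continuous_on)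
next
  case (Suc j)
  have "(f has_derivative f) (at x)" for x
    using assms bounded_linear_imp_has_derivative by blast
  then have "Ck_on (Suc j) UNIV f"
    by (intro Ck_on_SucI[where f'="\<lambda>x. f"] Ck_on_const) auto
  then show ?thesis using Suc Ck_on_subset by blast
qed

lemma Ck_on_id: "Ck_on k S (\<lambda>x. x)"
  by (rule Ck_on_bounded_linear) (rule bounded_linear_ident)

lemma Ck_on_add:
  assumes "open S" "Ck_on k S f" "Ck_on k S g"
  shows "Ck_on k S (\<lambda>x. f x + g x)"
  using assms(2,3)
proof (induction k arbitrary: f g)
  case 0
  then show ?case by (auto intro: continuous_intros)
next
  case (Suc k)
  show ?case
    by (rule Ck_on_SucI[OF assms(1) has_derivative_add[OF Ck_on_has_derivative Ck_on_has_derivative]])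
      (use Suc in auto)
qed

lemma Ck_on_bilinear:
  fixes prod :: "'a::euclidean_space \<Rightarrow> 'b::euclidean_space \<Rightarrow> 'c::euclidean_space"
  assumes "open S" "Ck_on k S f" "Ck_on k S g" "bounded_bilinear prod"
  shows "Ck_on k S (\<lambda>x. prod (f x) (g x))"
  using assms(2,3)
proof (induction k arbitrary: f g)
  case 0
  then show ?case using bounded_bilinear.continuous_on[OF assms(4)] by auto
next
  case (Suc k)
  show ?case
  proof (rule Ck_on_SucI[OF assms(1)])
    show "((\<lambda>x. prod (f x) (g x)) has_derivative
        (\<lambda>h. prod (f x) (frechet_derivative g (at x) h) + prod (frechet_derivative f (at x) h) (g x))) (at x)"
      if "x \<in> S" for x
      by (rule bounded_bilinear.FDERIV[OF assms(4)] Ck_on_has_derivative Suc.prems that)+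
    show "Ck_on k S (\<lambda>x. prod (f x) (frechet_derivative g (at x) v) + prod (frechet_derivative f (at x) v) (g x))" for v
      using Suc.prems by (intro Ck_on_add[OF assms(1)] Suc.IH) (auto intro: Ck_on_SucD simp del: Ck_on.simps simp: Ck_on.simps(2))
  qed
qed

lemmas Ck_on_mult = Ck_on_bilinear[OF _ _ _ bounded_bilinear_mult]
lemmas Ck_on_scaleR = Ck_on_bilinear[OF _ _ _ bounded_bilinear_scaleR]
lemmas Ck_on_inner = Ck_on_bilinear[OF _ _ _ bounded_bilinear_inner]

lemma Ck_on_uminus:
  assumes "open S" "Ck_on k S f"
  shows "Ck_on k S (\<lambda>x. - f x)"
  using Ck_on_scaleR[OF assms(1) Ck_on_const[of k S "-1"] assms(2)] by simp

lemma Ck_on_diff: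
  assumes "open S" "Ck_on k S f" "Ck_on k S g"
  shows "Ck_on k S (\<lambda>x. f x - g x)"
  using Ck_on_add[OF assms(1,2) Ck_on_uminus[OF assms(1,3)]] by simp

lemma Ck_on_sum:
  assumes "open S" "\<And>i. i \<in> I \<Longrightarrow> Ck_on k S (f i)"
  shows "Ck_on k S (\<lambda>x. \<Sum>i\<in>I. f i x)"
  using assms(2) by (induction I rule: infinite_finite_induct) (auto intro: Ck_on_const Ck_on_add assms(1))

lemma linear_expand_Basis:
  fixes h :: "'a::euclidean_space \<Rightarrow> 'b::real_vector"
  assumes "linear h" shows "h v = (\<Sum>i\<in>Basis. (v \<bullet> i) *\<^sub>R h i)"
proof -
  have "h v = h (\<Sum>i\<in>Basis. (v \<bullet> i) *\<^sub>R i)" by (simp add: euclidean_representation)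
  also have "\<dots> = (\<Sum>i\<in>Basis. (v \<bullet> i) *\<^sub>R h i)"
    using assms by (simp add: linear_sum linear_cmul)
  finally show ?thesis .
qed

lemma Ck_on_compose:
  assumes "open S" "open T" "Ck_on k S f" "Ck_on k T g" "f ` S \<subseteq> T"
  shows "Ck_on k S (\<lambda>x. g (f x))"
  using assms(3-)
proof (induction k arbitrary: f g)
  case 0
  then show ?case by (auto intro: continuous_on_compose2)
next
  case (Suc k)
  have d: "((\<lambda>x. g (f x)) has_derivative (\<lambda>v. frechet_derivative g (at (f x)) (frechet_derivative f (at x) v))) (at x)"
    if "x \<in> S" for x
    using diff_chain_at[OF Ck_on_has_derivative[OF Suc.prems(1) that] Ck_on_has_derivative[OF Suc.prems(2)]]
      Suc.prems(3) that by (auto simp: o_def)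
  \<comment> \<open>\<open>Ck_on\<close> controls the derivatives of \<open>g\<close> along fixed
    directions, whereas the chain rule needs a direction moving with \<open>x\<close>. Expanding in
    the basis restores fixed directions.\<close>
  have e: "Ck_on k S (\<lambda>x. \<Sum>i\<in>Basis. (frechet_derivative f (at x) v \<bullet> i) *\<^sub>R frechet_derivative g (at (f x)) i)" for v
    using Suc.prems
    by (intro Ck_on_sum[OF assms(1)] Ck_on_scaleR[OF assms(1)] Ck_on_inner[OF assms(1)] Ck_on_const
        Suc.IH[OF Ck_on_SucD]) auto
  have "Ck_on k S (\<lambda>x. frechet_derivative g (at (f x)) (frechet_derivative f (at x) v))" for v
  proof (rule Ck_on_cong[OF assms(1) _ e[of v]])
    fix x assume "x \<in> S"
    then have "linear (frechet_derivative g (at (f x)))"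
      using Suc.prems by (auto intro!: linear_frechet_derivative)
    from linear_expand_Basis[OF this, symmetric]
    show "(\<Sum>i\<in>Basis. (frechet_derivative f (at x) v \<bullet> i) *\<^sub>R frechet_derivative g (at (f x)) i) =
         frechet_derivative g (at (f x)) (frechet_derivative f (at x) v)" .
  qed
  with d show ?case by (rule Ck_on_SucI[OF assms(1)])
qed

lemma Ck_on_Pair:
  assumes "open S" "Ck_on k S f" "Ck_on k S g"
  shows "Ck_on k S (\<lambda>x. (f x, g x))"
  using assms(2,3)
proof (induction k arbitrary: f g)
  case 0
  then show ?case by (auto intro: continuous_intros)
next
  case (Suc k)
  show ?case
    by (rule Ck_on_SucI[OF assms(1) has_derivative_Pair[OF Ck_on_has_derivative Ck_on_has_derivative]])
      (use Suc in auto)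
qed

lemma Ck_on_inverse_real: "Ck_on k {x::real. x \<noteq> 0} inverse"
proof (induction k)
  case 0
  then show ?case by (auto intro!: continuous_intros)
next
  case (Suc k)
  have o: "open {x::real. x \<noteq> 0}" using open_Compl[of "{0::real}"] by (simp add: Compl_eq)
  show ?case
  proof (rule Ck_on_SucI[OF o])
    show "(inverse has_derivative (\<lambda>h. - (inverse x * h * inverse x))) (at x)" if "x \<in> {x. x \<noteq> 0}" for x :: real
      using that by (auto intro!: has_derivative_inverse')
    show "Ck_on k {x. x \<noteq> 0} (\<lambda>x. - (inverse x * v * inverse x))" for v :: real
      by (intro Ck_on_uminus[OF o] Ck_on_mult[OF o] Suc Ck_on_const)
  qed
qed

section \<open>Smooth bump functions\<close>

definition flat :: "nat \<Rightarrow> real \<Rightarrow> real" where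
  "flat n t = (if t > 0 then exp (- inverse t) * inverse t ^ n else 0)"

text \<open>The index \<open>n\<close> closes the family under differentiation up to linear
  combinations, so smoothness of exp(-1/t) becomes one induction over all \<open>n\<close>.\<close>

lemma has_real_derivative_flat:
  "(flat n has_real_derivative (flat (n + 2) t - real n * flat (n + 1) t)) (at t)"
proof -
  consider "t > 0" | "t < 0" | "t = 0" by linarith
  then show ?thesis
  proof cases
    case 1
    have "((\<lambda>t. exp (- inverse t) * inverse t ^ n) has_real_derivative
        exp (- inverse t) * inverse t ^ (n + 2) - real n * (exp (- inverse t) * inverse t ^ (n + 1))) (at t)"
    proof (rule DERIV_cong)
      show "((\<lambda>t. exp (- inverse t) * inverse t ^ n) has_real_derivative
          exp (- inverse t) * (inverse t)\<^sup>2 * inverse t ^ n +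
          real n * inverse t ^ (n - 1) * (- (inverse t)\<^sup>2) * exp (- inverse t)) (at t)"
        using 1 by (auto intro!: derivative_eq_intros simp: power2_eq_square)
      show "exp (- inverse t) * (inverse t)\<^sup>2 * inverse t ^ n +
          real n * inverse t ^ (n - 1) * (- (inverse t)\<^sup>2) * exp (- inverse t) =
          exp (- inverse t) * inverse t ^ (n + 2) - real n * (exp (- inverse t) * inverse t ^ (n + 1))"
        by (cases n) (auto simp: algebra_simps power2_eq_square)
    qed
    then have "(flat n has_real_derivative exp (- inverse t) * inverse t ^ (n + 2) - real n * (exp (- inverse t) * inverse t ^ (n + 1))) (at t)"
      by (rule has_field_derivative_transform_within_open[where S="{0<..}"]) (use 1 in \<open>auto simp: flat_def\<close>)
    then show ?thesis using 1 by (simp add: flat_def)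
  next
    case 2
    have "((\<lambda>t::real. 0) has_real_derivative 0) (at t)" by simp
    then have "(flat n has_real_derivative 0) (at t)"
      by (rule has_field_derivative_transform_within_open[where S="{..<0}"]) (use 2 in \<open>auto simp: flat_def\<close>)
    then show ?thesis using 2 by (simp add: flat_def)
  next
    case 3
    \<comment> \<open>Substituting \<open>inverse t\<close> turns the difference quotient
      \<open>flat n t / t\<close> at 0 into a power over an exponential at infinity.\<close>
    have "((\<lambda>x::real. x ^ (n + 1) / exp x) \<longlongrightarrow> 0) at_top"
      by (rule tendsto_power_div_exp_0)
    then have "((\<lambda>t::real. inverse t ^ (n + 1) / exp (inverse t)) \<longlongrightarrow> 0) (at_right 0)"
      by (rule filterlim_compose) (rule filterlim_inverse_at_top_right)
    then have r: "((\<lambda>t. flat n t / t) \<longlongrightarrow> 0) (at_right 0)"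
      by (rule filterlim_cong[THEN iffD1, rotated -1])
        (auto simp: eventually_at_filter flat_def field_simps exp_minus)
    have l: "((\<lambda>t. flat n t / t) \<longlongrightarrow> 0) (at_left 0)"
      by (rule filterlim_cong[THEN iffD1, OF refl refl _ tendsto_const])
        (auto simp: eventually_at_filter flat_def)
    have "((\<lambda>t. flat n t / t) \<longlongrightarrow> 0) (at 0)"
      using l r by (simp add: filterlim_at_split)
    then have "(flat n has_real_derivative 0) (at 0)"
      by (simp add: DERIV_def flat_def)
    then show ?thesis using 3 by (simp add: flat_def)
  qed
qed

lemma Ck_on_real_SucI:
  fixes f :: "real \<Rightarrow> 'b::euclidean_space"
  assumes "open S" "\<And>t. t \<in> S \<Longrightarrow> (f has_vector_derivative f' t) (at t)" "Ck_on k S f'"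
  shows "Ck_on (Suc k) S f"
  using assms
  by (intro Ck_on_SucI[where f'="\<lambda>t v. v *\<^sub>R f' t"] Ck_on_scaleR Ck_on_const)
    (auto simp: has_vector_derivative_def)

lemma Ck_on_flat: "Ck_on k UNIV (flat n)"
proof (induction k arbitrary: n)
  case 0
  have "continuous (at t) (flat n)" for t
    using has_real_derivative_flat DERIV_isCont by blast
  then show ?case by (simp add: continuous_at_imp_continuous_on)
next
  case (Suc k)
  show ?case
    by (rule Ck_on_real_SucI[OF open_UNIV has_real_derivative_flat[unfolded has_real_derivative_iff_has_vector_derivative]])
      (intro Ck_on_diff Ck_on_mult Ck_on_const Suc open_UNIV)
qed

text \<open>The squared distance is polynomial, so nothing is lost at the centre; the denominator
  normalises the value at \<open>p\<close> to 1.\<close>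

definition bump :: "real \<Rightarrow> 'a::euclidean_space \<Rightarrow> 'a \<Rightarrow> real" where
  "bump r p y = flat 0 (r\<^sup>2 - (y - p) \<bullet> (y - p)) / flat 0 (r\<^sup>2)"

lemma Ck_on_bump: "Ck_on k UNIV (bump r p)"
proof -
  have "Ck_on k UNIV (\<lambda>y. r\<^sup>2 - (y - p) \<bullet> (y - p))"
    by (intro Ck_on_diff Ck_on_inner Ck_on_const Ck_on_id open_UNIV)
  then have "Ck_on k UNIV (\<lambda>y. flat 0 (r\<^sup>2 - (y - p) \<bullet> (y - p)))"
    using Ck_on_compose[OF open_UNIV open_UNIV _ Ck_on_flat] by blast
  then have "Ck_on k UNIV (\<lambda>y. flat 0 (r\<^sup>2 - (y - p) \<bullet> (y - p)) * inverse (flat 0 (r\<^sup>2)))"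
    by (intro Ck_on_mult Ck_on_const open_UNIV)
  then show ?thesis by (simp add: bump_def[abs_def] divide_inverse)
qed

lemma bump_pos: "r > 0 \<Longrightarrow> y \<in> ball p r \<Longrightarrow> bump r p y > 0"
  by (auto simp: bump_def flat_def dist_norm norm_minus_commute power2_norm_eq_inner[symmetric]
      intro!: divide_pos_pos power_strict_mono)

lemma bump_center: "r > 0 \<Longrightarrow> bump r p p = 1"
  by (simp add: bump_def flat_def)

lemma bump_outside: "r > 0 \<Longrightarrow> y \<notin> ball p r \<Longrightarrow> bump r p y = 0"
  by (auto simp: bump_def flat_def dist_norm norm_minus_commute power2_norm_eq_inner[symmetric] not_less)

lemma Ck_on_divide_real:
  fixes f g :: "'a::euclidean_space \<Rightarrow> real"
  assumes "open S" "Ck_on k S f" "Ck_on k S g" "\<And>x. x \<in> S \<Longrightarrow> g x \<noteq> 0"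
  shows "Ck_on k S (\<lambda>x. f x / g x)"
proof -
  have "open {x::real. x \<noteq> 0}" using open_Compl[of "{0::real}"] by (simp add: Compl_eq)
  then have "Ck_on k S (\<lambda>x. inverse (g x))"
    by (rule Ck_on_compose[OF assms(1) _ assms(3) Ck_on_inverse_real]) (use assms(4) in auto)
  then show ?thesis
    unfolding divide_inverse by (intro Ck_on_mult assms)
qed

section \<open>Lipschitz bounds, differential equations and mixed derivatives\<close>

lemma norm_linear_le_Basis:
  fixes h :: "'a::euclidean_space \<Rightarrow> 'b::real_normed_vector"
  assumes "linear h" "\<And>i. i \<in> Basis \<Longrightarrow> norm (h i) \<le> B i"
  shows "norm (h v) \<le> (\<Sum>i\<in>Basis. B i) * norm v"
proof -
  have "norm (h v) \<le> (\<Sum>i\<in>Basis. norm ((v \<bullet> i) *\<^sub>R h i))"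
    unfolding linear_expand_Basis[OF assms(1), of v] by (rule norm_sum)
  also have "\<dots> \<le> (\<Sum>i\<in>Basis. norm v * B i)"
    using assms(2) by (intro sum_mono) (auto simp: Basis_le_norm intro!: mult_mono)
  finally show ?thesis by (simp add: sum_distrib_left mult.commute)
qed

lemma Ck_on_lipschitz:
  fixes f :: "'a::euclidean_space \<Rightarrow> 'b::euclidean_space"
  assumes "Ck_on (Suc 0) S f" "compact K" "convex K" "K \<subseteq> S"
  obtains L where "L \<ge> 0" "\<And>x y. x \<in> K \<Longrightarrow> y \<in> K \<Longrightarrow> norm (f x - f y) \<le> L * norm (x - y)"
proof -
  have "\<exists>B\<ge>0. \<forall>x\<in>K. norm (frechet_derivative f (at x) i) \<le> B" for i
  proof -
    have "continuous_on K (\<lambda>x. frechet_derivative f (at x) i)"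
      using assms(1,4) by (auto intro: continuous_on_subset)
    then have "bounded ((\<lambda>x. frechet_derivative f (at x) i) ` K)"
      using assms(2) compact_continuous_image compact_imp_bounded by blast
    then show ?thesis unfolding bounded_pos by (auto intro: less_imp_le)
  qed
  then obtain B where B: "\<And>i. B i \<ge> 0" "\<And>i x. x \<in> K \<Longrightarrow> norm (frechet_derivative f (at x) i) \<le> B i"
    by metis
  let ?L = "\<Sum>i\<in>Basis. B i"
  have "norm (f x - f y) \<le> ?L * norm (x - y)" if "x \<in> K" "y \<in> K" for x y
  proof (rule differentiable_bound[OF assms(3)])
    show "(f has_derivative frechet_derivative f (at z)) (at z within K)" if "z \<in> K" for z
      using that assms(1,4) Ck_on_has_derivative has_derivative_at_withinI by blast
    show "onorm (frechet_derivative f (at z)) \<le> ?L" if "z \<in> K" for z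
    proof (rule onorm_le)
      have "linear (frechet_derivative f (at z))"
        using that assms(1,4) by (auto intro!: linear_frechet_derivative)
      from norm_linear_le_Basis[OF this B(2)[OF that]]
      show "norm (frechet_derivative f (at z) v) \<le> ?L * norm v" for v .
    qed
  qed (use that in auto)
  then show ?thesis using that B(1) by (meson sum_nonneg)
qed

lemma gronwall_zero:
  fixes u :: "real \<Rightarrow> 'b::real_inner"
  assumes I: "convex I" "\<And>t. t \<in> I \<Longrightarrow> (u has_vector_derivative u' t) (at t)"
    and K: "\<And>t. t \<in> I \<Longrightarrow> norm (u' t) \<le> K * norm (u t)"
    and t0: "t0 \<in> I" "u t0 = 0" and t: "t \<in> I"
  shows "u t = 0"
proof -
  have seg: "s \<in> I" if "min t t0 \<le> s" "s \<le> max t t0" for s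
    using I(1) t t0(1) that mem_is_interval_1_I[of I] unfolding is_interval_convex_1[symmetric]
    by (metis max_def min_def)
  have d: "((\<lambda>s. (u s \<bullet> u s) * exp (c * s)) has_real_derivative
      (2 * (u s \<bullet> u' s) + c * (u s \<bullet> u s)) * exp (c * s)) (at s)" if "s \<in> I" for s c
  proof -
    have "((\<lambda>s. u s \<bullet> u s) has_real_derivative 2 * (u s \<bullet> u' s)) (at s)"
      using bounded_bilinear.has_vector_derivative[OF bounded_bilinear_inner I(2)[OF that] I(2)[OF that]]
      by (simp add: has_real_derivative_iff_has_vector_derivative inner_commute)
    then show ?thesis
      by (auto intro!: derivative_eq_intros simp: algebra_simps)
  qed
  have b: "\<bar>2 * (u s \<bullet> u' s)\<bar> \<le> 2 * K * (u s \<bullet> u s)" if "s \<in> I" for s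
  proof -
    have "\<bar>u s \<bullet> u' s\<bar> \<le> norm (u s) * (K * norm (u s))"
      using Cauchy_Schwarz_ineq2[of "u s" "u' s"] K[OF that] mult_left_mono[OF K[OF that], of "norm (u s)"]
      by simp
    then show ?thesis by (simp add: power2_norm_eq_inner[symmetric] power2_eq_square algebra_simps)
  qed
  \<comment> \<open>The sign of \<open>c\<close> makes the weighted square norm nonincreasing to the
    right of \<open>t0\<close> and nondecreasing to its left; either way it is at most its value 0
    at \<open>t0\<close>.\<close>
  have "(u t \<bullet> u t) * exp (c * t) \<le> 0" if "c = (if t \<ge> t0 then - (2 * K) else 2 * K)" for c
  proof (cases "t \<ge> t0")
    case True
    have "(u t \<bullet> u t) * exp (c * t) \<le> (u t0 \<bullet> u t0) * exp (c * t0)"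
    proof (rule DERIV_nonpos_imp_nonincreasing[OF True, where f="\<lambda>s. (u s \<bullet> u s) * exp (c * s)"])
      fix s assume s: "t0 \<le> s" "s \<le> t"
      then have "s \<in> I" using seg by auto
      then show "\<exists>y. ((\<lambda>s. (u s \<bullet> u s) * exp (c * s)) has_real_derivative y) (at s) \<and> y \<le> 0"
        using d[of s c] b[of s] True that by (intro exI conjI) (auto intro!: mult_nonpos_nonneg)
    qed
    then show ?thesis by (simp add: t0)
  next
    case False
    have "(u t \<bullet> u t) * exp (c * t) \<le> (u t0 \<bullet> u t0) * exp (c * t0)"
    proof (rule DERIV_nonneg_imp_nondecreasing[where f="\<lambda>s. (u s \<bullet> u s) * exp (c * s)"])
      show "t \<le> t0" using False by simp
      fix s assume s: "t \<le> s" "s \<le> t0"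
      then have "s \<in> I" using seg by auto
      then show "\<exists>y. ((\<lambda>s. (u s \<bullet> u s) * exp (c * s)) has_real_derivative y) (at s) \<and> y \<ge> 0"
        using d[of s c] b[of s] False that by (intro exI conjI) (auto intro!: mult_nonneg_nonneg)
    qed
    then show ?thesis by (simp add: t0)
  qed
  then have "u t \<bullet> u t \<le> 0" by (simp add: mult_le_0_iff)
  then show ?thesis by (metis inner_eq_zero_iff inner_ge_zero order_antisym)
qed

text \<open>The second difference \<open>D\<close> over a small square is \<open>h * h\<close> times
  either mixed derivative at some interior point, by the mean value theorem applied twice in either
  order. This later turns commuting one-parameter groups into a vanishing bracket.\<close>

lemma mixed_derivatives_eq:
  fixes F F1 F2 F12 F21 :: "real \<Rightarrow> real \<Rightarrow> real"
  assumes F1: "\<And>t s. ((\<lambda>t. F t s) has_real_derivative F1 t s) (at t)"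
    and F12: "\<And>t s. ((\<lambda>s. F1 t s) has_real_derivative F12 t s) (at s)"
    and F2: "\<And>t s. ((\<lambda>s. F t s) has_real_derivative F2 t s) (at s)"
    and F21: "\<And>t s. ((\<lambda>t. F2 t s) has_real_derivative F21 t s) (at t)"
    and c12: "isCont (\<lambda>(t, s). F12 t s) (0, 0)" and c21: "isCont (\<lambda>(t, s). F21 t s) (0, 0)"
  shows "F12 0 0 = F21 0 0"
proof (rule ccontr)
  assume ne: "F12 0 0 \<noteq> F21 0 0"
  define e where "e = \<bar>F12 0 0 - F21 0 0\<bar> / 2"
  have e: "e > 0" using ne by (simp add: e_def)
  obtain d1 where d1: "d1 > 0" "\<And>x. dist x (0, 0) < d1 \<Longrightarrow> dist ((\<lambda>(t, s). F12 t s) x) (F12 0 0) < e"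
    using c12 e unfolding continuous_at_eps_delta by fastforce
  obtain d2 where d2: "d2 > 0" "\<And>x. dist x (0, 0) < d2 \<Longrightarrow> dist ((\<lambda>(t, s). F21 t s) x) (F21 0 0) < e"
    using c21 e unfolding continuous_at_eps_delta by fastforce
  define h where "h = min d1 d2 / 3"
  have h: "h > 0" using d1 d2 by (simp add: h_def)
  define D where "D = F h h - F h 0 - F 0 h + F 0 0"
  have "\<exists>t s. 0 < t \<and> t < h \<and> 0 < s \<and> s < h \<and> D = h * h * F12 t s"
  proof -
    have "\<exists>t. 0 < t \<and> t < h \<and> (F h h - F h 0) - (F 0 h - F 0 0) = (h - 0) * (F1 t h - F1 t 0)"
      by (rule MVT2[OF h, of "\<lambda>t. F t h - F t 0" "\<lambda>t. F1 t h - F1 t 0"]) (intro DERIV_diff F1)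
    then obtain t where t: "0 < t" "t < h" "D = h * (F1 t h - F1 t 0)" by (auto simp: D_def)
    have "\<exists>s. 0 < s \<and> s < h \<and> F1 t h - F1 t 0 = (h - 0) * F12 t s"
      by (rule MVT2[OF h]) (rule F12)
    then show ?thesis using t by auto
  qed
  then obtain t s where ts: "0 < t" "t < h" "0 < s" "s < h" "D = h * h * F12 t s" by blast
  have "\<exists>t s. 0 < t \<and> t < h \<and> 0 < s \<and> s < h \<and> D = h * h * F21 t s"
  proof -
    have "\<exists>s. 0 < s \<and> s < h \<and> (F h h - F 0 h) - (F h 0 - F 0 0) = (h - 0) * (F2 h s - F2 0 s)"
      by (rule MVT2[OF h, of "\<lambda>s. F h s - F 0 s" "\<lambda>s. F2 h s - F2 0 s"]) (intro DERIV_diff F2)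
    then obtain s where s: "0 < s" "s < h" "D = h * (F2 h s - F2 0 s)" by (auto simp: D_def)
    have "\<exists>t. 0 < t \<and> t < h \<and> F2 h s - F2 0 s = (h - 0) * F21 t s"
      by (rule MVT2[OF h]) (rule F21)
    then show ?thesis using s by auto
  qed
  then obtain t' s' where ts': "0 < t'" "t' < h" "0 < s'" "s' < h" "D = h * h * F21 t' s'" by blast
  have eq: "F12 t s = F21 t' s'" using ts(5) ts'(5) h by simp
  have near: "dist (a, b) (0, 0) < 3 * h" if "0 < a" "a < h" "0 < b" "b < h" for a b :: real
    using norm_Pair_le[of a b] that by (simp add: dist_norm)
  have "dist (F12 t s) (F12 0 0) < e" "dist (F21 t' s') (F21 0 0) < e"
    using d1(2)[of "(t, s)"] d2(2)[of "(t', s')"] near[OF ts(1-4)] near[OF ts'(1-4)]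
    by (auto simp: h_def)
  then show False using eq by (auto simp: dist_real_def e_def abs_if split: if_splits)
qed

lemma picard_lindelof:
  fixes f :: "'b::euclidean_space \<Rightarrow> 'b"
  assumes lip: "\<And>x y. x \<in> cball p r \<Longrightarrow> y \<in> cball p r \<Longrightarrow> norm (f x - f y) \<le> L * norm (x - y)"
    and B: "\<And>x. x \<in> cball p r \<Longrightarrow> norm (f x) \<le> B"
    and r: "r > 0" and T: "T > 0" and L: "L \<ge> 0" "T * L < 1" and TB: "T * B \<le> r"
  obtains u where "u 0 = p" "\<And>t. t \<in> {-T..T} \<Longrightarrow> u t \<in> cball p r"
    "\<And>t. t \<in> {-T..T} \<Longrightarrow> (u has_vector_derivative f (u t)) (at t within {-T..T})"
proof -
  \<comment> \<open>The projection onto the ball is 1-Lipschitz, so \<open>F\<close> is bounded and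
    Lipschitz on the whole space. The solution turns out to stay in the ball, where \<open>F\<close>
    is \<open>f\<close>.\<close>
  define F where "F = (\<lambda>x. f (closest_point (cball p r) x))"
  have cp: "closest_point (cball p r) x \<in> cball p r" for x
    using r by (intro closest_point_in_set) auto
  have Flip: "norm (F x - F y) \<le> L * norm (x - y)" for x y :: 'b
  proof -
    have "norm (F x - F y) \<le> L * norm (closest_point (cball p r) x - closest_point (cball p r) y)"
      unfolding F_def by (intro lip cp)
    also have "\<dots> \<le> L * norm (x - y)"
      using closest_point_lipschitz[of "cball p r" x y] r L(1)
      by (intro mult_left_mono) (auto simp: dist_norm)
    finally show ?thesis .
  qed
  have FB: "norm (F x) \<le> B" for x unfolding F_def by (rule B[OF cp])
  have B0: "B \<ge> 0" using FB[of p] norm_ge_zero order_trans by blast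
  have Fcont: "continuous_on UNIV F"
  proof (rule continuous_at_imp_continuous_on, rule ballI)
    fix x :: 'b
    have "((\<lambda>y. L * norm (y - x)) \<longlongrightarrow> 0) (at x)"
      by (rule tendsto_eq_intros refl | simp)+
    then have "((\<lambda>y. F y - F x) \<longlongrightarrow> 0) (at x)"
      by (rule Lim_null_comparison[rotated]) (simp add: Flip)
    then show "isCont F x" by (simp add: isCont_def LIM_zero_iff)
  qed
  \<comment> \<open>Clamping the time allows bounded continuous functions on the whole line to serve
    as the complete space for the contraction.\<close>
  define c where "c t = max (-T) (min T t)" for t :: real
  have cT: "c t \<in> {-T..T}" for t using T by (auto simp: c_def)
  have cid: "c t = t" if "t \<in> {-T..T}" for t using that by (auto simp: c_def)
  have ccont: "continuous_on UNIV c" unfolding c_def by (intro continuous_intros)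
  \<comment> \<open>The Picard operator. The difference of two integrals from \<open>-T\<close> is
    the signed integral from 0, also for negative \<open>t\<close>.\<close>
  define P where "P u t = p + (integral {-T..t} (\<lambda>s. F (u s)) - integral {-T..0} (\<lambda>s. F (u s)))"
    for u :: "real \<Rightarrow> 'b" and t
  have Pd: "(P u has_vector_derivative F (u t)) (at t within {-T..T})"
    if "continuous_on {-T..T} u" "t \<in> {-T..T}" for u t
  proof -
    have "continuous_on {-T..T} (\<lambda>s. F (u s))"
      using continuous_on_compose2[OF Fcont that(1)] by auto
    from integral_has_vector_derivative[OF this that(2)]
    have "((\<lambda>t. p + (integral {-T..t} (\<lambda>s. F (u s)) - integral {-T..0} (\<lambda>s. F (u s)))) has_vector_derivative 0 + (F (u t) - 0)) (at t within {-T..T})"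
      by (intro has_vector_derivative_add has_vector_derivative_diff has_vector_derivative_const)
    then show ?thesis unfolding P_def[abs_def] by simp
  qed
  have P0: "P u 0 = p" for u by (simp add: P_def)
  have Pcont: "continuous_on {-T..T} (P u)" if "continuous_on {-T..T} u" for u
    using Pd[OF that] has_vector_derivative_continuous continuous_on_eq_continuous_within by blast
  have bnd: "norm (g t - g 0) \<le> C * T"
    if "\<And>t. t \<in> {-T..T} \<Longrightarrow> (g has_vector_derivative g' t) (at t within {-T..T})"
      "\<And>t. t \<in> {-T..T} \<Longrightarrow> norm (g' t) \<le> C" "t \<in> {-T..T}" for g g' :: "real \<Rightarrow> 'b" and C t
  proof -
    have C: "C \<ge> 0" using order_trans[OF norm_ge_zero that(2)[of 0]] T by simp
    have "norm (g t - g 0) \<le> C * norm (t - 0)"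
    proof (rule differentiable_bound[of "{-T..T}" g "\<lambda>t h. h *\<^sub>R g' t"])
      show "onorm (\<lambda>h. h *\<^sub>R g' x) \<le> C" if "x \<in> {-T..T}" for x
        using that \<open>\<And>t. t \<in> {-T..T} \<Longrightarrow> norm (g' t) \<le> C\<close>[OF that]
        by (intro onorm_le) (simp, metis abs_ge_zero mult.commute mult_left_mono)
    qed (use that T in \<open>auto simp: has_vector_derivative_def\<close>)
    also have "\<dots> \<le> C * T" using that(3) C by (intro mult_left_mono) auto
    finally show ?thesis .
  qed
  have PB: "norm (P u t - p) \<le> B * T" if "continuous_on {-T..T} u" "t \<in> {-T..T}" for u t
    using bnd[OF Pd[OF that(1)] FB that(2)] by (simp add: P0)
  define Q where "Q u = Bcontfun (\<lambda>t. P (apply_bcontfun u) (c t))" for u :: "real \<Rightarrow>\<^sub>C 'b"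
  have uc: "continuous_on {-T..T} (apply_bcontfun u)" for u :: "real \<Rightarrow>\<^sub>C 'b"
    by (intro continuous_on_apply_bcontfun continuous_on_id)
  have "(\<lambda>t. P (apply_bcontfun u) (c t)) \<in> bcontfun" for u :: "real \<Rightarrow>\<^sub>C 'b"
  proof (rule bcontfun_normI)
    show "continuous_on UNIV (\<lambda>t. P (apply_bcontfun u) (c t))"
      by (rule continuous_on_compose2[OF Pcont[OF uc] ccont]) (use cT in auto)
    show "norm (P (apply_bcontfun u) (c t)) \<le> B * T + norm p" for t
      using PB[OF uc cT, of u t] norm_triangle_ineq2[of "P (apply_bcontfun u) (c t)" p] by simp
  qed
  then have Qapp: "apply_bcontfun (Q u) t = P (apply_bcontfun u) (c t)" for u t
    by (simp add: Q_def Bcontfun_inverse)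
  have "\<exists>!u. u \<in> (UNIV :: (real \<Rightarrow>\<^sub>C 'b) set) \<and> Q u = u"
  proof (rule Banach_fix)
    show "complete (UNIV :: (real \<Rightarrow>\<^sub>C 'b) set)" by (rule complete_UNIV)
    show "0 \<le> T * L" "T * L < 1" using T L by auto
    show "dist (Q u) (Q v) \<le> (T * L) * dist u v" for u v
    proof (rule dist_bound)
      fix t
      let ?g = "\<lambda>t. P (apply_bcontfun u) t - P (apply_bcontfun v) t"
      have "norm (?g (c t) - ?g 0) \<le> (L * dist u v) * T"
      proof (rule bnd[OF _ _ cT])
        show "(?g has_vector_derivative F (apply_bcontfun u s) - F (apply_bcontfun v s)) (at s within {-T..T})"
          if "s \<in> {-T..T}" for s
          by (intro has_vector_derivative_diff Pd uc that)
        show "norm (F (apply_bcontfun u s) - F (apply_bcontfun v s)) \<le> L * dist u v" for s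
          using Flip[of "apply_bcontfun u s" "apply_bcontfun v s"]
            mult_left_mono[OF dist_bounded[of u s v] L(1)] by (simp add: dist_norm)
      qed
      then show "dist (apply_bcontfun (Q u) t) (apply_bcontfun (Q v) t) \<le> T * L * dist u v"
        by (simp add: Qapp P0 dist_norm algebra_simps)
    qed
  qed auto
  then obtain u where u: "Q u = u" by auto
  define w where "w = P (apply_bcontfun u)"
  have uw: "apply_bcontfun u t = w t" if "t \<in> {-T..T}" for t
    using Qapp[of u t] cid[OF that] by (simp add: u w_def)
  have wB: "w t \<in> cball p r" if "t \<in> {-T..T}" for t
    using PB[OF uc that, of u] TB by (simp add: w_def dist_norm norm_minus_commute mult.commute)
  have Fw: "F (w t) = f (w t)" if "t \<in> {-T..T}" for t
    using closest_point_self[OF wB[OF that]] by (simp add: F_def)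
  show ?thesis
  proof (rule that)
    show "w 0 = p" by (simp add: w_def P0)
    show "w t \<in> cball p r" if "t \<in> {-T..T}" for t using wB[OF that] .
    show "(w has_vector_derivative f (w t)) (at t within {-T..T})" if "t \<in> {-T..T}" for t
      using Pd[OF uc that, of u] uw[OF that] Fw[OF that] by (simp add: w_def)
  qed
qed

section \<open>Hadamard's lemma by integration along rays\<close>

lemma has_derivative_ray_integral:
  fixes f :: "'a::euclidean_space \<Rightarrow> 'b::euclidean_space"
  assumes f: "Ck_on (Suc 0) (ball p r) f" and y: "y \<in> ball p r"
  shows "((\<lambda>y. integral {0..1} (\<lambda>t. t ^ j *\<^sub>R f (p + t *\<^sub>R (y - p)))) has_derivative
    (\<lambda>v. integral {0..1} (\<lambda>t. t ^ Suc j *\<^sub>R frechet_derivative f (at (p + t *\<^sub>R (y - p))) v))) (at y)"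
proof -
  have inb: "p + t *\<^sub>R (y - p) \<in> ball p r" if "y \<in> ball p r" "t \<in> {0..1}" for y t
  proof -
    have "norm (t *\<^sub>R (y - p)) \<le> norm (y - p)"
      using that(2) mult_left_le_one_le[of "norm (y - p)" t] by simp
    then show ?thesis using that(1) by (simp add: dist_norm norm_minus_commute)
  qed
  let ?D = "\<lambda>y t v. t ^ Suc j *\<^sub>R frechet_derivative f (at (p + t *\<^sub>R (y - p))) v"
  have bl: "bounded_linear (?D y t)" if "y \<in> ball p r" "t \<in> {0..1}" for y t
    using f inb[OF that] by (intro bounded_linear_const_scaleR has_derivative_bounded_linear[OF Ck_on_has_derivative[OF f]])
  have cont: "continuous_on (ball p r \<times> {0..1}) (\<lambda>(y, t). ?D y t v)" for v
    unfolding split_def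
  proof (intro continuous_on_scaleR continuous_on_power continuous_on_snd continuous_on_id)
    have df: "continuous_on (ball p r) (\<lambda>x. frechet_derivative f (at x) v)"
      using f by simp
    show "continuous_on (ball p r \<times> {0..1}) (\<lambda>x. frechet_derivative f (at (p + snd x *\<^sub>R (fst x - p))) v)"
      by (rule continuous_on_compose2[OF df])
        (auto intro!: continuous_intros inb simp del: mem_ball atLeastAtMost_iff)
  qed
  have contB: "continuous_on (ball p r \<times> cbox 0 1) (\<lambda>(y, t). Blinfun (?D y t))"
    unfolding split_def
  proof (rule continuous_on_blinfun_componentwise)
    fix v :: 'a
    show "continuous_on (ball p r \<times> cbox 0 1) (\<lambda>x. blinfun_apply (Blinfun (?D (fst x) (snd x))) v)"
    proof (rule continuous_on_eq)
      show "continuous_on (ball p r \<times> cbox 0 1) (\<lambda>x. ?D (fst x) (snd x) v)"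
        using cont[of v] by (simp add: split_def)
      show "?D (fst x) (snd x) v = blinfun_apply (Blinfun (?D (fst x) (snd x))) v"
        if "x \<in> ball p r \<times> cbox 0 1" for x
      proof -
        have "bounded_linear (?D (fst x) (snd x))" using bl that by (auto simp del: mem_ball)
        from bounded_linear_Blinfun_apply[OF this] show ?thesis by simp
      qed
    qed
  qed
  have "((\<lambda>y. integral (cbox 0 1) (\<lambda>t. t ^ j *\<^sub>R f (p + t *\<^sub>R (y - p)))) has_derivative
      blinfun_apply (integral (cbox 0 1) (\<lambda>t. Blinfun (?D y t)))) (at y within ball p r)"
  proof (rule leibniz_rule[OF _ _ contB y convex_ball])
    fix y :: 'a and t :: real assume yt: "y \<in> ball p r" "t \<in> cbox 0 1"
    have "((\<lambda>y. t ^ j *\<^sub>R f (p + t *\<^sub>R (y - p))) has_derivative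
        (\<lambda>v. t ^ j *\<^sub>R frechet_derivative f (at (p + t *\<^sub>R (y - p))) (t *\<^sub>R v))) (at y)"
    proof (rule has_derivative_scaleR_right)
      have 1: "((\<lambda>y. p + t *\<^sub>R (y - p)) has_derivative (\<lambda>v. t *\<^sub>R v)) (at y)"
        by (auto intro!: derivative_eq_intros)
      have 2: "(f has_derivative frechet_derivative f (at (p + t *\<^sub>R (y - p)))) (at (p + t *\<^sub>R (y - p)))"
        using inb yt by (intro Ck_on_has_derivative[OF f]) auto
      show "((\<lambda>y. f (p + t *\<^sub>R (y - p))) has_derivative
          (\<lambda>v. frechet_derivative f (at (p + t *\<^sub>R (y - p))) (t *\<^sub>R v))) (at y)"
        using diff_chain_at[OF 1 2] by (simp add: o_def)
    qed
    moreover have "linear (frechet_derivative f (at (p + t *\<^sub>R (y - p))))"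
      using f inb yt by (intro linear_frechet_derivative) auto
    ultimately show "((\<lambda>y. t ^ j *\<^sub>R f (p + t *\<^sub>R (y - p))) has_derivative blinfun_apply (Blinfun (?D y t))) (at y within ball p r)"
      using bl[of y t] yt
      by (simp add: bounded_linear_Blinfun_apply linear_cmul has_derivative_at_withinI mult.commute)
  next
    fix y :: 'a assume "y \<in> ball p r"
    then have "continuous_on {0..1} (\<lambda>t. t ^ j *\<^sub>R f (p + t *\<^sub>R (y - p)))"
      by (intro continuous_intros continuous_on_compose2[OF Ck_on_imp_continuous_on[OF f]]) (use inb in auto)
    then show "(\<lambda>t. t ^ j *\<^sub>R f (p + t *\<^sub>R (y - p))) integrable_on cbox 0 1"
      using integrable_continuous_interval by auto
  qed
  moreover have "blinfun_apply (integral (cbox 0 1) (\<lambda>t. Blinfun (?D y t))) = (\<lambda>v. integral (cbox 0 1) (\<lambda>t. ?D y t v))"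
  proof
    fix v
    have "continuous_on (cbox 0 1) (\<lambda>t. Blinfun (?D y t))"
      using continuous_on_compose2[OF contB, of "cbox 0 1" "\<lambda>t. (y, t)"] y
      by (force intro: continuous_on_Pair continuous_on_const continuous_on_id)
    then have "(\<lambda>t. Blinfun (?D y t)) integrable_on cbox 0 1"
      by (rule integrable_continuous)
    then have "blinfun_apply (integral (cbox 0 1) (\<lambda>t. Blinfun (?D y t))) v =
        integral (cbox 0 1) (\<lambda>t. blinfun_apply (Blinfun (?D y t)) v)"
      by (rule blinfun_apply_integral)
    also have "\<dots> = integral (cbox 0 1) (\<lambda>t. ?D y t v)"
      using bl y by (intro integral_cong) (auto simp: bounded_linear_Blinfun_apply)
    finally show "blinfun_apply (integral (cbox 0 1) (\<lambda>t. Blinfun (?D y t))) v = integral (cbox 0 1) (\<lambda>t. ?D y t v)" .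
  qed
  ultimately show ?thesis
    using y by (simp add: at_within_open[OF y open_ball])
qed

text \<open>Differentiating under the integral, the chain rule for
  \<open>p + t *\<^sub>R (y - p)\<close> contributes one more factor \<open>t\<close>. Keeping the
  exponent \<open>j\<close> general closes the family under differentiation.\<close>

lemma Ck_on_ray_integral:
  fixes f :: "'a::euclidean_space \<Rightarrow> 'b::euclidean_space"
  assumes "\<And>k. Ck_on k (ball p r) f"
  shows "Ck_on k (ball p r) (\<lambda>y. integral {0..1} (\<lambda>t. t ^ j *\<^sub>R f (p + t *\<^sub>R (y - p))))"
  using assms
proof (induction k arbitrary: j f)
  case 0
  show ?case unfolding Ck_on.simps
    by (rule continuous_at_imp_continuous_on)
      (use has_derivative_continuous[OF has_derivative_ray_integral[OF 0]] in blast)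
next
  case (Suc k)
  show ?case
    by (rule Ck_on_SucI[OF open_ball has_derivative_ray_integral[OF Suc.prems]], assumption)
      (rule Suc.IH, use Suc.prems Ck_on.simps(2) in blast)
qed

text \<open>The fundamental theorem of calculus along the ray from \<open>p\<close> to
  \<open>y\<close>; \<open>g i\<close> is the average of the i-th partial derivative over that ray.
  It is what reduces a derivation at \<open>p\<close> to a directional derivative.\<close>

lemma hadamard:
  fixes f :: "'a::euclidean_space \<Rightarrow> real"
  assumes f: "\<And>k. Ck_on k (ball p r) f" and r: "r > 0"
  obtains g where "\<And>i k. Ck_on k (ball p r) (g i)"
    "\<And>i. g i p = frechet_derivative f (at p) i"
    "\<And>y. y \<in> ball p r \<Longrightarrow> f y = f p + (\<Sum>i\<in>Basis. ((y - p) \<bullet> i) * g i y)"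
proof
  let ?g = "\<lambda>i y. integral {0..1} (\<lambda>t. t ^ 0 *\<^sub>R frechet_derivative f (at (p + t *\<^sub>R (y - p))) i)"
  show "Ck_on k (ball p r) (?g i)" for i k
    by (rule Ck_on_ray_integral) (use f Ck_on.simps(2) in blast)
  show "?g i p = frechet_derivative f (at p) i" for i by simp
  fix y assume y: "y \<in> ball p r"
  have inb: "p + t *\<^sub>R (y - p) \<in> ball p r" if "t \<in> {0..1}" for t
  proof -
    have "norm (t *\<^sub>R (y - p)) \<le> norm (y - p)"
      using that mult_left_le_one_le[of "norm (y - p)" t] by simp
    then show ?thesis using y by (simp add: dist_norm norm_minus_commute)
  qed
  have "((\<lambda>t. frechet_derivative f (at (p + t *\<^sub>R (y - p))) (y - p)) has_integral
      f (p + 1 *\<^sub>R (y - p)) - f (p + 0 *\<^sub>R (y - p))) {0..1}"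
  proof (rule fundamental_theorem_of_calculus)
    fix t :: real assume t: "t \<in> {0..1}"
    have "((\<lambda>t. p + t *\<^sub>R (y - p)) has_derivative (\<lambda>h. h *\<^sub>R (y - p))) (at t)"
      by (auto intro!: derivative_eq_intros)
    from diff_chain_at[OF this Ck_on_has_derivative[OF f inb[OF t]]]
    have "((\<lambda>t. f (p + t *\<^sub>R (y - p))) has_derivative
        (\<lambda>h. frechet_derivative f (at (p + t *\<^sub>R (y - p))) (h *\<^sub>R (y - p)))) (at t)"
      by (simp add: o_def)
    moreover have "linear (frechet_derivative f (at (p + t *\<^sub>R (y - p))))"
      using f[of "Suc 0"] inb[OF t] by (intro linear_frechet_derivative) auto
    ultimately show "((\<lambda>t. f (p + t *\<^sub>R (y - p))) has_vector_derivative
        frechet_derivative f (at (p + t *\<^sub>R (y - p))) (y - p)) (at t within {0..1})"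
      by (simp add: has_vector_derivative_def linear_cmul has_derivative_at_withinI)
  qed simp
  then have "f y - f p = integral {0..1} (\<lambda>t. frechet_derivative f (at (p + t *\<^sub>R (y - p))) (y - p))"
    by (simp add: integral_unique)
  also have "\<dots> = integral {0..1} (\<lambda>t. \<Sum>i\<in>Basis. ((y - p) \<bullet> i) * frechet_derivative f (at (p + t *\<^sub>R (y - p))) i)"
  proof (rule integral_cong)
    fix t :: real assume t: "t \<in> {0..1}"
    have "linear (frechet_derivative f (at (p + t *\<^sub>R (y - p))))"
      using f[of "Suc 0"] inb[OF t] by (intro linear_frechet_derivative) auto
    from linear_expand_Basis[OF this, of "y - p"]
    show "frechet_derivative f (at (p + t *\<^sub>R (y - p))) (y - p) =
      (\<Sum>i\<in>Basis. ((y - p) \<bullet> i) * frechet_derivative f (at (p + t *\<^sub>R (y - p))) i)" by simp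
  qed
  also have "\<dots> = (\<Sum>i\<in>Basis. ((y - p) \<bullet> i) * ?g i y)"
  proof -
    have "(\<lambda>t. frechet_derivative f (at (p + t *\<^sub>R (y - p))) i) integrable_on {0..1}" for i
    proof (rule integrable_continuous_interval)
      have "continuous_on (ball p r) (\<lambda>x. frechet_derivative f (at x) i)"
        using f[of "Suc 0"] by auto
      then show "continuous_on {0..1} (\<lambda>t. frechet_derivative f (at (p + t *\<^sub>R (y - p))) i)"
        by (rule continuous_on_compose2) (use inb in \<open>auto intro!: continuous_intros\<close>)
    qed
    then show ?thesis by (subst integral_sum) (auto intro!: integrable_on_mult_right)
  qed
  finally show "f y = f p + (\<Sum>i\<in>Basis. ((y - p) \<bullet> i) * ?g i y)" by simp
qed

section \<open>Smooth functions and vector fields in charts\<close>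

lemma smooth_atlas_chart:
  assumes "smooth_atlas A" "(U, c) \<in> A"
  shows "open U" "open (c ` U)" "inj_on c U" "continuous_on U c" "continuous_on (c ` U) (inv_into U c)"
  using assms unfolding smooth_atlas_def homeomorphism_def
  by (force intro: inj_on_inverseI)+

lemma smooth_atlas_inv:
  assumes "smooth_atlas A" "(U, c) \<in> A"
  shows "x \<in> U \<Longrightarrow> inv_into U c (c x) = x" "y \<in> c ` U \<Longrightarrow> inv_into U c y \<in> U"
    "y \<in> c ` U \<Longrightarrow> c (inv_into U c y) = y"
  using smooth_atlas_chart(3)[OF assms] by (auto intro: inv_into_into f_inv_into_f)

lemma smooth_atlas_cover:
  assumes "smooth_atlas A" obtains V d where "(V, d) \<in> A" "x \<in> V"
proof -
  have "x \<in> (\<Union>(V, d)\<in>A. V)" using assms unfolding smooth_atlas_def by simp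
  then show ?thesis using that by auto
qed

lemma chart_image_Int:
  assumes "smooth_atlas A" "(U, c) \<in> A"
  shows "c ` (U \<inter> S) = {y \<in> c ` U. inv_into U c y \<in> S}"
proof (intro equalityI subsetI)
  fix y assume "y \<in> {y \<in> c ` U. inv_into U c y \<in> S}"
  then have "y = c (inv_into U c y)" "inv_into U c y \<in> U \<inter> S"
    using smooth_atlas_inv(2,3)[OF assms] by auto
  then show "y \<in> c ` (U \<inter> S)" by (rule image_eqI)
qed (auto simp: smooth_atlas_inv(1)[OF assms])

lemma open_chart_preimage:
  assumes "smooth_atlas A" "(U, c) \<in> A" "open S"
  shows "open {y \<in> c ` U. inv_into U c y \<in> S}"
  using continuous_open_preimage[OF smooth_atlas_chart(5,2)[OF assms(1,2)] assms(3)]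
  by (simp add: vimage_def Int_def)

text \<open>Smooth maps out of Euclidean domains need charts on the target only. Maps between
  manifolds are reduced to this case by composing with inverse charts, which keeps products and
  compositions free of chart pairs.\<close>

definition smooth_into ::
  "('a::topological_space, 'b::euclidean_space) chart set \<Rightarrow> 'e::euclidean_space set \<Rightarrow> ('e \<Rightarrow> 'a) \<Rightarrow> bool" where
  "smooth_into A N F \<longleftrightarrow> open N \<and> continuous_on N F \<and>
     (\<forall>(V, d)\<in>A. \<forall>k. Ck_on k {y \<in> N. F y \<in> V} (\<lambda>y. d (F y)))"

lemma smooth_intoD:
  assumes "smooth_into A N F"
  shows "open N" "continuous_on N F" "(V, d) \<in> A \<Longrightarrow> Ck_on k {y \<in> N. F y \<in> V} (\<lambda>y. d (F y))"
  using assms by (auto simp: smooth_into_def)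

lemma smooth_into_open:
  assumes "smooth_into A N F" "open V"
  shows "open {y \<in> N. F y \<in> V}"
  using continuous_open_preimage[OF smooth_intoD(2,1)[OF assms(1)] assms(2)]
  by (simp add: vimage_def Int_def)

lemma smooth_into_subset:
  assumes "smooth_into A N F" "open T" "T \<subseteq> N"
  shows "smooth_into A T F"
proof -
  have "Ck_on k {y \<in> T. F y \<in> V} (\<lambda>y. d (F y))" if "(V, d) \<in> A" for V d k
    by (rule Ck_on_subset[OF smooth_intoD(3)[OF assms(1) that]]) (use assms(3) in auto)
  moreover have "continuous_on T F"
    using smooth_intoD(2)[OF assms(1)] assms(3) by (rule continuous_on_subset)
  ultimately show ?thesis using assms(2) unfolding smooth_into_def by auto
qed

lemma smooth_into_local:
  assumes "smooth_atlas A" "\<And>y. y \<in> N \<Longrightarrow> \<exists>T. y \<in> T \<and> smooth_into A T F" "open N"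
  shows "smooth_into A N F"
proof -
  have "isCont F y" if "y \<in> N" for y
    using assms(2)[OF that] smooth_intoD(1,2) continuous_on_eq_continuous_at by blast
  then have cont: "continuous_on N F" by (simp add: continuous_at_imp_continuous_on)
  have "Ck_on k {y \<in> N. F y \<in> V} (\<lambda>y. d (F y))" if Vd: "(V, d) \<in> A" for V d k
  proof (rule Ck_on_local)
    fix y assume y: "y \<in> {y \<in> N. F y \<in> V}"
    obtain T where T: "y \<in> T" "smooth_into A T F" using assms(2) y by auto
    have "open {y \<in> T. F y \<in> V}"
      by (rule smooth_into_open[OF T(2) smooth_atlas_chart(1)[OF assms(1) Vd]])
    moreover have "Ck_on k {y \<in> T. F y \<in> V} (\<lambda>y. d (F y))"
      by (rule smooth_intoD(3)[OF T(2) Vd])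
    ultimately show "\<exists>T. open T \<and> y \<in> T \<and> Ck_on k T (\<lambda>y. d (F y))"
      using T(1) y by blast
  qed
  with cont assms(3) show ?thesis unfolding smooth_into_def by auto
qed

lemma smooth_into_const:
  assumes "smooth_atlas A" "open N" shows "smooth_into A N (\<lambda>y. g)"
  unfolding smooth_into_def using assms(2) by (auto intro: Ck_on_const)

lemma smooth_into_cong:
  assumes "smooth_atlas A" "smooth_into A N F" "\<And>y. y \<in> N \<Longrightarrow> F y = F' y"
  shows "smooth_into A N F'"
proof -
  have "Ck_on k {y \<in> N. F' y \<in> V} (\<lambda>y. d (F' y))" if "(V, d) \<in> A" for V d k
  proof (rule Ck_on_cong)
    have eq: "{y \<in> N. F' y \<in> V} = {y \<in> N. F y \<in> V}" using assms(3) by auto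
    show "open {y \<in> N. F' y \<in> V}"
      unfolding eq by (rule smooth_into_open[OF assms(2) smooth_atlas_chart(1)[OF assms(1) that]])
    show "Ck_on k {y \<in> N. F' y \<in> V} (\<lambda>y. d (F y))"
      unfolding eq by (rule smooth_intoD(3)[OF assms(2) that])
  qed (use assms(3) in auto)
  moreover have "continuous_on N F'"
    using smooth_intoD(2)[OF assms(2)] assms(3) by (simp cong: continuous_on_cong)
  ultimately show ?thesis using smooth_intoD(1)[OF assms(2)] unfolding smooth_into_def by auto
qed

lemma smooth_into_inv_chart:
  assumes "smooth_atlas A" "(U, c) \<in> A"
  shows "smooth_into A (c ` U) (inv_into U c)"
proof -
  have "Ck_on k {y \<in> c ` U. inv_into U c y \<in> V} (\<lambda>y. d (inv_into U c y))" if "(V, d) \<in> A" for V d k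
    using assms that unfolding chart_image_Int[OF assms, symmetric] smooth_atlas_def smooth_on_def
    by (force simp: o_def)
  then show ?thesis
    using smooth_atlas_chart[OF assms] unfolding smooth_into_def by auto
qed

lemma smooth_into_comp:
  assumes A: "smooth_atlas A" and F: "smooth_into A N F" and M: "open M" "\<And>k. Ck_on k M h" "h ` M \<subseteq> N"
  shows "smooth_into A M (\<lambda>y. F (h y))"
proof -
  have hc: "continuous_on M h" using M(2)[of 0] by simp
  have cont: "continuous_on M (\<lambda>y. F (h y))"
    by (rule continuous_on_compose2[OF smooth_intoD(2)[OF F] hc M(3)])
  have "Ck_on k {y \<in> M. F (h y) \<in> V} (\<lambda>y. d (F (h y)))" if Vd: "(V, d) \<in> A" for V d k
  proof -
    have oV: "open V" using smooth_atlas_chart(1)[OF A Vd] .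
    show ?thesis
    proof (rule Ck_on_compose[OF _ smooth_into_open[OF F oV] _ smooth_intoD(3)[OF F Vd]])
      show "open {y \<in> M. F (h y) \<in> V}"
        using continuous_open_preimage[OF cont M(1) oV] by (simp add: vimage_def Int_def)
      show "Ck_on k {y \<in> M. F (h y) \<in> V} h" by (rule Ck_on_subset[OF M(2)]) auto
    qed (use M(3) in auto)
  qed
  with cont M(1) show ?thesis unfolding smooth_into_def by auto
qed

lemma smooth_map_smooth_into:
  assumes A: "smooth_atlas A" and B: "smooth_atlas B" and \<phi>: "smooth_map A B \<phi>" and F: "smooth_into A N F"
  shows "smooth_into B N (\<lambda>y. \<phi> (F y))"
proof (rule smooth_into_local[OF B _ smooth_intoD(1)[OF F]])
  have \<phi>c: "continuous_on UNIV \<phi>" using \<phi> by (simp add: smooth_map_def)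
  fix y assume y: "y \<in> N"
  obtain U c where U: "(U, c) \<in> A" "F y \<in> U" using smooth_atlas_cover[OF A] .
  note oU = smooth_atlas_chart(1)[OF A U(1)]
  let ?T = "{y \<in> N. F y \<in> U}"
  have T: "smooth_into A ?T F"
    by (rule smooth_into_subset[OF F smooth_into_open[OF F oU]]) auto
  have Fc: "continuous_on ?T (\<lambda>y. \<phi> (F y))"
    by (rule continuous_on_compose2[OF \<phi>c smooth_intoD(2)[OF T]]) auto
  have "Ck_on k {y \<in> ?T. \<phi> (F y) \<in> V} (\<lambda>y. d (\<phi> (F y)))" if Vd: "(V, d) \<in> B" for V d k
  proof -
    note oV = smooth_atlas_chart(1)[OF B Vd]
    let ?S = "{y \<in> ?T. \<phi> (F y) \<in> V}"
    have oS: "open ?S"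
      using continuous_open_preimage[OF Fc smooth_intoD(1)[OF T] oV] by (simp add: vimage_def Int_def conj_assoc)
    have 1: "Ck_on k (c ` (U \<inter> \<phi> -` V)) (d \<circ> \<phi> \<circ> inv_into U c)"
      using \<phi> U(1) Vd by (force simp: smooth_map_def smooth_on_def)
    have 2: "open (c ` (U \<inter> \<phi> -` V))"
      unfolding chart_image_Int[OF A U(1)]
      using \<phi>c oV by (intro open_chart_preimage[OF A U(1)]) (simp add: open_vimage)
    have 3: "Ck_on k ?S (\<lambda>y. c (F y))"
      using smooth_intoD(3)[OF F U(1)] by (rule Ck_on_subset) auto
    \<comment> \<open>In coordinates the composite factors through the source chart
      \<open>c\<close>: the coordinate form of \<open>\<phi>\<close> after that of
      \<open>F\<close>.\<close>
    have "Ck_on k ?S (\<lambda>y. (d \<circ> \<phi> \<circ> inv_into U c) (c (F y)))"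
      by (rule Ck_on_compose[OF oS 2 3 1]) auto
    then show ?thesis
      by (rule Ck_on_cong[OF oS, rotated]) (simp add: smooth_atlas_inv(1)[OF A U(1)])
  qed
  with Fc smooth_intoD(1)[OF T] have "smooth_into B ?T (\<lambda>y. \<phi> (F y))"
    unfolding smooth_into_def by blast
  then show "\<exists>T. y \<in> T \<and> smooth_into B T (\<lambda>y. \<phi> (F y))"
    using y U(2) by (intro exI[of _ ?T]) simp
qed

lemma smooth_atlas_std: "smooth_atlas (std_atlas :: ('b::euclidean_space, 'b) chart set)"
  by (auto simp: smooth_atlas_def std_atlas_def homeomorphism_def smooth_on_def o_def inv_id id_def
      intro: Ck_on_id continuous_on_id)

lemma smooth_into_std: "smooth_into std_atlas N f \<longleftrightarrow> open N \<and> (\<forall>k. Ck_on k N f)"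
  by (auto simp: smooth_into_def std_atlas_def dest: Ck_on_imp_continuous_on[of 0])

text \<open>The bridge between the chart-pair definition and \<open>smooth_into\<close>. Continuity
  need not be checked separately because charts are homeomorphisms onto open sets.\<close>

lemma smooth_map_chart_iff:
  fixes A :: "('a::t2_space, 'b::euclidean_space) chart set"
  assumes A: "smooth_atlas A" and B: "smooth_atlas B"
  shows "smooth_map A B \<phi> \<longleftrightarrow> (\<forall>(U, c)\<in>A. smooth_into B (c ` U) (\<lambda>y. \<phi> (inv_into U c y)))"
proof
  assume "smooth_map A B \<phi>"
  then show "\<forall>(U, c)\<in>A. smooth_into B (c ` U) (\<lambda>y. \<phi> (inv_into U c y))"
    using smooth_map_smooth_into[OF A B _ smooth_into_inv_chart[OF A]] by auto
next
  assume *: "\<forall>(U, c)\<in>A. smooth_into B (c ` U) (\<lambda>y. \<phi> (inv_into U c y))"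
  have "isCont \<phi> x" for x
  proof -
    obtain U c where U: "(U, c) \<in> A" "x \<in> U" using smooth_atlas_cover[OF A] .
    have "smooth_into B (c ` U) (\<lambda>y. \<phi> (inv_into U c y))" using * U(1) by auto
    from continuous_on_compose2[OF smooth_intoD(2)[OF this] smooth_atlas_chart(4)[OF A U(1)]]
    have "continuous_on U (\<lambda>x. \<phi> (inv_into U c (c x)))" by simp
    then have "continuous_on U \<phi>"
      by (simp add: smooth_atlas_inv(1)[OF A U(1)] cong: continuous_on_cong)
    then show ?thesis
      using U(2) smooth_atlas_chart(1)[OF A U(1)] continuous_on_eq_continuous_at by blast
  qed
  moreover have "smooth_on (c ` (U \<inter> \<phi> -` V)) (d \<circ> \<phi> \<circ> inv_into U c)"
    if "(U, c) \<in> A" "(V, d) \<in> B" for U c V d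
    using * that smooth_intoD(3)[of B "c ` U" "\<lambda>y. \<phi> (inv_into U c y)" V d]
    unfolding chart_image_Int[OF A that(1)] smooth_on_def by (auto simp: o_def)
  ultimately show "smooth_map A B \<phi>"
    unfolding smooth_map_def by (auto intro: continuous_at_imp_continuous_on)
qed

lemma smooth_map_std_iff:
  assumes B: "smooth_atlas B"
  shows "smooth_map std_atlas B \<gamma> \<longleftrightarrow> smooth_into B UNIV \<gamma>"
  unfolding smooth_map_chart_iff[OF smooth_atlas_std B] by (simp add: std_atlas_def inv_id)

lemma smooth_fun_iff:
  fixes A :: "('a::t2_space, 'b::euclidean_space) chart set"
  assumes A: "smooth_atlas A"
  shows "smooth_fun A f \<longleftrightarrow> (\<forall>(U, c)\<in>A. \<forall>k. Ck_on k (c ` U) (\<lambda>y. f (inv_into U c y)))"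
  unfolding smooth_map_chart_iff[OF A smooth_atlas_std] smooth_into_std
  using smooth_atlas_chart(2)[OF A] by blast

lemma smooth_fun_into:
  assumes "smooth_atlas A" "smooth_fun A f" "smooth_into A N F"
  shows "Ck_on k N (\<lambda>y. f (F y))"
  using smooth_map_smooth_into[OF assms(1) smooth_atlas_std assms(2,3)] by (simp add: smooth_into_std)

lemma smooth_fun_continuous: "smooth_fun A f \<Longrightarrow> continuous_on UNIV f"
  by (simp add: smooth_map_def)

lemma smooth_fun_mult:
  fixes A :: "('a::t2_space, 'b::euclidean_space) chart set"
  assumes "smooth_atlas A" "smooth_fun A f" "smooth_fun A g"
  shows "smooth_fun A (f * g)"
  using assms(2,3) smooth_atlas_chart(2)[OF assms(1)] unfolding smooth_fun_iff[OF assms(1)]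
  by (fastforce intro: Ck_on_mult)

lemma smooth_fun_add:
  fixes A :: "('a::t2_space, 'b::euclidean_space) chart set"
  assumes "smooth_atlas A" "smooth_fun A f" "smooth_fun A g"
  shows "smooth_fun A (f + g)"
  using assms(2,3) smooth_atlas_chart(2)[OF assms(1)] unfolding smooth_fun_iff[OF assms(1)]
  by (fastforce intro: Ck_on_add)

lemma smooth_fun_const:
  fixes A :: "('a::t2_space, 'b::euclidean_space) chart set"
  assumes "smooth_atlas A" shows "smooth_fun A (\<lambda>x. r)"
  unfolding smooth_fun_iff[OF assms] by (auto intro: Ck_on_const)

section \<open>Cut-off functions and tangent vectors\<close>

definition bump_ext :: "'a set \<Rightarrow> ('a \<Rightarrow> 'b::euclidean_space) \<Rightarrow> 'b \<Rightarrow> real \<Rightarrow> ('b \<Rightarrow> real) \<Rightarrow> 'a \<Rightarrow> real" where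
  "bump_ext U c p r h x = (if x \<in> U \<and> c x \<in> ball p r then bump r p (c x) * h (c x) else 0)"

text \<open>Tangent vectors act on globally smooth functions, so a function \<open>h\<close> of the
  coordinates enters only after damping and extension by zero. Two open sets suffice: the part of
  the chart over the larger ball of radius \<open>R\<close>, and the complement of the compact set
  over the closed ball of radius \<open>r\<close>.\<close>

lemma smooth_fun_bump_ext:
  fixes A :: "('a::t2_space, 'b::euclidean_space) chart set"
  assumes A: "smooth_atlas A" and U: "(U, c) \<in> A" and R: "ball p R \<subseteq> c ` U" and r: "0 < r" "r < R"
    and h: "\<And>k. Ck_on k (ball p R) h"
  shows "smooth_fun A (bump_ext U c p r h)"
  unfolding smooth_fun_iff[OF A]
proof (intro ballI, clarify)
  fix V d k assume V: "(V, d) \<in> A"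
  let ?\<psi> = "inv_into V d"
  let ?b = "bump_ext U c p r h"
  have sub: "cball p r \<subseteq> c ` U" using R r by force
  define K where "K = inv_into U c ` cball p r"
  have "compact K" unfolding K_def
    by (intro compact_continuous_image compact_cball continuous_on_subset[OF smooth_atlas_chart(5)[OF A U] sub])
  \<comment> \<open>Closedness of the compact set \<open>K\<close> uses the Hausdorff property;
    without it the extension by zero could fail to be smooth outside the chart.\<close>
  then have oK: "open (- K)" by (simp add: compact_imp_closed open_Compl)
  define N1 where "N1 = {y \<in> {y \<in> d ` V. ?\<psi> y \<in> U}. c (?\<psi> y) \<in> ball p R}"
  define N2 where "N2 = {y \<in> d ` V. ?\<psi> y \<in> - K}"
  have S1: "Ck_on j {y \<in> d ` V. ?\<psi> y \<in> U} (\<lambda>y. c (?\<psi> y))" for j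
    by (rule smooth_intoD(3)[OF smooth_into_inv_chart[OF A V] U])
  have o1: "open {y \<in> d ` V. ?\<psi> y \<in> U}"
    by (rule open_chart_preimage[OF A V smooth_atlas_chart(1)[OF A U]])
  have oN1: "open N1"
    using continuous_open_preimage[OF _ o1 open_ball, of "\<lambda>y. c (?\<psi> y)" p R] S1[of 0]
    by (simp add: N1_def vimage_def Int_def)
  have oN2: "open N2" unfolding N2_def by (rule open_chart_preimage[OF A V oK])
  show "Ck_on k (d ` V) (\<lambda>y. ?b (?\<psi> y))"
  proof (rule Ck_on_local)
    fix y assume y: "y \<in> d ` V"
    show "\<exists>T. open T \<and> y \<in> T \<and> Ck_on k T (\<lambda>y. ?b (?\<psi> y))"
    proof (cases "?\<psi> y \<in> K")
      case True
      then obtain z where z: "z \<in> cball p r" "?\<psi> y = inv_into U c z" by (auto simp: K_def)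
      have "z \<in> c ` U" using z sub by blast
      then have "y \<in> N1"
        using y z r smooth_atlas_inv(2,3)[OF A U] by (auto simp: N1_def)
      moreover have "Ck_on k N1 (\<lambda>y. bump r p (c (?\<psi> y)) * h (c (?\<psi> y)))"
      proof (rule Ck_on_mult[OF oN1])
        have S: "Ck_on k N1 (\<lambda>y. c (?\<psi> y))" by (rule Ck_on_subset[OF S1]) (auto simp: N1_def)
        show "Ck_on k N1 (\<lambda>y. bump r p (c (?\<psi> y)))"
          by (rule Ck_on_compose[OF oN1 open_UNIV S Ck_on_bump]) simp
        show "Ck_on k N1 (\<lambda>y. h (c (?\<psi> y)))"
          by (rule Ck_on_compose[OF oN1 open_ball S h]) (auto simp: N1_def)
      qed
      then have "Ck_on k N1 (\<lambda>y. ?b (?\<psi> y))"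
        by (rule Ck_on_cong[OF oN1, rotated]) (use r in \<open>auto simp: N1_def bump_ext_def bump_outside\<close>)
      ultimately show ?thesis using oN1 by blast
    next
      case False
      have "Ck_on k N2 (\<lambda>y. ?b (?\<psi> y))"
      proof (rule Ck_on_cong[OF oN2 _ Ck_on_const])
        fix y assume "y \<in> N2"
        then have "?\<psi> y \<notin> K" by (simp add: N2_def)
        then have "\<not> (?\<psi> y \<in> U \<and> c (?\<psi> y) \<in> ball p r)"
          using smooth_atlas_inv(1)[OF A U] unfolding K_def by (metis ball_subset_cball image_eqI subsetD)
        then show "0 = ?b (?\<psi> y)" by (auto simp: bump_ext_def)
      qed
      then show ?thesis using oN2 False y by (auto simp: N2_def)
    qed
  qed
qed

lemma tangent_space_sum:
  fixes A :: "('a::t2_space, 'b::euclidean_space) chart set"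
  assumes A: "smooth_atlas A" and v: "v \<in> tangent_space A p"
    and "finite I" "\<And>i. i \<in> I \<Longrightarrow> smooth_fun A (f i)"
  shows "smooth_fun A (\<lambda>x. \<Sum>i\<in>I. f i x) \<and> v (\<lambda>x. \<Sum>i\<in>I. f i x) = (\<Sum>i\<in>I. v (f i))"
  using assms(3,4)
proof (induction I rule: finite_induct)
  case empty
  have "v (\<lambda>x. 0 * (0::real)) = 0 * v (\<lambda>x. 0)"
    using v smooth_fun_const[OF A, of 0] unfolding tangent_space_def by blast
  then show ?case using smooth_fun_const[OF A] by simp
next
  case (insert i I)
  have "(\<lambda>x. \<Sum>i\<in>insert i I. f i x) = f i + (\<lambda>x. \<Sum>i\<in>I. f i x)"
    using insert by (simp add: fun_eq_iff)
  then show ?case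
    using insert v smooth_fun_add[OF A, of "f i" "\<lambda>x. \<Sum>i\<in>I. f i x"] unfolding tangent_space_def by simp
qed

text \<open>Hadamard's lemma writes \<open>f\<close> near \<open>e\<close> as a constant plus
  coordinates times smooth coefficients, and the Leibniz rule then leaves only the values of
  \<open>v\<close> on the coordinates.\<close>

lemma tangent_space_derivative:
  fixes A :: "('a::t2_space, 'b::euclidean_space) chart set"
  assumes A: "smooth_atlas A" and U: "(U, c) \<in> A" and e: "e \<in> U" and v: "v \<in> tangent_space A e"
  obtains x where "\<And>f. smooth_fun A f \<Longrightarrow> v f = frechet_derivative (\<lambda>y. f (inv_into U c y)) (at (c e)) x"
proof -
  let ?\<psi> = "inv_into U c"
  define p where "p = c e"
  have \<psi>p: "?\<psi> p = e" using smooth_atlas_inv(1)[OF A U e] by (simp add: p_def)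
  obtain R where R: "R > 0" "ball p R \<subseteq> c ` U"
    using smooth_atlas_chart(2)[OF A U] e open_contains_ball unfolding p_def by blast
  define r where "r = R / 2"
  have r: "0 < r" "r < R" using R by (auto simp: r_def)
  let ?E = "bump_ext U c p r"
  note sE = smooth_fun_bump_ext[OF A U R(2) r]
  have vadd: "v (f + g) = v f + v g" if "smooth_fun A f" "smooth_fun A g" for f g
    using v that unfolding tangent_space_def by blast
  have vmul: "v (f * g) = f e * v g + g e * v f" if "smooth_fun A f" "smooth_fun A g" for f g
    using v that unfolding tangent_space_def by blast
  have vscale: "v (\<lambda>x. s * f x) = s * v f" if "smooth_fun A f" for s f
    using v that unfolding tangent_space_def by blast
  have Ee: "?E h e = h p" for h using e r by (simp add: bump_ext_def p_def[symmetric] bump_center)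
  \<comment> \<open>The component along \<open>i\<close> has to be the value of \<open>v\<close> on
    the i-th coordinate, damped to a global function.\<close>
  define x where "x = (\<Sum>i\<in>Basis. v (?E (\<lambda>y. (y - p) \<bullet> i)) *\<^sub>R i)"
  define B where "B = ?E (\<lambda>y. 1)"
  have sB: "smooth_fun A B" unfolding B_def by (rule sE) (rule Ck_on_const)
  have "v f = frechet_derivative (\<lambda>y. f (?\<psi> y)) (at p) x" if f: "smooth_fun A f" for f
  proof -
    let ?f = "\<lambda>y. f (?\<psi> y)"
    have fs: "Ck_on k (ball p R) ?f" for k
      by (rule Ck_on_subset[OF _ R(2)]) (use f U in \<open>auto simp: smooth_fun_iff[OF A]\<close>)
    obtain g where g: "\<And>i k. Ck_on k (ball p R) (g i)"
      "\<And>i. g i p = frechet_derivative ?f (at p) i"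
      "\<And>y. y \<in> ball p R \<Longrightarrow> ?f y = ?f p + (\<Sum>i\<in>Basis. ((y - p) \<bullet> i) * g i y)"
      using hadamard[OF fs R(1)] by blast
    have sl: "smooth_fun A (?E (\<lambda>y. (y - p) \<bullet> i))" for i :: 'b
      by (intro sE Ck_on_inner Ck_on_diff Ck_on_id Ck_on_const open_ball)
    have sg: "smooth_fun A (?E (g i))" for i by (rule sE) (rule g(1))
    have BB: "smooth_fun A (B * B)" by (rule smooth_fun_mult[OF A sB sB])
    have sp: "smooth_fun A (?E (\<lambda>y. (y - p) \<bullet> i) * ?E (g i))" for i by (rule smooth_fun_mult[OF A sl sg])
    \<comment> \<open>Two bump factors are used so that each summand splits into a damped coordinate
      times a damped coefficient, both globally smooth.\<close>
    have eq: "f * (B * B) = (\<lambda>x. f e * (B * B) x) + (\<lambda>x. \<Sum>i\<in>Basis. (?E (\<lambda>y. (y - p) \<bullet> i) * ?E (g i)) x)"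
    proof
      fix x
      show "(f * (B * B)) x = ((\<lambda>x. f e * (B * B) x) + (\<lambda>x. \<Sum>i\<in>Basis. (?E (\<lambda>y. (y - p) \<bullet> i) * ?E (g i)) x)) x"
      proof (cases "x \<in> U \<and> c x \<in> ball p r")
        case True
        then have "f x = f e + (\<Sum>i\<in>Basis. ((c x - p) \<bullet> i) * g i (c x))"
          using g(3)[of "c x"] r \<psi>p smooth_atlas_inv(1)[OF A U, of x] by simp
        then show ?thesis using True
          by (simp add: B_def bump_ext_def algebra_simps sum_distrib_left)
      qed (auto simp: B_def bump_ext_def)
    qed
    \<comment> \<open>\<open>B\<close> is 1 at \<open>e\<close>, so the Leibniz rule isolates
      \<open>v f\<close>; the term \<open>f e * v (B * B)\<close> occurs in the other expansion too
      and cancels.\<close>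
    have "v (f * (B * B)) = f e * v (B * B) + v f"
      using vmul[OF f BB] Ee by (simp add: B_def)
    moreover have "smooth_fun A (\<lambda>x. f e * (B * B) x)"
      using smooth_fun_mult[OF A smooth_fun_const[OF A] BB] by (simp add: times_fun_def)
    then have "v (f * (B * B)) = f e * v (B * B) + (\<Sum>i\<in>Basis. v (?E (\<lambda>y. (y - p) \<bullet> i) * ?E (g i)))"
      unfolding eq
      using tangent_space_sum[OF A v finite_Basis, of "\<lambda>i. ?E (\<lambda>y. (y - p) \<bullet> i) * ?E (g i)", OF sp]
      by (simp only: vadd vscale[OF BB])
    moreover have "v (?E (\<lambda>y. (y - p) \<bullet> i) * ?E (g i)) = v (?E (\<lambda>y. (y - p) \<bullet> i)) * frechet_derivative ?f (at p) i" for i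
      using vmul[OF sl sg] by (simp add: Ee g(2))
    ultimately have "v f = (\<Sum>i\<in>Basis. v (?E (\<lambda>y. (y - p) \<bullet> i)) * frechet_derivative ?f (at p) i)" by simp
    also have "\<dots> = frechet_derivative ?f (at p) x"
    proof -
      have "linear (frechet_derivative ?f (at p))"
        using fs[of "Suc 0"] R(1) by (intro linear_frechet_derivative) auto
      then show ?thesis unfolding x_def by (simp add: linear_sum linear_cmul)
    qed
    finally show ?thesis .
  qed
  then show ?thesis using that unfolding p_def by blast
qed

text \<open>The equation of an integral curve on a set of times, with continuity in place of
  smoothness. Local solutions, time shifts and right translates satisfy it directly, and uniqueness
  already holds at this level.\<close>

definition weak_curve ::
  "('a::topological_space, 'b::euclidean_space) chart set \<Rightarrow> 'a vfield \<Rightarrow> real set \<Rightarrow> (real \<Rightarrow> 'a) \<Rightarrow> bool" where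
  "weak_curve A X I \<gamma> \<longleftrightarrow> continuous_on I \<gamma> \<and>
     (\<forall>t\<in>I. \<forall>f. smooth_fun A f \<longrightarrow> ((\<lambda>s. f (\<gamma> s)) has_real_derivative X f (\<gamma> t)) (at t))"

text \<open>Coordinates are not globally smooth functions, but near \<open>q\<close> each of them is a quotient
  $H_i/B$ of two globally smooth functions, so the action of the field on $H_i$ and $B$ determines
  the differential equation in the chart.\<close>

lemma vector_field_chart_ode:
  fixes A :: "('a::t2_space, 'b::euclidean_space) chart set"
  assumes A: "smooth_atlas A" and X: "vector_field A X" and U: "(U, c) \<in> A" and q: "q \<in> U"
  obtains r \<Xi> where "r > 0" "ball (c q) r \<subseteq> c ` U" "\<And>k. Ck_on k (ball (c q) r) \<Xi>"
    "\<And>\<gamma> I t. weak_curve A X I \<gamma> \<Longrightarrow> open I \<Longrightarrow> t \<in> I \<Longrightarrow> \<gamma> t \<in> U \<Longrightarrow> c (\<gamma> t) \<in> ball (c q) r \<Longrightarrow>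
        ((\<lambda>t. c (\<gamma> t)) has_vector_derivative \<Xi> (c (\<gamma> t))) (at t)"
proof -
  let ?\<psi> = "inv_into U c"
  define p where "p = c q"
  obtain R where R: "R > 0" "ball p R \<subseteq> c ` U"
    using smooth_atlas_chart(2)[OF A U] q open_contains_ball unfolding p_def by blast
  define r where "r = R / 2"
  have r: "0 < r" "r < R" using R by (auto simp: r_def)
  let ?E = "bump_ext U c p r"
  note sE = smooth_fun_bump_ext[OF A U R(2) r]
  define B where "B = ?E (\<lambda>y. 1)"
  define H where "H i = ?E (\<lambda>y. (y - p) \<bullet> i)" for i
  have sB: "smooth_fun A B" unfolding B_def by (rule sE) (rule Ck_on_const)
  have sH: "smooth_fun A (H i)" for i
    unfolding H_def by (intro sE Ck_on_inner Ck_on_diff Ck_on_id Ck_on_const open_ball)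
  \<comment> \<open>The quotient rule for \<open>H i / B\<close>: the i-th coordinate component of
    \<open>X\<close> near \<open>q\<close>.\<close>
  define \<xi> where "\<xi> i x = (X (H i) x * B x - H i x * X B x) / (B x * B x)" for i x
  define \<Xi> where "\<Xi> y = (\<Sum>i\<in>Basis. \<xi> i (?\<psi> y) *\<^sub>R i)" for y
  have sub: "ball p r \<subseteq> c ` U" using R r by force
  have Bpos: "B x > 0" if "x \<in> U" "c x \<in> ball p r" for x
    using that r by (simp add: B_def bump_ext_def bump_pos)
  have smooth: "Ck_on k (ball p r) (\<lambda>y. f (?\<psi> y))" if "smooth_fun A f" for f k
    by (rule Ck_on_subset[OF _ sub]) (use that U in \<open>auto simp: smooth_fun_iff[OF A]\<close>)
  have X': "smooth_fun A (X f)" if "smooth_fun A f" for f using X that by (simp add: vector_field_def)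
  have "Ck_on k (ball p r) \<Xi>" for k
    unfolding \<Xi>_def[abs_def] \<xi>_def
  proof (intro Ck_on_sum Ck_on_scaleR Ck_on_divide_real Ck_on_diff Ck_on_mult smooth X' sB sH Ck_on_const open_ball)
    fix y assume "y \<in> ball p r"
    then have "y \<in> c ` U" using sub by blast
    then show "B (?\<psi> y) * B (?\<psi> y) \<noteq> 0"
      using Bpos[of "?\<psi> y"] \<open>y \<in> ball p r\<close> smooth_atlas_inv(2,3)[OF A U] by force
  qed
  moreover have "((\<lambda>t. c (\<gamma> t)) has_vector_derivative \<Xi> (c (\<gamma> t))) (at t)"
    if \<gamma>: "weak_curve A X I \<gamma>" "open I" and t: "t \<in> I" "\<gamma> t \<in> U" "c (\<gamma> t) \<in> ball p r" for \<gamma> I t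
  proof -
    have d: "((\<lambda>s. f (\<gamma> s)) has_real_derivative X f (\<gamma> t)) (at t)" if "smooth_fun A f" for f
      using \<gamma>(1) t(1) that unfolding weak_curve_def by blast
    have Bt: "B (\<gamma> t) > 0" using Bpos t by blast
    define J where "J = {s \<in> I. B (\<gamma> s) > 0}"
    have "continuous_on I (\<lambda>s. B (\<gamma> s))"
      by (rule continuous_on_compose2[OF smooth_fun_continuous[OF sB]]) (use \<gamma>(1) in \<open>auto simp: weak_curve_def\<close>)
    then have oJ: "open J"
      using continuous_open_preimage[OF _ \<gamma>(2) open_greaterThan[of 0]] by (simp add: J_def vimage_def Int_def)
    have tJ: "t \<in> J" using t(1) Bt by (simp add: J_def)
    have HB: "H i (\<gamma> s) / B (\<gamma> s) = (c (\<gamma> s) - p) \<bullet> i" if "s \<in> J" for s i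
      using that by (auto simp: J_def H_def B_def bump_ext_def split: if_splits)
    have "((\<lambda>s. H i (\<gamma> s) / B (\<gamma> s)) has_real_derivative \<xi> i (\<gamma> t)) (at t)" for i
      unfolding \<xi>_def by (rule DERIV_divide[OF d[OF sH] d[OF sB]]) (use Bt in simp)
    then have "((\<lambda>s. (H i (\<gamma> s) / B (\<gamma> s)) *\<^sub>R i) has_vector_derivative \<xi> i (\<gamma> t) *\<^sub>R i) (at t)" for i
      using has_vector_derivative_scaleR[OF _ has_vector_derivative_const[of i]] by fastforce
    then have "((\<lambda>s. p + (\<Sum>i\<in>Basis. (H i (\<gamma> s) / B (\<gamma> s)) *\<^sub>R i)) has_vector_derivative
        0 + (\<Sum>i\<in>Basis. \<xi> i (\<gamma> t) *\<^sub>R i)) (at t)"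
      by (intro has_vector_derivative_add has_vector_derivative_const has_vector_derivative_sum)
    then have "((\<lambda>t. c (\<gamma> t)) has_vector_derivative 0 + (\<Sum>i\<in>Basis. \<xi> i (\<gamma> t) *\<^sub>R i)) (at t)"
    proof (rule has_vector_derivative_transform_within_open[OF _ oJ tJ])
      fix s assume "s \<in> J"
      then show "p + (\<Sum>i\<in>Basis. (H i (\<gamma> s) / B (\<gamma> s)) *\<^sub>R i) = c (\<gamma> s)"
        by (simp add: HB euclidean_representation)
    qed
    then show ?thesis using smooth_atlas_inv(1)[OF A U t(2)] by (simp add: \<Xi>_def)
  qed
  ultimately show ?thesis using that[of r \<Xi>] r(1) sub unfolding p_def by blast
qed

text \<open>The times of agreement and of disagreement are both open in a connected set:
  disagreement by the Hausdorff property, agreement because in a chart both curves solve the same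
  Lipschitz equation and Gronwall applies.\<close>

lemma weak_curve_unique:
  fixes A :: "('a::t2_space, 'b::euclidean_space) chart set"
  assumes A: "smooth_atlas A" and X: "vector_field A X" and I: "open I" "connected I"
    and \<gamma>: "weak_curve A X I \<gamma>" "weak_curve A X I \<eta>" and t0: "t0 \<in> I" "\<gamma> t0 = \<eta> t0" and t: "t \<in> I"
  shows "\<gamma> t = \<eta> t"
proof (rule ccontr)
  assume ne: "\<gamma> t \<noteq> \<eta> t"
  have cont: "continuous_on I \<gamma>" "continuous_on I \<eta>" using \<gamma> by (auto simp: weak_curve_def)
  have pre: "open {s \<in> I. \<gamma> s \<in> V \<and> \<eta> s \<in> W}" if "open V" "open W" for V W
  proof -
    have "{s \<in> I. \<gamma> s \<in> V \<and> \<eta> s \<in> W} = (I \<inter> \<gamma> -` V) \<inter> (I \<inter> \<eta> -` W)" by auto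
    then show ?thesis
      using continuous_open_preimage[OF cont(1) I(1) that(1)] continuous_open_preimage[OF cont(2) I(1) that(2)]
      by (simp add: open_Int)
  qed
  have "open {s \<in> I. \<gamma> s \<noteq> \<eta> s}"
  proof (rule openI)
    fix s assume s: "s \<in> {s \<in> I. \<gamma> s \<noteq> \<eta> s}"
    then obtain V W where VW: "open V" "open W" "\<gamma> s \<in> V" "\<eta> s \<in> W" "V \<inter> W = {}"
      using hausdorff[of "\<gamma> s" "\<eta> s"] by auto
    have "{s \<in> I. \<gamma> s \<in> V \<and> \<eta> s \<in> W} \<subseteq> {s \<in> I. \<gamma> s \<noteq> \<eta> s}" using VW(5) by auto
    then show "\<exists>e>0. ball s e \<subseteq> {s \<in> I. \<gamma> s \<noteq> \<eta> s}"
      using pre[OF VW(1,2)] s VW(3,4) open_contains_ball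
      by (metis (no_types, lifting) mem_Collect_eq order_trans)
  qed
  moreover have "open {s \<in> I. \<gamma> s = \<eta> s}"
  proof (rule openI)
    fix s assume s: "s \<in> {s \<in> I. \<gamma> s = \<eta> s}"
    obtain U c where U: "(U, c) \<in> A" "\<gamma> s \<in> U" using smooth_atlas_cover[OF A] .
    obtain r \<Xi> where r: "r > 0" "ball (c (\<gamma> s)) r \<subseteq> c ` U" "\<And>k. Ck_on k (ball (c (\<gamma> s)) r) \<Xi>"
      and ode: "\<And>\<gamma>' I t. weak_curve A X I \<gamma>' \<Longrightarrow> open I \<Longrightarrow> t \<in> I \<Longrightarrow> \<gamma>' t \<in> U \<Longrightarrow> c (\<gamma>' t) \<in> ball (c (\<gamma> s)) r \<Longrightarrow>
        ((\<lambda>t. c (\<gamma>' t)) has_vector_derivative \<Xi> (c (\<gamma>' t))) (at t)"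
      using vector_field_chart_ode[OF A X U] by blast
    \<comment> \<open>Halving the radius gives a compact convex set inside the domain of
      \<open>\<Xi>\<close>, as the Lipschitz bound requires.\<close>
    let ?K = "cball (c (\<gamma> s)) (r / 2)"
    have KS: "?K \<subseteq> ball (c (\<gamma> s)) r" using r(1) by force
    obtain L where L: "L \<ge> 0" "\<And>x y. x \<in> ?K \<Longrightarrow> y \<in> ?K \<Longrightarrow> norm (\<Xi> x - \<Xi> y) \<le> L * norm (x - y)"
      using Ck_on_lipschitz[OF r(3) compact_cball convex_cball KS] by blast
    define V where "V = U \<inter> c -` ball (c (\<gamma> s)) (r / 2)"
    have oV: "open V" unfolding V_def
      by (rule continuous_open_preimage[OF smooth_atlas_chart(4,1)[OF A U(1)] open_ball])
    have sV: "s \<in> {s \<in> I. \<gamma> s \<in> V \<and> \<eta> s \<in> V}" using s U(2) r(1) by (auto simp: V_def)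
    then obtain e where e: "e > 0" "ball s e \<subseteq> {s \<in> I. \<gamma> s \<in> V \<and> \<eta> s \<in> V}"
      using pre[OF oV oV] open_contains_ball by blast
    have "c (\<gamma> s') - c (\<eta> s') = 0" if s': "s' \<in> ball s e" for s'
    proof (rule gronwall_zero[where I="ball s e" and u="\<lambda>s. c (\<gamma> s) - c (\<eta> s)" and K=L and ?t0.0=s])
      fix t assume t: "t \<in> ball s e"
      then have tI: "t \<in> I" "\<gamma> t \<in> U" "\<eta> t \<in> U"
        "c (\<gamma> t) \<in> ball (c (\<gamma> s)) (r/2)" "c (\<eta> t) \<in> ball (c (\<gamma> s)) (r/2)"
        using e(2) by (auto simp: V_def)
      then have K: "c (\<gamma> t) \<in> ?K" "c (\<eta> t) \<in> ?K" by auto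
      then have K': "c (\<gamma> t) \<in> ball (c (\<gamma> s)) r" "c (\<eta> t) \<in> ball (c (\<gamma> s)) r" using KS by blast+
      show "((\<lambda>s. c (\<gamma> s) - c (\<eta> s)) has_vector_derivative \<Xi> (c (\<gamma> t)) - \<Xi> (c (\<eta> t))) (at t)"
        by (intro has_vector_derivative_diff ode[OF \<gamma>(1)] ode[OF \<gamma>(2)] K' tI I(1))
      show "norm (\<Xi> (c (\<gamma> t)) - \<Xi> (c (\<eta> t))) \<le> L * norm (c (\<gamma> t) - c (\<eta> t))"
        by (rule L(2)[OF K])
    qed (use e(1) s s' in auto)
    then have "\<gamma> s' = \<eta> s'" if "s' \<in> ball s e" for s'
      using that e(2) smooth_atlas_chart(3)[OF A U(1)] by (auto simp: V_def inj_on_def)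
    then show "\<exists>e>0. ball s e \<subseteq> {s \<in> I. \<gamma> s = \<eta> s}" using e by blast
  qed
  ultimately show False
    using connectedD[OF I(2), of "{s \<in> I. \<gamma> s \<noteq> \<eta> s}" "{s \<in> I. \<gamma> s = \<eta> s}"] t ne t0 by blast
qed

lemma integral_curve_imp_weak_curve: "integral_curve A X \<gamma> \<Longrightarrow> weak_curve A X UNIV \<gamma>"
  by (auto simp: integral_curve_def weak_curve_def smooth_map_def)

section \<open>Right invariant vector fields\<close>

lemma has_derivative_partial1:
  assumes "(K has_derivative D) (at (z, y))"
  shows "((\<lambda>z. K (z, y)) has_derivative (\<lambda>v. D (v, 0))) (at z)"
proof -
  have "((\<lambda>z. (z, y)) has_derivative (\<lambda>v. (v, 0))) (at z)"
    by (auto intro!: derivative_eq_intros)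
  from diff_chain_at[OF this assms] show ?thesis by (simp add: o_def)
qed

lemma has_derivative_partial2:
  assumes "(K has_derivative D) (at (z, y))"
  shows "((\<lambda>y. K (z, y)) has_derivative (\<lambda>v. D (0, v))) (at y)"
proof -
  have "((\<lambda>y. (z, y)) has_derivative (\<lambda>v. (0, v))) (at y)"
    by (auto intro!: derivative_eq_intros)
  from diff_chain_at[OF this assms] show ?thesis by (simp add: o_def)
qed

lemma Ck_on_partial1:
  assumes K: "Ck_on (Suc k) N K" and N: "open N" "open M" "\<And>y. y \<in> M \<Longrightarrow> (z, y) \<in> N"
  shows "Ck_on k M (\<lambda>y. frechet_derivative (\<lambda>z. K (z, y)) (at z) v)"
proof (rule Ck_on_cong[OF N(2)])
  show "Ck_on k M (\<lambda>y. frechet_derivative K (at (z, y)) (v, 0))"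
    by (rule Ck_on_compose[where g="\<lambda>w. frechet_derivative K (at w) (v, 0)" and f="\<lambda>y. (z, y)", OF N(2,1)])
      (use K N(3) in \<open>auto intro!: Ck_on_Pair Ck_on_const Ck_on_id N(2)\<close>)
  show "frechet_derivative K (at (z, y)) (v, 0) = frechet_derivative (\<lambda>z. K (z, y)) (at z) v" if "y \<in> M" for y
    using frechet_derivative_at[OF has_derivative_partial1[OF Ck_on_has_derivative[OF K N(3)[OF that]]]]
    by (metis (no_types))
qed

lemma Ck_on_partial2:
  assumes K: "Ck_on (Suc k) N K" and N: "open N" "open M" "\<And>z. z \<in> M \<Longrightarrow> (z, y) \<in> N"
  shows "Ck_on k M (\<lambda>z. frechet_derivative (\<lambda>y. K (z, y)) (at y) v)"
proof (rule Ck_on_cong[OF N(2)])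
  show "Ck_on k M (\<lambda>z. frechet_derivative K (at (z, y)) (0, v))"
    by (rule Ck_on_compose[where g="\<lambda>w. frechet_derivative K (at w) (0, v)" and f="\<lambda>z. (z, y)", OF N(2,1)])
      (use K N(3) in \<open>auto intro!: Ck_on_Pair Ck_on_const Ck_on_id N(2)\<close>)
  show "frechet_derivative K (at (z, y)) (0, v) = frechet_derivative (\<lambda>y. K (z, y)) (at y) v" if "z \<in> M" for z
    using frechet_derivative_at[OF has_derivative_partial2[OF Ck_on_has_derivative[OF K N(3)[OF that]]]]
    by (metis (no_types))
qed

lemma Ck_on_fst: "Ck_on k S fst" and Ck_on_snd: "Ck_on k S snd"
  by (auto intro: Ck_on_bounded_linear bounded_linear_fst bounded_linear_snd)

text \<open>One chart at the unit identifies the tangent space there with the model space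
  \<open>'b\<close>; translations carry local statements to all other points.\<close>

locale lie_chart =
  fixes G :: "'a::{t2_space, second_countable_topology} monoid" (structure)
    and A :: "('a, 'b::euclidean_space) chart set" and U :: "'a set" and c :: "'a \<Rightarrow> 'b"
  assumes lie: "lie_group G A" and chart: "(U, c) \<in> A" and one_U: "\<one> \<in> U"
begin

abbreviation \<psi> :: "'b \<Rightarrow> 'a" where "\<psi> \<equiv> inv_into U c"
abbreviation p :: 'b where "p \<equiv> c \<one>"
abbreviation W :: "'b set" where "W \<equiv> c ` U"

lemma atlas: "smooth_atlas A" using lie by (simp add: lie_group_def)

lemma carrier_UNIV [simp]: "carrier G = UNIV" using lie by (simp add: lie_group_def)

sublocale group G using lie by (simp add: lie_group_def)

lemma group_simps [simp]:
  "\<one> \<otimes> x = x" "x \<otimes> \<one> = x" "inv x \<otimes> x = \<one>" "x \<otimes> inv x = \<one>" "inv \<one> = \<one>"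
  "inv x \<otimes> (x \<otimes> y) = y" "x \<otimes> (inv x \<otimes> y) = y" "inv (inv x) = x"
  using l_inv r_inv by (auto simp: m_assoc[symmetric] simp del: l_inv r_inv)

lemma assoc: "x \<otimes> y \<otimes> z = x \<otimes> (y \<otimes> z)" by (simp add: m_assoc)

lemma inv_mult: "inv (x \<otimes> y) = inv y \<otimes> inv x" by (simp add: inv_mult_group)

lemmas open_U = smooth_atlas_chart(1)[OF atlas chart]
lemmas open_W = smooth_atlas_chart(2)[OF atlas chart]
lemmas \<psi>_c = smooth_atlas_inv(1)[OF atlas chart]
lemmas \<psi>_U = smooth_atlas_inv(2)[OF atlas chart]
lemmas c_\<psi> = smooth_atlas_inv(3)[OF atlas chart]

lemma p_W: "p \<in> W" using one_U by blast

lemma \<psi>_p [simp]: "\<psi> p = \<one>" by (rule \<psi>_c[OF one_U])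

lemma continuous_mult: "continuous_on UNIV (\<lambda>z. fst z \<otimes> snd z)"
  using lie by (simp add: lie_group_def smooth_map_def split_def)

lemma continuous_on_mult [continuous_intros]:
  "continuous_on S f \<Longrightarrow> continuous_on S g \<Longrightarrow> continuous_on S (\<lambda>x. f x \<otimes> g x)"
  using continuous_on_compose2[OF continuous_mult continuous_on_Pair] by fastforce

lemma smooth_map_inv: "smooth_map A A (\<lambda>x. inv x)"
  using lie by (simp add: lie_group_def)

text \<open>Translates smoothness of the multiplication with respect to the product atlas into
  \<open>smooth_into\<close>, from which all further products are built.\<close>

lemma smooth_into_mult_chart:
  assumes "(U1, c1) \<in> A" "(U2, c2) \<in> A"
  shows "smooth_into A (c1 ` U1 \<times> c2 ` U2) (\<lambda>z. inv_into U1 c1 (fst z) \<otimes> inv_into U2 c2 (snd z))"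
proof -
  let ?\<psi>1 = "inv_into U1 c1" and ?\<psi>2 = "inv_into U2 c2"
  let ?N = "c1 ` U1 \<times> c2 ` U2"
  have cont: "continuous_on ?N (\<lambda>z. ?\<psi>1 (fst z) \<otimes> ?\<psi>2 (snd z))"
    by (intro continuous_on_mult continuous_on_compose2[OF smooth_atlas_chart(5)[OF atlas assms(1)]]
        continuous_on_compose2[OF smooth_atlas_chart(5)[OF atlas assms(2)]]
        continuous_on_fst continuous_on_snd continuous_on_id) auto
  have inv: "inv_into (U1 \<times> U2) (map_prod c1 c2) z = (?\<psi>1 (fst z), ?\<psi>2 (snd z))" if "z \<in> ?N" for z
  proof (rule inv_into_f_eq)
    show "inj_on (map_prod c1 c2) (U1 \<times> U2)"
      using smooth_atlas_chart(3)[OF atlas assms(1)] smooth_atlas_chart(3)[OF atlas assms(2)]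
      by (rule map_prod_inj_on)
  qed (use that smooth_atlas_inv[OF atlas assms(1)] smooth_atlas_inv[OF atlas assms(2)] in auto)
  have "Ck_on k {z \<in> ?N. ?\<psi>1 (fst z) \<otimes> ?\<psi>2 (snd z) \<in> V} (\<lambda>z. d (?\<psi>1 (fst z) \<otimes> ?\<psi>2 (snd z)))"
    if V: "(V, d) \<in> A" for V d k
  proof -
    have mem: "(U1 \<times> U2, map_prod c1 c2) \<in> prod_atlas A A" using assms by (auto simp: prod_atlas_def)
    have "smooth_map (prod_atlas A A) A (\<lambda>(x, y). x \<otimes> y)" using lie by (simp add: lie_group_def)
    then have *: "Ck_on k (map_prod c1 c2 ` ((U1 \<times> U2) \<inter> (\<lambda>(x, y). x \<otimes> y) -` V))
        (d \<circ> (\<lambda>(x, y). x \<otimes> y) \<circ> inv_into (U1 \<times> U2) (map_prod c1 c2))"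
      using mem V unfolding smooth_map_def smooth_on_def by blast
    have set: "map_prod c1 c2 ` ((U1 \<times> U2) \<inter> (\<lambda>(x, y). x \<otimes> y) -` V) =
        {z \<in> ?N. ?\<psi>1 (fst z) \<otimes> ?\<psi>2 (snd z) \<in> V}" (is "?L = ?R")
    proof (intro equalityI subsetI)
      fix z assume "z \<in> ?R"
      then have "z = map_prod c1 c2 (?\<psi>1 (fst z), ?\<psi>2 (snd z))"
        "(?\<psi>1 (fst z), ?\<psi>2 (snd z)) \<in> (U1 \<times> U2) \<inter> (\<lambda>(x, y). x \<otimes> y) -` V"
        using smooth_atlas_inv(2,3)[OF atlas assms(1)] smooth_atlas_inv(2,3)[OF atlas assms(2)] by auto
      then show "z \<in> ?L" by (rule image_eqI)
    qed (auto simp: smooth_atlas_inv(1)[OF atlas assms(1)] smooth_atlas_inv(1)[OF atlas assms(2)])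
    have "open ?R"
      using continuous_open_preimage[OF cont _ smooth_atlas_chart(1)[OF atlas V]]
        smooth_atlas_chart(2)[OF atlas assms(1)] smooth_atlas_chart(2)[OF atlas assms(2)]
      by (simp add: open_Times vimage_def Int_def)
    then show ?thesis
      by (rule Ck_on_cong[OF _ _ *[unfolded set]]) (simp add: inv)
  qed
  then show ?thesis
    using cont smooth_atlas_chart(2)[OF atlas assms(1)] smooth_atlas_chart(2)[OF atlas assms(2)]
    unfolding smooth_into_def by (auto simp: open_Times)
qed

lemma smooth_into_mult:
  assumes F: "smooth_into A N F1" "smooth_into A N F2"
  shows "smooth_into A N (\<lambda>y. F1 y \<otimes> F2 y)"
proof (rule smooth_into_local[OF atlas _ smooth_intoD(1)[OF F(1)]])
  fix y assume y: "y \<in> N"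
  obtain U1 c1 where U1: "(U1, c1) \<in> A" "F1 y \<in> U1" using smooth_atlas_cover[OF atlas] .
  obtain U2 c2 where U2: "(U2, c2) \<in> A" "F2 y \<in> U2" using smooth_atlas_cover[OF atlas] .
  let ?T = "{y \<in> N. F1 y \<in> U1} \<inter> {y \<in> N. F2 y \<in> U2}"
  have oT: "open ?T"
    using smooth_into_open[OF F(1) smooth_atlas_chart(1)[OF atlas U1(1)]]
      smooth_into_open[OF F(2) smooth_atlas_chart(1)[OF atlas U2(1)]] by (rule open_Int)
  have 1: "Ck_on k ?T (\<lambda>y. c1 (F1 y))" for k
    by (rule Ck_on_subset[OF smooth_intoD(3)[OF F(1) U1(1)]]) auto
  have 2: "Ck_on k ?T (\<lambda>y. c2 (F2 y))" for k
    by (rule Ck_on_subset[OF smooth_intoD(3)[OF F(2) U2(1)]]) auto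
  have "smooth_into A ?T (\<lambda>y. inv_into U1 c1 (fst (c1 (F1 y), c2 (F2 y))) \<otimes> inv_into U2 c2 (snd (c1 (F1 y), c2 (F2 y))))"
    by (rule smooth_into_comp[OF atlas smooth_into_mult_chart[OF U1(1) U2(1)] oT Ck_on_Pair[OF oT 1 2]]) auto
  then have "smooth_into A ?T (\<lambda>y. F1 y \<otimes> F2 y)"
    by (rule smooth_into_cong[OF atlas])
      (simp add: smooth_atlas_inv(1)[OF atlas U1(1)] smooth_atlas_inv(1)[OF atlas U2(1)])
  then show "\<exists>T. y \<in> T \<and> smooth_into A T (\<lambda>y. F1 y \<otimes> F2 y)"
    using y U1(2) U2(2) by (intro exI[of _ ?T]) simp
qed

lemma smooth_into_m_inv: "smooth_into A N F \<Longrightarrow> smooth_into A N (\<lambda>y. inv F y)"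
  using smooth_map_smooth_into[OF atlas atlas smooth_map_inv] .

lemma smooth_into_\<psi>:
  assumes "open N" "\<And>k. Ck_on k N h" "h ` N \<subseteq> W"
  shows "smooth_into A N (\<lambda>y. \<psi> (h y))"
  using smooth_into_comp[OF atlas smooth_into_inv_chart[OF atlas chart] assms] .

lemma smooth_map_mult_right: "smooth_map A A (\<lambda>x. x \<otimes> g)"
  unfolding smooth_map_chart_iff[OF atlas atlas]
  using smooth_into_mult[OF smooth_into_inv_chart[OF atlas] smooth_into_const[OF atlas smooth_atlas_chart(2)[OF atlas]]]
  by blast

lemma smooth_map_conj: "smooth_map A A (\<lambda>x. g \<otimes> x \<otimes> inv g)"
  unfolding smooth_map_chart_iff[OF atlas atlas]
  using smooth_into_mult[OF smooth_into_mult[OF smooth_into_const[OF atlas smooth_atlas_chart(2)[OF atlas]]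
      smooth_into_inv_chart[OF atlas]] smooth_into_const[OF atlas smooth_atlas_chart(2)[OF atlas]]]
  by blast

lemma smooth_fun_mult_right:
  assumes "smooth_fun A f" shows "smooth_fun A (\<lambda>x. f (x \<otimes> g))"
  unfolding smooth_map_chart_iff[OF atlas smooth_atlas_std]
  using smooth_map_smooth_into[OF atlas smooth_atlas_std assms
      smooth_map_smooth_into[OF atlas atlas smooth_map_mult_right smooth_into_inv_chart[OF atlas]]]
  by blast

text \<open>The value 0 on non-smooth functions is forced by \<^const>\<open>tangent_space\<close>.\<close>

definition rfield :: "'b \<Rightarrow> 'a vfield" where
  "rfield x f g = (if smooth_fun A f then frechet_derivative (\<lambda>y. f (\<psi> y \<otimes> g)) (at p) x else 0)"

lemma Ck_on_smooth_fun_mult: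
  assumes "smooth_fun A f"
  shows "Ck_on k W (\<lambda>y. f (\<psi> y \<otimes> g))"
  by (rule smooth_fun_into[OF atlas assms smooth_into_mult])
    (auto intro!: smooth_into_inv_chart[OF atlas chart] smooth_into_const[OF atlas] open_W)

lemma rfield_has_derivative:
  assumes "smooth_fun A f"
  shows "((\<lambda>y. f (\<psi> y \<otimes> g)) has_derivative (\<lambda>x. rfield x f g)) (at p)"
  using Ck_on_has_derivative[OF Ck_on_smooth_fun_mult[OF assms] p_W] assms
  by (simp add: rfield_def[abs_def])

lemma rfield_eqI:
  assumes "smooth_fun A f" "((\<lambda>y. f (\<psi> y \<otimes> g)) has_derivative D) (at p)"
  shows "rfield x f g = D x"
  using has_derivative_unique[OF rfield_has_derivative[OF assms(1)] assms(2)] by metis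

text \<open>In coordinates the field is a partial derivative, in the first factor at the unit, of
  the jointly smooth map \<open>(y, g)\<close> to \<open>f (\<psi> y \<otimes> g)\<close>; it stays
  smooth in the second factor.\<close>

lemma smooth_fun_rfield:
  assumes f: "smooth_fun A f"
  shows "smooth_fun A (rfield x f)"
  unfolding smooth_fun_iff[OF atlas]
proof (intro ballI, clarify)
  fix V d k assume V: "(V, d) \<in> A"
  have K: "Ck_on (Suc k) (W \<times> d ` V) (\<lambda>z. f (\<psi> (fst z) \<otimes> inv_into V d (snd z)))"
    by (rule smooth_fun_into[OF atlas f smooth_into_mult_chart[OF chart V]])
  have "Ck_on k (d ` V) (\<lambda>y. frechet_derivative (\<lambda>z. f (\<psi> (fst (z, y)) \<otimes> inv_into V d (snd (z, y)))) (at p) x)"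
    by (rule Ck_on_partial1[OF K]) (use open_W smooth_atlas_chart(2)[OF atlas V] p_W in \<open>auto simp: open_Times\<close>)
  then show "Ck_on k (d ` V) (\<lambda>y. rfield x f (inv_into V d y))"
    using f by (simp add: rfield_def)
qed

lemma right_invariant_rfield: "right_invariant G A (rfield x)"
proof -
  have add: "rfield x (f + h) g = rfield x f g + rfield x h g" if "smooth_fun A f" "smooth_fun A h" for f h g
    using has_derivative_add[OF rfield_has_derivative[OF that(1), of g] rfield_has_derivative[OF that(2), of g]]
    by (intro rfield_eqI smooth_fun_add[OF atlas] that) simp
  have scale: "rfield x (\<lambda>x. r * f x) g = r * rfield x f g" if "smooth_fun A f" for r f g
    using has_derivative_mult_right[OF rfield_has_derivative[OF that, of g], of r]
      smooth_fun_mult[OF atlas smooth_fun_const[OF atlas] that, of r]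
    by (intro rfield_eqI[where D="\<lambda>x. r * rfield x f g"]) (auto simp: times_fun_def)
  have mult: "rfield x (f * h) g = f g * rfield x h g + h g * rfield x f g"
    if "smooth_fun A f" "smooth_fun A h" for f h g
    using has_derivative_mult[OF rfield_has_derivative[OF that(1), of g] rfield_has_derivative[OF that(2), of g]]
    by (intro rfield_eqI[where D="\<lambda>x. f g * rfield x h g + h g * rfield x f g"] smooth_fun_mult[OF atlas] that)
      (simp add: mult.commute)
  have "(\<lambda>f. rfield x f g) \<in> tangent_space A g" for g
    unfolding tangent_space_def using add scale mult by (simp add: rfield_def)
  moreover have "rfield x (\<lambda>x. f (x \<otimes> h)) g = rfield x f (g \<otimes> h)" if "smooth_fun A f" for f g h
    using that smooth_fun_mult_right[OF that] by (simp add: rfield_def assoc)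
  ultimately show ?thesis
    using smooth_fun_rfield unfolding right_invariant_def vector_field_def by blast
qed

lemma vector_field_rfield: "vector_field A (rfield x)"
  using right_invariant_rfield by (simp add: right_invariant_def)

text \<open>At the unit the field is a directional derivative, and right invariance transports this
  to every \<open>g\<close>. On functions that are not smooth both sides have the default value
  0.\<close>

lemma right_invariant_imp_rfield:
  assumes "right_invariant G A X" obtains x where "X = rfield x"
proof -
  have v: "(\<lambda>f. X f g) \<in> tangent_space A g" for g
    using assms by (simp add: right_invariant_def vector_field_def)
  obtain x where x: "\<And>f. smooth_fun A f \<Longrightarrow> X f \<one> = frechet_derivative (\<lambda>y. f (\<psi> y)) (at p) x"
    using tangent_space_derivative[OF atlas chart one_U v] by blast
  have "X f g = rfield x f g" for f g
  proof (cases "smooth_fun A f")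
    case True
    then have "X f g = X (\<lambda>x. f (x \<otimes> g)) \<one>"
      using assms by (auto simp: right_invariant_def)
    then show ?thesis using x[OF smooth_fun_mult_right[OF True]] True by (simp add: rfield_def)
  next
    case False
    then show ?thesis using v[of g] by (simp add: tangent_space_def rfield_def)
  qed
  then show ?thesis using that by blast
qed

lemma linear_rfield: "linear (\<lambda>x. rfield x f g)"
proof (cases "smooth_fun A f")
  case True
  then show ?thesis using has_derivative_linear[OF rfield_has_derivative] by blast
qed (simp add: rfield_def linear_zero)

lemma rfield_scale: "rfield (r *\<^sub>R x) = vf_scale r (rfield x)"
  using linear_cmul[OF linear_rfield] by (auto simp: vf_scale_def fun_eq_iff)

lemma rfield_add: "rfield (x + y) = rfield x + rfield y"
  using linear_add[OF linear_rfield] by (auto simp: fun_eq_iff)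

lemma rfield_zero: "rfield 0 = 0"
  using linear_0[OF linear_rfield] by (auto simp: fun_eq_iff)

lemma rfield_eq_0_iff: "rfield x = 0 \<longleftrightarrow> x = 0"
proof
  assume *: "rfield x = 0"
  obtain R where R: "R > 0" "ball p R \<subseteq> W"
    using open_W p_W open_contains_ball by blast
  define r where "r = R / 2"
  have r: "0 < r" "r < R" using R by (auto simp: r_def)
  have "x \<bullet> i = 0" for i
  proof -
    \<comment> \<open>The damped i-th coordinate vanishes at \<open>p\<close> and the bump is 1
      there, so its derivative along \<open>x\<close> is \<open>x \<bullet> i\<close>.\<close>
    let ?f = "bump_ext U c p r (\<lambda>y. (y - p) \<bullet> i)"
    have f: "smooth_fun A ?f"
      by (intro smooth_fun_bump_ext[OF atlas chart R(2) r] Ck_on_inner Ck_on_diff Ck_on_id Ck_on_const open_ball)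
    have "((\<lambda>y. bump r p y * ((y - p) \<bullet> i)) has_derivative
        (\<lambda>v. bump r p p * (v \<bullet> i) + frechet_derivative (bump r p) (at p) v * ((p - p) \<bullet> i))) (at p)"
      by (intro has_derivative_mult Ck_on_has_derivative[OF Ck_on_bump UNIV_I])
        (auto intro!: derivative_eq_intros)
    then have "((\<lambda>y. ?f (\<psi> y \<otimes> \<one>)) has_derivative (\<lambda>v. bump r p p * (v \<bullet> i) + frechet_derivative (bump r p) (at p) v * ((p - p) \<bullet> i))) (at p)"
    proof (rule has_derivative_transform_within_open[OF _ open_ball])
      show "p \<in> ball p r" using r by simp
      fix y assume y: "y \<in> ball p r"
      then have "y \<in> W" using R r by auto
      then show "bump r p y * ((y - p) \<bullet> i) = ?f (\<psi> y \<otimes> \<one>)"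
        using y \<psi>_U c_\<psi> by (simp add: bump_ext_def)
    qed
    from rfield_eqI[OF f this, of x] show "x \<bullet> i = 0"
      using r by (simp add: * bump_center)
  qed
  then show "x = 0" by (metis inner_eq_zero_iff)
qed (simp add: rfield_zero)

end

section \<open>One-parameter subgroups\<close>

lemma has_vector_derivative_compose_at:
  assumes "(u has_vector_derivative x) (at t)" "(F has_derivative D) (at (u t))"
  shows "((\<lambda>t. F (u t)) has_vector_derivative D x) (at t)"
  using vector_derivative_diff_chain_within[OF assms(1) has_derivative_at_withinI[OF assms(2)]]
  by (simp add: o_def)

lemma has_vector_derivative_shift:
  fixes f :: "real \<Rightarrow> 'b::real_normed_vector"
  assumes "((\<lambda>s. f (s + t)) has_vector_derivative y) (at 0)"
  shows "(f has_vector_derivative y) (at t)"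
proof -
  have 1: "((\<lambda>s. s - t) has_vector_derivative 1) (at t)"
    by (auto intro!: derivative_eq_intros)
  have "((\<lambda>s. f (s + t)) has_vector_derivative y) (at (t - t))" using assms by simp
  from vector_diff_chain_at[OF 1 this] show ?thesis by (simp add: o_def)
qed

lemma has_vector_derivative_scale_arg:
  fixes f :: "real \<Rightarrow> 'b::real_normed_vector"
  assumes "(f has_vector_derivative y) (at 0)"
  shows "((\<lambda>s. f (a * s)) has_vector_derivative a *\<^sub>R y) (at 0)"
proof -
  have 1: "((\<lambda>s. a * s) has_vector_derivative a) (at 0)"
    by (auto intro!: derivative_eq_intros simp: has_real_derivative_iff_has_vector_derivative[symmetric])
  have "(f has_vector_derivative y) (at (a * 0))" using assms by simp
  from vector_diff_chain_at[OF 1 this] show ?thesis by (simp add: o_def)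
qed

lemma weak_curve_subset: "weak_curve A X I \<gamma> \<Longrightarrow> J \<subseteq> I \<Longrightarrow> weak_curve A X J \<gamma>"
  unfolding weak_curve_def using continuous_on_subset by blast

lemma weak_curve_shift:
  assumes "weak_curve A X I \<gamma>"
  shows "weak_curve A X {t. t + s \<in> I} (\<lambda>t. \<gamma> (t + s))"
  unfolding weak_curve_def
proof (intro conjI ballI allI impI)
  have "continuous_on I \<gamma>" using assms by (simp add: weak_curve_def)
  then show "continuous_on {t. t + s \<in> I} (\<lambda>t. \<gamma> (t + s))"
    by (rule continuous_on_compose2) (auto intro!: continuous_intros)
  fix t f assume "t \<in> {t. t + s \<in> I}" "smooth_fun A f"
  then have "((\<lambda>t. f (\<gamma> t)) has_real_derivative X f (\<gamma> (t + s))) (at (t + s))"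
    using assms by (auto simp: weak_curve_def)
  then show "((\<lambda>t. f (\<gamma> (t + s))) has_real_derivative X f (\<gamma> (t + s))) (at t)"
    by (simp add: DERIV_shift)
qed

context lie_chart
begin

lemma weak_curve_mult_right:
  assumes X: "right_invariant G A X" and \<gamma>: "weak_curve A X I \<gamma>"
  shows "weak_curve A X I (\<lambda>t. \<gamma> t \<otimes> g)"
  unfolding weak_curve_def
proof (intro conjI ballI allI impI)
  show "continuous_on I (\<lambda>t. \<gamma> t \<otimes> g)"
    using \<gamma> by (auto simp: weak_curve_def intro!: continuous_on_mult continuous_on_const)
  fix t f assume t: "t \<in> I" and f: "smooth_fun A f"
  have "\<And>f. smooth_fun A f \<Longrightarrow> ((\<lambda>t. f (\<gamma> t)) has_real_derivative X f (\<gamma> t)) (at t)"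
    using \<gamma> t by (simp add: weak_curve_def)
  from this[OF smooth_fun_mult_right[OF f]] show "((\<lambda>t. f (\<gamma> t \<otimes> g)) has_real_derivative X f (\<gamma> t \<otimes> g)) (at t)"
    using X f by (simp add: right_invariant_def)
qed

text \<open>In the chart, \<open>R w\<close> is the differential at the unit of the right translation by \<open>\<psi> w\<close>.\<close>

definition R :: "'b \<Rightarrow> 'b \<Rightarrow> 'b" where
  "R w x = frechet_derivative (\<lambda>y. c (\<psi> y \<otimes> \<psi> w)) (at p) x"

definition \<Omega> :: "('b \<times> 'b) set" where
  "\<Omega> = {z \<in> W \<times> W. \<psi> (fst z) \<otimes> \<psi> (snd z) \<in> U}"

lemma open_\<Omega>: "open \<Omega>"
  unfolding \<Omega>_def by (rule smooth_into_open[OF smooth_into_mult_chart[OF chart chart] open_U])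

lemma Ck_on_\<Omega>: "Ck_on k \<Omega> (\<lambda>z. c (\<psi> (fst z) \<otimes> \<psi> (snd z)))"
  unfolding \<Omega>_def by (rule smooth_intoD(3)[OF smooth_into_mult_chart[OF chart chart] chart])

lemma p_\<Omega>: "w \<in> W \<Longrightarrow> (p, w) \<in> \<Omega>" "w \<in> W \<Longrightarrow> (w, p) \<in> \<Omega>"
  using p_W \<psi>_U by (auto simp: \<Omega>_def)

lemma Ck_on_R: "Ck_on k W (\<lambda>w. R w v)"
  using Ck_on_partial1[OF Ck_on_\<Omega> open_\<Omega> open_W p_\<Omega>(1)] by (simp add: R_def)

lemma R_has_derivative:
  assumes "w \<in> W" shows "((\<lambda>y. c (\<psi> y \<otimes> \<psi> w)) has_derivative R w) (at p)"
proof -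
  have "((\<lambda>y. c (\<psi> (fst (y, w)) \<otimes> \<psi> (snd (y, w)))) has_derivative
      (\<lambda>v. frechet_derivative (\<lambda>z. c (\<psi> (fst z) \<otimes> \<psi> (snd z))) (at (p, w)) (v, 0))) (at p)"
    by (rule has_derivative_partial1[OF Ck_on_has_derivative[OF Ck_on_\<Omega> p_\<Omega>(1)[OF assms]]])
  then have "(\<lambda>y. c (\<psi> y \<otimes> \<psi> w)) differentiable (at p)" by (auto simp: differentiable_def)
  then show ?thesis by (simp add: R_def[abs_def] frechet_derivative_works)
qed

lemma linear_R: "w \<in> W \<Longrightarrow> linear (R w)"
  using R_has_derivative has_derivative_linear by blast

lemma R_p: "R p x = x"
proof -
  have "((\<lambda>y. c (\<psi> y \<otimes> \<psi> p)) has_derivative (\<lambda>x. x)) (at p)"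
    by (rule has_derivative_transform_within_open[OF has_derivative_ident open_W p_W]) (simp add: c_\<psi>)
  from has_derivative_unique[OF R_has_derivative[OF p_W] this] show ?thesis by metis
qed

text \<open>Beyond the group law only continuity and a velocity at time 0 are required; the group
  law spreads differentiability to all times, and the differential equation then gives
  smoothness.\<close>

definition one_param :: "'b \<Rightarrow> (real \<Rightarrow> 'a) \<Rightarrow> bool" where
  "one_param x \<gamma> \<longleftrightarrow> (\<forall>s t. \<gamma> (s + t) = \<gamma> s \<otimes> \<gamma> t) \<and> continuous_on UNIV \<gamma> \<and>
     ((\<lambda>t. c (\<gamma> t)) has_vector_derivative x) (at 0)"

lemma
  assumes "one_param x \<gamma>"
  shows one_param_add: "\<gamma> (s + t) = \<gamma> s \<otimes> \<gamma> t"
    and one_param_cont: "continuous_on UNIV \<gamma>"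
    and one_param_deriv0: "((\<lambda>t. c (\<gamma> t)) has_vector_derivative x) (at 0)"
  using assms by (auto simp: one_param_def)

lemma one_param_0: assumes "one_param x \<gamma>" shows "\<gamma> 0 = \<one>"
  using one_param_add[OF assms, of 0 0] by (simp add: l_cancel_one')

lemma one_param_minus: assumes "one_param x \<gamma>" shows "\<gamma> (- t) = inv (\<gamma> t)"
  using one_param_add[OF assms, of "-t" t] one_param_0[OF assms] by (simp add: inv_equality)

lemma one_param_power: assumes "one_param x \<gamma>" shows "\<gamma> (real n * t) = \<gamma> t [^] n"
proof (induction n)
  case (Suc n)
  have "\<gamma> (real (Suc n) * t) = \<gamma> (real n * t) \<otimes> \<gamma> t"
    using one_param_add[OF assms, of "real n * t" t] by (simp add: algebra_simps)
  then show ?case using Suc by simp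
qed (simp add: one_param_0[OF assms])

lemma one_param_open_U: assumes "one_param x \<gamma>" shows "open {t. \<gamma> t \<in> U}"
  using open_vimage[OF open_U one_param_cont[OF assms]] by (simp add: vimage_def)

lemma one_param_chain0:
  assumes "one_param x \<gamma>" "(F has_derivative D) (at p)"
  shows "((\<lambda>t. F (c (\<gamma> t))) has_vector_derivative D x) (at 0)"
  using has_vector_derivative_compose_at[OF one_param_deriv0[OF assms(1)]] assms(2) one_param_0[OF assms(1)] by simp

text \<open>Since \<open>\<gamma> (s + t) = \<gamma> s \<otimes> \<gamma> t\<close>, the velocity at
  \<open>t\<close> is the velocity at 0 pushed forward by right translation.\<close>

lemma one_param_ode:
  assumes \<gamma>: "one_param x \<gamma>" and t: "\<gamma> t \<in> U"
  shows "((\<lambda>s. c (\<gamma> s)) has_vector_derivative R (c (\<gamma> t)) x) (at t)"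
proof (rule has_vector_derivative_shift)
  have w: "c (\<gamma> t) \<in> W" using t by blast
  from one_param_chain0[OF \<gamma> R_has_derivative[OF this]]
  show "((\<lambda>s. c (\<gamma> (s + t))) has_vector_derivative R (c (\<gamma> t)) x) (at 0)"
    by (rule has_vector_derivative_transform_within_open[OF _ one_param_open_U[OF \<gamma>]])
      (use t one_U in \<open>auto simp: one_param_0[OF \<gamma>] \<psi>_c one_param_add[OF \<gamma>]\<close>)
qed

lemma one_param_derivative:
  assumes \<gamma>: "one_param x \<gamma>" and f: "smooth_fun A f"
  shows "((\<lambda>s. f (\<gamma> s \<otimes> g)) has_real_derivative rfield x f (\<gamma> t \<otimes> g)) (at t)"
proof -
  have "((\<lambda>s. f (\<gamma> (s + t) \<otimes> g)) has_vector_derivative rfield x f (\<gamma> t \<otimes> g)) (at 0)"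
    using one_param_chain0[OF \<gamma> rfield_has_derivative[OF f, of "\<gamma> t \<otimes> g"]]
    by (rule has_vector_derivative_transform_within_open[OF _ one_param_open_U[OF \<gamma>]])
      (use one_U in \<open>auto simp: one_param_0[OF \<gamma>] \<psi>_c one_param_add[OF \<gamma>] assoc\<close>)
  then show ?thesis
    by (simp add: has_real_derivative_iff_has_vector_derivative has_vector_derivative_shift)
qed

lemma one_param_weak_curve: "one_param x \<gamma> \<Longrightarrow> weak_curve A (rfield x) UNIV \<gamma>"
  using one_param_derivative[of x \<gamma> _ "\<one>"] one_param_cont by (simp add: weak_curve_def)

lemma one_param_unique: assumes "one_param x \<gamma>" "one_param x \<eta>" shows "\<gamma> = \<eta>"
proof
  fix t
  show "\<gamma> t = \<eta> t"
    by (rule weak_curve_unique[OF atlas vector_field_rfield open_UNIV connected_UNIV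
          one_param_weak_curve[OF assms(1)] one_param_weak_curve[OF assms(2)], of 0])
      (auto simp: one_param_0[OF assms(1)] one_param_0[OF assms(2)])
qed

lemma one_param_scale: assumes "one_param x \<gamma>" shows "one_param (a *\<^sub>R x) (\<lambda>t. \<gamma> (a * t))"
  unfolding one_param_def
proof (intro conjI allI)
  show "\<gamma> (a * (s + t)) = \<gamma> (a * s) \<otimes> \<gamma> (a * t)" for s t
    using one_param_add[OF assms] by (simp add: distrib_left)
  show "continuous_on UNIV (\<lambda>t. \<gamma> (a * t))"
    by (rule continuous_on_compose2[OF one_param_cont[OF assms]]) (auto intro!: continuous_intros)
  show "((\<lambda>t. c (\<gamma> (a * t))) has_vector_derivative a *\<^sub>R x) (at 0)"
    by (rule has_vector_derivative_scale_arg[OF one_param_deriv0[OF assms]])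
qed

text \<open>Near time 0 the differential equation expresses the velocity through the curve itself,
  so each order of differentiability yields the next. Right translation by
  \<open>\<gamma> t0\<close> carries this to times near \<open>t0\<close>.\<close>

lemma one_param_smooth_into: assumes \<gamma>: "one_param x \<gamma>" shows "smooth_into A UNIV \<gamma>"
proof (rule smooth_into_local[OF atlas _ open_UNIV])
  let ?J = "{t. \<gamma> t \<in> U}"
  note oJ = one_param_open_U[OF \<gamma>]
  have "Ck_on k ?J (\<lambda>t. c (\<gamma> t))" for k
  proof (induction k)
    case 0
    show ?case unfolding Ck_on.simps
      by (rule continuous_on_compose2[OF smooth_atlas_chart(4)[OF atlas chart]
            continuous_on_subset[OF one_param_cont[OF \<gamma>]]]) auto
  next
    case (Suc k)
    show ?case
      by (rule Ck_on_real_SucI[OF oJ one_param_ode[OF \<gamma>]])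
        (auto intro: Ck_on_compose[OF oJ open_W Suc Ck_on_R])
  qed
  from smooth_into_\<psi>[OF oJ this] have "smooth_into A ?J (\<lambda>t. \<psi> (c (\<gamma> t)))" by auto
  then have J: "smooth_into A ?J \<gamma>"
    by (rule smooth_into_cong[OF atlas]) (simp add: \<psi>_c)
  fix t0 :: real
  let ?T = "{t. t - t0 \<in> ?J}"
  have oT: "open ?T"
  proof -
    have "continuous_on UNIV (\<lambda>t. t - t0)" by (intro continuous_intros)
    from open_vimage[OF oJ this] show ?thesis by (simp add: vimage_def)
  qed
  have "smooth_into A ?T (\<lambda>t. \<gamma> (t - t0) \<otimes> \<gamma> t0)"
    by (intro smooth_into_mult smooth_into_const[OF atlas oT] smooth_into_comp[OF atlas J oT] Ck_on_diff[OF oT]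
        Ck_on_id Ck_on_const) auto
  then have "smooth_into A ?T \<gamma>"
    by (rule smooth_into_cong[OF atlas]) (simp add: one_param_add[OF \<gamma>, symmetric])
  then show "\<exists>T. t0 \<in> T \<and> smooth_into A T \<gamma>"
    using one_U by (intro exI[of _ ?T]) (simp add: one_param_0[OF \<gamma>])
qed

lemma one_param_integral_curve: assumes "one_param x \<gamma>" shows "integral_curve A (rfield x) \<gamma>"
  using one_param_smooth_into[OF assms] one_param_weak_curve[OF assms]
  by (simp add: integral_curve_def smooth_map_std_iff[OF atlas] weak_curve_def)

text \<open>Uniqueness of integral curves gives the definite description in \<open>lie_exp\<close>
  its meaning.\<close>

lemma lie_exp_one_param: assumes "one_param x \<gamma>" shows "lie_exp G A (rfield x) = \<gamma> 1"
proof -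
  have "(THE \<gamma>. \<gamma> 0 = \<one> \<and> integral_curve A (rfield x) \<gamma>) = \<gamma>"
  proof (rule the_equality)
    show "\<gamma> 0 = \<one> \<and> integral_curve A (rfield x) \<gamma>"
      using one_param_integral_curve[OF assms] one_param_0[OF assms] by simp
    fix \<eta> assume \<eta>: "\<eta> 0 = \<one> \<and> integral_curve A (rfield x) \<eta>"
    show "\<eta> = \<gamma>"
    proof
      fix t show "\<eta> t = \<gamma> t"
        by (rule weak_curve_unique[OF atlas vector_field_rfield open_UNIV connected_UNIV
              integral_curve_imp_weak_curve[OF conjunct2[OF \<eta>]] one_param_weak_curve[OF assms], of 0])
          (use \<eta> one_param_0[OF assms] in auto)
    qed
  qed
  then show ?thesis by (simp add: lie_exp_def)
qed

lemma invariant_flow_one_param: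
  assumes "one_param x \<gamma>" shows "invariant_flow G A (rfield x) t g = \<gamma> t \<otimes> g"
  using lie_exp_one_param[OF one_param_scale[OF assms, of t]] by (simp add: invariant_flow_def rfield_scale)

text \<open>The extension is $\gamma(t) = h(t/n)^n$ for any $n$ with $|t|/n < T$.\<close>

lemma local_hom_extend:
  fixes h :: "real \<Rightarrow> 'a"
  assumes T: "T > 0" and h: "\<And>s t. \<bar>s\<bar> < T \<Longrightarrow> \<bar>t\<bar> < T \<Longrightarrow> \<bar>s + t\<bar> < T \<Longrightarrow> h (s + t) = h s \<otimes> h t"
  obtains \<gamma> where "\<And>s t. \<gamma> (s + t) = \<gamma> s \<otimes> \<gamma> t" "\<And>t. \<bar>t\<bar> < T \<Longrightarrow> \<gamma> t = h t"
proof -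
  have h0: "h 0 = \<one>" using h[of 0 0] T by (simp add: l_cancel_one')
  have pow: "h (real k * t) = h t [^] k" if "\<bar>real k * t\<bar> < T" for k t
    using that
  proof (induction k)
    case (Suc k)
    have le: "\<bar>real k * t\<bar> \<le> \<bar>real (Suc k) * t\<bar>" "\<bar>t\<bar> \<le> \<bar>real (Suc k) * t\<bar>"
      using mult_right_mono[of "real k" "real (Suc k)" "\<bar>t\<bar>"] mult_right_mono[of 1 "real (Suc k)" "\<bar>t\<bar>"]
      by (simp_all add: abs_mult del: of_nat_Suc)
    have "h (real k * t + t) = h (real k * t) \<otimes> h t"
      using le Suc.prems by (intro h) (auto simp: algebra_simps)
    then show ?case using Suc le by (simp add: algebra_simps)
  qed (simp add: h0)
  have indep: "h (t / real n) [^] n = h (t / real m) [^] m"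
    if "n > 0" "m > 0" "\<bar>t\<bar> < real n * T" "\<bar>t\<bar> < real m * T" for n m :: nat and t
  proof -
    \<comment> \<open>Both subdivisions are compared with their common refinement into
      \<open>n * m\<close> steps.\<close>
    have *: "h (t / real n) [^] n = h (t / (real n * real m)) [^] (n * m)"
      if "n > 0" "m > 0" "\<bar>t\<bar> < real n * T" for n m :: nat
    proof -
      have "h (real m * (t / (real n * real m))) = h (t / (real n * real m)) [^] m"
        using that by (intro pow) (simp add: abs_mult field_simps)
      then show ?thesis using that by (simp add: nat_pow_pow mult.commute)
    qed
    show ?thesis using *[OF that(1,2,3)] *[OF that(2,1,4)] by (simp add: mult.commute)
  qed
  \<comment> \<open>The successor makes the bound on \<open>\<bar>t\<bar>\<close> strict and keeps
    \<open>N t\<close> positive at \<open>t = 0\<close>.\<close>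
  define N where "N t = Suc (nat \<lceil>\<bar>t\<bar> / T\<rceil>)" for t
  have N: "\<bar>t\<bar> < real (N t) * T" for t
  proof -
    have "\<bar>t\<bar> / T < real (N t)" unfolding N_def by linarith
    then show ?thesis using T by (simp add: field_simps)
  qed
  define \<gamma> where "\<gamma> t = h (t / real (N t)) [^] N t" for t
  have \<gamma>: "\<gamma> t = h (t / real n) [^] n" if "n > 0" "\<bar>t\<bar> < real n * T" for t n
    unfolding \<gamma>_def using that by (intro indep N) (auto simp: N_def)
  show ?thesis
  proof (rule that)
    show "\<gamma> t = h t" if "\<bar>t\<bar> < T" for t
      using \<gamma>[of 1 t] that by simp
    fix s t
    define n where "n = N (\<bar>s\<bar> + \<bar>t\<bar>)"
    have n: "n > 0" "\<bar>s\<bar> + \<bar>t\<bar> < real n * T" using N[of "\<bar>s\<bar> + \<bar>t\<bar>"] by (auto simp: n_def N_def)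
    then have b: "\<bar>s\<bar> < real n * T" "\<bar>t\<bar> < real n * T" "\<bar>s + t\<bar> < real n * T" by auto
    then have b': "\<bar>s / real n\<bar> < T" "\<bar>t / real n\<bar> < T" "\<bar>s / real n + t / real n\<bar> < T"
      using n(1) by (auto simp: abs_divide add_divide_distrib[symmetric] field_simps)
    have e: "h ((s + t) / real n) = h (s / real n) \<otimes> h (t / real n)"
      using h[OF b'] by (simp add: add_divide_distrib)
    \<comment> \<open>The factors commute because addition of times does; this is what allows the
      n-th power of the product to split.\<close>
    have e': "h (s / real n) \<otimes> h (t / real n) = h (t / real n) \<otimes> h (s / real n)"
      using h[OF b'] h[OF b'(2,1)] b'(3) by (simp add: add.commute)
    show "\<gamma> (s + t) = \<gamma> s \<otimes> \<gamma> t"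
      using \<gamma>[OF n(1) b(1)] \<gamma>[OF n(1) b(2)] \<gamma>[OF n(1) b(3)] e pow_mult_distrib[OF e'] by simp
  qed
qed

text \<open>A local solution of the translation equation is a local homomorphism by uniqueness, and
  powers extend it to all times. \<open>T\<close> and \<open>K\<close> must not depend on
  \<open>x\<close>: continuity of the differentials of a flow is later read off from this uniform
  remainder.\<close>

lemma one_param_exists_uniform:
  obtains T K where "T > 0" "K \<ge> 0"
    "\<And>x. norm x \<le> 1 \<Longrightarrow> \<exists>\<gamma>. one_param x \<gamma> \<and> (\<forall>t. \<bar>t\<bar> < T \<longrightarrow> \<gamma> t \<in> U \<and> norm (c (\<gamma> t) - p - t *\<^sub>R x) \<le> K * t\<^sup>2)"
proof -
  obtain \<rho> where \<rho>: "\<rho> > 0" "cball p \<rho> \<subseteq> W"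
    using open_W p_W open_contains_cball by blast
  have "\<exists>L\<ge>0. \<forall>w\<in>cball p \<rho>. \<forall>w'\<in>cball p \<rho>. norm (R w i - R w' i) \<le> L * norm (w - w')" for i
    using Ck_on_lipschitz[OF Ck_on_R compact_cball convex_cball \<rho>(2), of i] by metis
  then obtain Li where Li: "\<And>i. Li i \<ge> 0"
    "\<And>i w w'. w \<in> cball p \<rho> \<Longrightarrow> w' \<in> cball p \<rho> \<Longrightarrow> norm (R w i - R w' i) \<le> Li i * norm (w - w')"
    by metis
  define L where "L = (\<Sum>i\<in>(Basis::'b set). Li i)"
  have L0: "L \<ge> 0" unfolding L_def using Li(1) by (simp add: sum_nonneg)
  have lip: "norm (R w x - R w' x) \<le> L * norm (w - w') * norm x"
    if w: "w \<in> cball p \<rho>" "w' \<in> cball p \<rho>" for w w' x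
  proof -
    have "linear (\<lambda>v. R w v - R w' v)"
      using w \<rho>(2) linear_R by (intro linear_compose_sub) auto
    from norm_linear_le_Basis[OF this Li(2)[OF w]]
    show ?thesis by (simp add: L_def sum_distrib_right)
  qed
  have pin: "p \<in> cball p \<rho>" using \<rho> by simp
  \<comment> \<open>\<open>R p\<close> is the identity, so over the ball of radius
    \<open>\<rho>\<close> the Lipschitz bound adds at most \<open>L * \<rho>\<close> to its norm
    1.\<close>
  define B where "B = L * \<rho> + 1"
  have B: "B > 0" using L0 \<rho>(1) by (simp add: B_def add_nonneg_pos)
  have RB: "norm (R w x) \<le> B * norm x" if w: "w \<in> cball p \<rho>" for w x
  proof -
    have "norm (R w x) \<le> norm (R w x - R p x) + norm x"
      using norm_triangle_sub[of "R w x" x] by (simp add: R_p)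
    also have "norm (R w x - R p x) \<le> L * norm (w - p) * norm x" by (rule lip[OF w pin])
    also have "\<dots> \<le> L * \<rho> * norm x"
      using w L0 by (intro mult_right_mono mult_left_mono) (auto simp: dist_norm norm_minus_commute)
    finally show ?thesis by (simp add: B_def algebra_simps)
  qed
  \<comment> \<open>The first bound makes the Picard operator a contraction, the second keeps the
    solution inside the ball of radius \<open>\<rho>\<close>.\<close>
  define T where "T = min (1 / (2 * (L + 1))) (\<rho> / B)"
  have T0: "T > 0" using L0 \<rho>(1) B by (simp add: T_def)
  have TL: "T * L < 1"
  proof -
    have "T * L \<le> 1 / (2 * (L + 1)) * L" using L0 by (intro mult_right_mono) (auto simp: T_def)
    also have "\<dots> < 1" using L0 by (simp add: field_simps)
    finally show ?thesis .
  qed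
  have TB: "T * B \<le> \<rho>"
  proof -
    have "T * B \<le> \<rho> / B * B" using B by (intro mult_right_mono) (auto simp: T_def)
    then show ?thesis using B by simp
  qed
  have "\<exists>\<gamma>. one_param x \<gamma> \<and> (\<forall>t. \<bar>t\<bar> < T \<longrightarrow> \<gamma> t \<in> U \<and> norm (c (\<gamma> t) - p - t *\<^sub>R x) \<le> (L * B) * t\<^sup>2)"
    if x: "norm x \<le> 1" for x
  proof -
    have lipx: "norm (R w x - R w' x) \<le> L * norm (w - w')" if "w \<in> cball p \<rho>" "w' \<in> cball p \<rho>" for w w'
      using order_trans[OF lip[OF that] mult_left_le[OF x]] L0 by simp
    have Bx: "norm (R w x) \<le> B" if "w \<in> cball p \<rho>" for w
      using order_trans[OF RB[OF that] mult_left_le[OF x]] B by simp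
    obtain u where u: "u 0 = p" "\<And>t. t \<in> {-T..T} \<Longrightarrow> u t \<in> cball p \<rho>"
      "\<And>t. t \<in> {-T..T} \<Longrightarrow> (u has_vector_derivative R (u t) x) (at t within {-T..T})"
      using picard_lindelof[OF lipx Bx \<rho>(1) T0 L0 TL TB] by blast
    have uW: "u t \<in> W" if "t \<in> {-T..T}" for t using u(2)[OF that] \<rho>(2) by blast
    have ud: "(u has_vector_derivative R (u t) x) (at t)" if "t \<in> {-T<..<T}" for t
    proof -
      have "at t within {-T..T} = at t"
        using that by (intro at_within_interior) auto
      then show ?thesis using u(3)[of t] that by auto
    qed
    define h where "h = (\<lambda>t. \<psi> (u t))"
    have ucont: "continuous_on {-T..T} u"
      using u(3) has_vector_derivative_continuous continuous_on_eq_continuous_within by blast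
    have hU: "h t \<in> U" "c (h t) = u t" if "t \<in> {-T..T}" for t
      using uW[OF that] \<psi>_U c_\<psi> by (auto simp: h_def)
    have h0: "h 0 = \<one>" by (simp add: h_def u(1))
    have curve: "weak_curve A (rfield x) {-T<..<T} h"
      unfolding weak_curve_def
    proof (intro conjI ballI allI impI)
      show "continuous_on {-T<..<T} h" unfolding h_def
        by (rule continuous_on_compose2[OF smooth_atlas_chart(5)[OF atlas chart]
              continuous_on_subset[OF ucont]]) (use uW in auto)
      fix t f assume t: "t \<in> {-T<..<T}" and f: "smooth_fun A f"
      have w: "u t \<in> W" using uW t by auto
      let ?D = "frechet_derivative (\<lambda>y. f (\<psi> y)) (at (u t))"
      have D: "((\<lambda>y. f (\<psi> y)) has_derivative ?D) (at (u t))"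
        by (rule Ck_on_has_derivative[OF _ w, of 0], rule smooth_fun_into[OF atlas f])
          (rule smooth_into_inv_chart[OF atlas chart])
      have d1: "((\<lambda>s. f (h s)) has_vector_derivative ?D (R (u t) x)) (at t)"
        unfolding h_def by (rule has_vector_derivative_compose_at[OF ud[OF t] D])
      let ?N = "{y \<in> W. \<psi> y \<otimes> \<psi> (u t) \<in> U}"
      \<comment> \<open>\<open>R (u t)\<close> is the differential of right translation by
        \<open>h t\<close>, so the derivative of \<open>f\<close> along \<open>R (u t) x\<close> in
        the chart is the action of \<open>rfield x\<close> at \<open>h t\<close>.\<close>
      have "((\<lambda>y. f (\<psi> (c (\<psi> y \<otimes> \<psi> (u t))))) has_derivative (\<lambda>v. ?D (R (u t) v))) (at p)"
        using diff_chain_at[OF R_has_derivative[OF w], of "\<lambda>y. f (\<psi> y)" ?D] D w c_\<psi>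
        by (simp add: o_def)
      then have "((\<lambda>y. f (\<psi> y \<otimes> h t)) has_derivative (\<lambda>v. ?D (R (u t) v))) (at p)"
      proof (rule has_derivative_transform_within_open)
        show "open ?N"
          by (rule smooth_into_open[OF smooth_into_mult[OF smooth_into_inv_chart[OF atlas chart]
                  smooth_into_const[OF atlas open_W]] open_U])
        show "p \<in> ?N" using p_W w \<psi>_U by simp
      qed (auto simp: \<psi>_c h_def)
      from rfield_eqI[OF f this] show "((\<lambda>s. f (h s)) has_real_derivative rfield x f (h t)) (at t)"
        using d1 by (simp add: has_real_derivative_iff_has_vector_derivative)
    qed
    have hom: "h (s + t) = h s \<otimes> h t" if st: "\<bar>s\<bar> < T" "\<bar>t\<bar> < T" "\<bar>s + t\<bar> < T" for s t
    proof -
      \<comment> \<open>On these times both the shifted curve and the right translate are defined;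
        they solve the same equation and agree at \<open>s = 0\<close>.\<close>
      let ?I = "{-T<..<T} \<inter> {-T-t<..<T-t}"
      have 1: "weak_curve A (rfield x) ?I (\<lambda>s. h (s + t))"
        by (rule weak_curve_subset[OF weak_curve_shift[OF curve]]) auto
      have 2: "weak_curve A (rfield x) ?I (\<lambda>s. h s \<otimes> h t)"
        by (rule weak_curve_subset[OF weak_curve_mult_right[OF right_invariant_rfield curve]]) auto
      have 3: "open ?I" "connected ?I"
        by (simp add: open_Int, intro convex_connected convex_Int convex_real_interval)
      have "0 \<in> ?I" "s \<in> ?I" using st T0 by (auto simp: abs_less_iff)
      then show ?thesis
        by (intro weak_curve_unique[OF atlas vector_field_rfield 3 1 2, of 0 s]) (simp_all add: h0)
    qed
    obtain \<gamma> where \<gamma>: "\<And>s t. \<gamma> (s + t) = \<gamma> s \<otimes> \<gamma> t" "\<And>t. \<bar>t\<bar> < T \<Longrightarrow> \<gamma> t = h t"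
      using local_hom_extend[OF T0 hom] by blast
    have \<gamma>c0: "continuous_on {-T<..<T} \<gamma>"
      by (rule continuous_on_eq[of _ h]) (use curve \<gamma>(2) in \<open>auto simp: weak_curve_def abs_less_iff\<close>)
    have \<gamma>c: "continuous_on UNIV \<gamma>"
    proof (rule continuous_at_imp_continuous_on, rule ballI)
      fix t
      have "continuous_on {t-T<..<t+T} (\<lambda>s. \<gamma> (s - t) \<otimes> \<gamma> t)"
        by (intro continuous_on_mult continuous_on_const continuous_on_compose2[OF \<gamma>c0])
          (auto intro!: continuous_intros)
      then have "continuous_on {t-T<..<t+T} \<gamma>" by (simp add: \<gamma>(1)[symmetric])
      then show "isCont \<gamma> t" using T0 by (simp add: continuous_on_eq_continuous_at)
    qed
    have \<gamma>u: "c (\<gamma> t) = u t" if "\<bar>t\<bar> < T" for t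
      using \<gamma>(2)[OF that] hU(2)[of t] that by (auto simp: abs_less_iff)
    have "(u has_vector_derivative x) (at 0)" using ud[of 0] T0 by (simp add: u(1) R_p)
    then have "((\<lambda>t. c (\<gamma> t)) has_vector_derivative x) (at 0)"
      by (rule has_vector_derivative_transform_within_open[of _ _ _ "{-T<..<T}"]) (use T0 \<gamma>u in auto)
    then have "one_param x \<gamma>" using \<gamma>(1) \<gamma>c by (simp add: one_param_def)
    moreover have "norm (c (\<gamma> t) - p - t *\<^sub>R x) \<le> (L * B) * t\<^sup>2" if t: "\<bar>t\<bar> < T" for t
    proof -
      let ?S = "{-\<bar>t\<bar>..\<bar>t\<bar>}"
      have S: "s \<in> {-T<..<T}" "s \<in> {-T..T}" if "s \<in> ?S" for s using that t by auto
      have 1: "norm (u s - p) \<le> B * \<bar>t\<bar>" if s: "s \<in> ?S" for s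
      proof -
        have "norm (u s - u 0) \<le> B * norm (s - 0)"
        proof (rule differentiable_bound[of ?S u "\<lambda>s h. h *\<^sub>R R (u s) x"])
          show "(u has_derivative (\<lambda>h. h *\<^sub>R R (u s) x)) (at s within ?S)" if "s \<in> ?S" for s
            using ud[OF S(1)[OF that]] by (auto simp: has_vector_derivative_def intro: has_derivative_at_withinI)
          show "onorm (\<lambda>h. h *\<^sub>R R (u s) x) \<le> B" if "s \<in> ?S" for s
            using Bx[OF u(2)[OF S(2)[OF that]]]
            by (intro onorm_le) (simp, metis abs_ge_zero mult.commute mult_left_mono)
        qed (use s in auto)
        also have "\<dots> \<le> B * \<bar>t\<bar>" using s B by (intro mult_left_mono) auto
        finally show ?thesis by (simp add: u(1))
      qed
      \<comment> \<open>The solution moves at most \<open>B * \<bar>t\<bar>\<close> away from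
        \<open>p\<close>, so its velocity differs from \<open>x\<close> by at most
        \<open>L * (B * \<bar>t\<bar>)\<close>; a second mean value estimate gives the quadratic
        remainder.\<close>
      have "norm ((u t - p - t *\<^sub>R x) - (u 0 - p - 0 *\<^sub>R x)) \<le> (L * (B * \<bar>t\<bar>)) * norm (t - 0)"
      proof (rule differentiable_bound[of ?S "\<lambda>s. u s - p - s *\<^sub>R x" "\<lambda>s h. h *\<^sub>R R (u s) x - 0 - h *\<^sub>R x"])
        show "((\<lambda>s. u s - p - s *\<^sub>R x) has_derivative (\<lambda>h. h *\<^sub>R R (u s) x - 0 - h *\<^sub>R x)) (at s within ?S)"
          if "s \<in> ?S" for s
          using ud[OF S(1)[OF that]] unfolding has_vector_derivative_def
          by (intro has_derivative_diff has_derivative_const has_derivative_scaleR_left has_derivative_ident)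
            (auto intro: has_derivative_at_withinI)
        fix s assume s: "s \<in> ?S"
        have "norm (R (u s) x - R p x) \<le> L * norm (u s - p)" by (rule lipx[OF u(2)[OF S(2)[OF s]] pin])
        also have "\<dots> \<le> L * (B * \<bar>t\<bar>)" by (intro mult_left_mono 1 s L0)
        finally have "norm (R (u s) x - x) \<le> L * (B * \<bar>t\<bar>)" by (simp add: R_p)
        then show "onorm (\<lambda>h. h *\<^sub>R R (u s) x - 0 - h *\<^sub>R x) \<le> L * (B * \<bar>t\<bar>)"
          by (intro onorm_le) (simp add: scaleR_diff_right[symmetric], metis abs_ge_zero mult.commute mult_left_mono)
      qed auto
      then show ?thesis
        by (simp add: \<gamma>u[OF t] u(1) power2_eq_square abs_mult[symmetric] mult.assoc)
    qed
    moreover have "\<gamma> t \<in> U" if "\<bar>t\<bar> < T" for t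
      using \<gamma>(2)[OF that] hU(1)[of t] that by (auto simp: abs_less_iff)
    ultimately show ?thesis by blast
  qed
  then show ?thesis using that[OF T0, of "L * B"] L0 B by simp
qed

lemma one_param_exists: obtains \<gamma> where "one_param x \<gamma>"
proof -
  \<comment> \<open>The maximum with 1 brings \<open>x\<close> into the unit ball without dividing
    by 0.\<close>
  obtain \<gamma> where "one_param ((1 / max 1 (norm x)) *\<^sub>R x) \<gamma>"
  proof -
    have "norm ((1 / max 1 (norm x)) *\<^sub>R x) \<le> 1" by (simp add: divide_le_eq)
    then show ?thesis using one_param_exists_uniform that by metis
  qed
  from one_param_scale[OF this, of "max 1 (norm x)"] show ?thesis
    using that max.cobounded1[of 1 "norm x"] by simp
qed

end

section \<open>Smooth endomorphisms and the adjoint representation\<close>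

text \<open>Passes from \<open>Ck_on\<close>, which tests single directions, to the operator-norm
  continuity demanded by \<open>has_derivative_locally_injective\<close>. Each basis vector gets the
  share \<open>b\<close>, so that the sum over the basis is \<open>e / 2\<close>.\<close>

lemma Ck_on_onorm_continuous:
  fixes f :: "'a::euclidean_space \<Rightarrow> 'b::euclidean_space"
  assumes "open S" "Ck_on (Suc 0) S f" "a \<in> S" "e > 0"
  shows "\<exists>d>0. \<forall>x. dist a x < d \<longrightarrow>
    onorm (\<lambda>v. frechet_derivative f (at x) v - frechet_derivative f (at a) v) < e"
proof -
  define b where "b = e / (2 * real (DIM('a)))"
  have b: "b > 0" using assms(4) by (simp add: b_def)
  have "\<exists>d>0. \<forall>x. dist a x < d \<longrightarrow> x \<in> S \<and> norm (frechet_derivative f (at x) i - frechet_derivative f (at a) i) < b" for i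
  proof -
    obtain d1 where d1: "d1 > 0" "ball a d1 \<subseteq> S" using assms(1,3) open_contains_ball by blast
    have "isCont (\<lambda>x. frechet_derivative f (at x) i) a"
      using assms(1-3) continuous_on_eq_continuous_at by fastforce
    then obtain d2 where d2: "d2 > 0" "\<And>x. dist x a < d2 \<Longrightarrow> dist (frechet_derivative f (at x) i) (frechet_derivative f (at a) i) < b"
      unfolding continuous_at_eps_delta using b by blast
    have "min d1 d2 > 0" using d1 d2 by simp
    then show ?thesis using d1(2) d2(2) by (intro exI[of _ "min d1 d2"]) (auto simp: dist_norm norm_minus_commute)
  qed
  then obtain d where d: "\<And>i. d i > 0"
    "\<And>i x. dist a x < d i \<Longrightarrow> x \<in> S \<and> norm (frechet_derivative f (at x) i - frechet_derivative f (at a) i) < b"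
    by metis
  define d0 where "d0 = Min (d ` Basis)"
  have d0: "d0 > 0" unfolding d0_def using d(1) by (simp add: Min_gr_iff)
  have d0i: "d0 \<le> d i" if "i \<in> Basis" for i unfolding d0_def using that by simp
  have "onorm (\<lambda>v. frechet_derivative f (at x) v - frechet_derivative f (at a) v) < e" if x: "dist a x < d0" for x
  proof -
    obtain i :: 'a where i: "i \<in> Basis" using nonempty_Basis by blast
    then have "x \<in> S" using d(2)[of x i] less_le_trans[OF x d0i[OF i]] by blast
    then have "linear (\<lambda>v. frechet_derivative f (at x) v - frechet_derivative f (at a) v)"
      using assms(2,3) by (intro linear_compose_sub linear_frechet_derivative) auto
    from norm_linear_le_Basis[OF this, of "\<lambda>i. b"]
    have "norm (frechet_derivative f (at x) v - frechet_derivative f (at a) v) \<le> (\<Sum>i\<in>(Basis::'a set). b) * norm v" for v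
      using d(2) d0i x by (meson less_imp_le less_le_trans)
    then have "onorm (\<lambda>v. frechet_derivative f (at x) v - frechet_derivative f (at a) v) \<le> (\<Sum>i\<in>(Basis::'a set). b)"
      by (intro onorm_le)
    also have "\<dots> = e / 2" by (simp add: b_def)
    finally show ?thesis using assms(4) by simp
  qed
  then show ?thesis using d0 by blast
qed

context lie_chart
begin

definition smooth_hom :: "('a \<Rightarrow> 'a) \<Rightarrow> bool" where
  "smooth_hom \<phi> \<longleftrightarrow> (\<forall>x y. \<phi> (x \<otimes> y) = \<phi> x \<otimes> \<phi> y) \<and> smooth_map A A \<phi>"

definition diff :: "('a \<Rightarrow> 'a) \<Rightarrow> 'b \<Rightarrow> 'b" where
  "diff \<phi> x = frechet_derivative (\<lambda>y. c (\<phi> (\<psi> y))) (at p) x"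

lemma smooth_hom_mult: "smooth_hom \<phi> \<Longrightarrow> \<phi> (x \<otimes> y) = \<phi> x \<otimes> \<phi> y"
  by (simp add: smooth_hom_def)

lemma smooth_hom_one [simp]: assumes "smooth_hom \<phi>" shows "\<phi> \<one> = \<one>"
  using smooth_hom_mult[OF assms, of "\<one>" "\<one>"] by (simp add: l_cancel_one')

lemma smooth_hom_inv: assumes "smooth_hom \<phi>" shows "\<phi> (inv x) = inv (\<phi> x)"
  using smooth_hom_mult[OF assms, of "inv x" x] assms by (simp add: inv_equality)

lemma smooth_hom_cont: "smooth_hom \<phi> \<Longrightarrow> continuous_on UNIV \<phi>"
  by (simp add: smooth_hom_def smooth_map_def)

lemma smooth_hom_into: "smooth_hom \<phi> \<Longrightarrow> smooth_into A W (\<lambda>y. \<phi> (\<psi> y))"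
  using smooth_map_smooth_into[OF atlas atlas _ smooth_into_inv_chart[OF atlas chart]]
  by (simp add: smooth_hom_def)

lemma smooth_hom_near:
  assumes "smooth_hom \<phi>"
  shows "open {y \<in> W. \<phi> (\<psi> y) \<in> U}" "p \<in> {y \<in> W. \<phi> (\<psi> y) \<in> U}"
  using smooth_into_open[OF smooth_hom_into[OF assms] open_U] p_W one_U assms by auto

lemma diff_has_derivative:
  assumes "smooth_hom \<phi>" shows "((\<lambda>y. c (\<phi> (\<psi> y))) has_derivative diff \<phi>) (at p)"
  using Ck_on_has_derivative[OF smooth_intoD(3)[OF smooth_hom_into[OF assms] chart]
      smooth_hom_near(2)[OF assms]]
  by (simp add: diff_def[abs_def])

lemma diff_eqI:
  assumes "smooth_hom \<phi>" "((\<lambda>y. c (\<phi> (\<psi> y))) has_derivative D) (at p)"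
  shows "diff \<phi> = D"
  using has_derivative_unique[OF diff_has_derivative[OF assms(1)] assms(2)] .

lemma linear_diff: "smooth_hom \<phi> \<Longrightarrow> linear (diff \<phi>)"
  using diff_has_derivative has_derivative_linear by blast

lemma smooth_hom_id: "smooth_hom (\<lambda>x. x)"
  unfolding smooth_hom_def smooth_map_chart_iff[OF atlas atlas]
  using smooth_into_inv_chart[OF atlas] by auto

lemma diff_id: "diff (\<lambda>x. x) = (\<lambda>x. x)"
proof (rule diff_eqI[OF smooth_hom_id])
  show "((\<lambda>y. c (\<psi> y)) has_derivative (\<lambda>x. x)) (at p)"
    by (rule has_derivative_transform_within_open[OF has_derivative_ident open_W p_W]) (simp add: c_\<psi>)
qed

lemma smooth_hom_comp:
  assumes "smooth_hom \<phi>" "smooth_hom \<theta>" shows "smooth_hom (\<lambda>x. \<phi> (\<theta> x))"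
proof -
  have "smooth_map A A (\<lambda>x. \<phi> (\<theta> x))"
    unfolding smooth_map_chart_iff[OF atlas atlas]
    using smooth_map_smooth_into[OF atlas atlas _ smooth_map_smooth_into[OF atlas atlas _ smooth_into_inv_chart[OF atlas]]]
      assms unfolding smooth_hom_def by blast
  then show ?thesis using assms by (simp add: smooth_hom_def)
qed

lemma diff_comp:
  assumes "smooth_hom \<phi>" "smooth_hom \<theta>"
  shows "diff (\<lambda>x. \<phi> (\<theta> x)) x = diff \<phi> (diff \<theta> x)"
proof -
  have "((\<lambda>y. c (\<phi> (\<psi> y))) has_derivative diff \<phi>) (at (c (\<theta> (\<psi> p))))"
    using diff_has_derivative[OF assms(1)] assms(2) by simp
  from diff_chain_at[OF diff_has_derivative[OF assms(2)] this]
  have "((\<lambda>y. c (\<phi> (\<psi> (c (\<theta> (\<psi> y)))))) has_derivative (\<lambda>x. diff \<phi> (diff \<theta> x))) (at p)"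
    by (simp add: o_def)
  then have "((\<lambda>y. c (\<phi> (\<theta> (\<psi> y)))) has_derivative (\<lambda>x. diff \<phi> (diff \<theta> x))) (at p)"
    by (rule has_derivative_transform_within_open[OF _ smooth_hom_near[OF assms(2)]]) (simp add: \<psi>_c)
  from diff_eqI[OF smooth_hom_comp[OF assms] this] show ?thesis by simp
qed

lemma smooth_hom_one_param:
  assumes \<phi>: "smooth_hom \<phi>" and \<gamma>: "one_param x \<gamma>"
  shows "one_param (diff \<phi> x) (\<lambda>t. \<phi> (\<gamma> t))"
  unfolding one_param_def
proof (intro conjI allI)
  show "\<phi> (\<gamma> (s + t)) = \<phi> (\<gamma> s) \<otimes> \<phi> (\<gamma> t)" for s t
    by (simp add: one_param_add[OF \<gamma>] smooth_hom_mult[OF \<phi>])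
  show "continuous_on UNIV (\<lambda>t. \<phi> (\<gamma> t))"
    by (rule continuous_on_compose2[OF smooth_hom_cont[OF \<phi>] one_param_cont[OF \<gamma>]]) simp
  show "((\<lambda>t. c (\<phi> (\<gamma> t))) has_vector_derivative diff \<phi> x) (at 0)"
    using one_param_chain0[OF \<gamma> diff_has_derivative[OF \<phi>]]
    by (rule has_vector_derivative_transform_within_open[OF _ one_param_open_U[OF \<gamma>]])
      (use one_U in \<open>auto simp: one_param_0[OF \<gamma>] \<psi>_c\<close>)
qed

text \<open>The differential of the multiplication at the pair of units is addition: it is linear,
  and the identity on each factor.\<close>

lemma has_derivative_mult_one:
  fixes F1 F2 :: "'e::real_normed_vector \<Rightarrow> 'a"
  assumes F: "continuous_on UNIV F1" "continuous_on UNIV F2" "F1 z = \<one>" "F2 z = \<one>"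
    and D: "((\<lambda>v. c (F1 v)) has_derivative D1) (at z)" "((\<lambda>v. c (F2 v)) has_derivative D2) (at z)"
  shows "((\<lambda>v. c (F1 v \<otimes> F2 v)) has_derivative (\<lambda>v. D1 v + D2 v)) (at z)"
proof -
  let ?m = "\<lambda>z. c (\<psi> (fst z) \<otimes> \<psi> (snd z))"
  let ?D = "frechet_derivative ?m (at (p, p))"
  have m: "(?m has_derivative ?D) (at (p, p))"
    by (rule Ck_on_has_derivative[OF Ck_on_\<Omega> p_\<Omega>(1)[OF p_W]])
  have "((\<lambda>y. ?m (y, p)) has_derivative (\<lambda>v. v)) (at p)" "((\<lambda>y. ?m (p, y)) has_derivative (\<lambda>v. v)) (at p)"
    by (rule has_derivative_transform_within_open[OF has_derivative_ident open_W p_W], simp add: c_\<psi>)+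
  from has_derivative_unique[OF has_derivative_partial1[OF m] this(1)]
    has_derivative_unique[OF has_derivative_partial2[OF m] this(2)]
  have D1: "?D (v, 0) = v" and D2: "?D (0, v) = v" for v by (simp_all add: fun_eq_iff)
  have Dsum: "?D (v, w) = v + w" for v w
    using linear_add[OF has_derivative_linear[OF m], of "(v, 0)" "(0, w)"] D1 D2 by simp
  have 1: "((\<lambda>v. (c (F1 v), c (F2 v))) has_derivative (\<lambda>v. (D1 v, D2 v))) (at z)"
    by (rule has_derivative_Pair[OF D])
  have 2: "(?m has_derivative ?D) (at (c (F1 z), c (F2 z)))" using m F(3,4) by simp
  from diff_chain_at[OF 1 2]
  have "((\<lambda>v. ?m (c (F1 v), c (F2 v))) has_derivative (\<lambda>v. D1 v + D2 v)) (at z)"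
    by (simp add: Dsum o_def)
  then show ?thesis
  proof (rule has_derivative_transform_within_open)
    show "open (F1 -` U \<inter> F2 -` U)"
      using open_vimage[OF open_U F(1)] open_vimage[OF open_U F(2)] by (rule open_Int)
  qed (use F(3,4) one_U in \<open>auto simp: \<psi>_c\<close>)
qed

text \<open>Canonical coordinates of the second kind: the product of three one-parameter subgroups
  along the basis has the identity as differential at 0. Only surjectivity onto a neighbourhood is
  wanted, so an open mapping theorem with differentiability at one point is enough.\<close>

lemma one_param_product_nbhd:
  assumes "DIM('b) = 3"
  obtains N where "open N" "\<one> \<in> N"
    "\<And>g. g \<in> N \<Longrightarrow> \<exists>x y z \<alpha> \<beta> \<gamma> r s t. one_param x \<alpha> \<and> one_param y \<beta> \<and> one_param z \<gamma> \<and> g = \<alpha> r \<otimes> \<beta> s \<otimes> \<gamma> t"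
proof -
  obtain i j k :: 'b where B: "Basis = {i, j, k}" "i \<noteq> j" "i \<noteq> k" "j \<noteq> k"
    using assms by (auto simp: card_3_iff)
  obtain \<alpha> \<beta> \<gamma> where o: "one_param i \<alpha>" "one_param j \<beta>" "one_param k \<gamma>" using one_param_exists by metis
  have cont: "continuous_on UNIV (\<lambda>v. \<delta> (v \<bullet> l))" if "one_param x \<delta>" for x \<delta> and l :: 'b
    by (rule continuous_on_compose2[OF one_param_cont[OF that]]) (auto intro!: continuous_intros)
  have der: "((\<lambda>v. c (\<delta> (v \<bullet> l))) has_derivative (\<lambda>v. (v \<bullet> l) *\<^sub>R x)) (at 0)" if "one_param x \<delta>" for x \<delta> and l :: 'b
  proof -
    have 1: "((\<lambda>v. v \<bullet> l) has_derivative (\<lambda>v. v \<bullet> l)) (at 0)" by (auto intro!: derivative_eq_intros)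
    have 2: "((\<lambda>t. c (\<delta> t)) has_derivative (\<lambda>h. h *\<^sub>R x)) (at (0 \<bullet> l))"
      using one_param_deriv0[OF that] by (simp add: has_vector_derivative_def)
    from diff_chain_at[OF 1 2] show ?thesis by (simp add: o_def)
  qed
  define F where "F v = \<alpha> (v \<bullet> i) \<otimes> \<beta> (v \<bullet> j) \<otimes> \<gamma> (v \<bullet> k)" for v
  have Fc: "continuous_on UNIV F" unfolding F_def
    by (intro continuous_on_mult cont[OF o(1)] cont[OF o(2)] cont[OF o(3)])
  have F0: "F 0 = \<one>" by (simp add: F_def one_param_0[OF o(1)] one_param_0[OF o(2)] one_param_0[OF o(3)])
  have "((\<lambda>v. c (F v)) has_derivative (\<lambda>v. ((v \<bullet> i) *\<^sub>R i + (v \<bullet> j) *\<^sub>R j) + (v \<bullet> k) *\<^sub>R k)) (at 0)"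
    unfolding F_def
    by (intro has_derivative_mult_one continuous_on_mult cont[OF o(1)] cont[OF o(2)] cont[OF o(3)]
        der[OF o(1)] der[OF o(2)] der[OF o(3)])
      (simp_all add: one_param_0[OF o(1)] one_param_0[OF o(2)] one_param_0[OF o(3)])
  moreover have "((v \<bullet> i) *\<^sub>R i + (v \<bullet> j) *\<^sub>R j) + (v \<bullet> k) *\<^sub>R k = v" for v
    using euclidean_representation[of v, unfolded B(1)] B(2-4) by (simp add: add.assoc)
  ultimately have dF: "((\<lambda>v. c (F v)) has_derivative (\<lambda>v. v)) (at 0)" by simp
  let ?S = "F -` U"
  have oS: "open ?S" by (rule open_vimage[OF open_U Fc])
  have "c (F 0) \<in> interior ((\<lambda>v. c (F v)) ` ?S)"
  proof (rule sussmann_open_mapping[OF oS _ _ dF])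
    show "continuous_on ?S (\<lambda>v. c (F v))"
      by (rule continuous_on_compose2[OF smooth_atlas_chart(4)[OF atlas chart] continuous_on_subset[OF Fc]]) auto
    show "bounded_linear (\<lambda>v::'b. v)" by (rule bounded_linear_ident)
  qed (use oS F0 one_U in \<open>auto simp: interior_open o_def id_def\<close>)
  then have pI: "p \<in> interior ((\<lambda>v. c (F v)) ` ?S)" using F0 by simp
  let ?N = "U \<inter> c -` interior ((\<lambda>v. c (F v)) ` ?S)"
  show ?thesis
  proof (rule that)
    show "open ?N"
      by (rule continuous_open_preimage[OF smooth_atlas_chart(4)[OF atlas chart] open_U open_interior])
    show "\<one> \<in> ?N" using pI one_U by simp
    fix g assume g: "g \<in> ?N"
    then obtain v where v: "F v \<in> U" "c g = c (F v)" using interior_subset by blast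
    then have "g = F v" using g \<psi>_c by (metis IntD1)
    then show "\<exists>x y z \<alpha> \<beta> \<gamma> r s t. one_param x \<alpha> \<and> one_param y \<beta> \<and> one_param z \<gamma> \<and> g = \<alpha> r \<otimes> \<beta> s \<otimes> \<gamma> t"
      unfolding F_def using o by blast
  qed
qed

lemma open_translate: assumes "open N" shows "open {x. g \<otimes> x \<otimes> h \<in> N}"
proof -
  have "continuous_on UNIV (\<lambda>x. g \<otimes> x \<otimes> h)"
    by (intro continuous_on_mult continuous_on_const continuous_on_id)
  from open_vimage[OF assms this] show ?thesis by (simp add: vimage_def)
qed

text \<open>By uniqueness such a homomorphism fixes every one-parameter subgroup, hence a
  neighbourhood of the unit. Its fixed set is closed, open by translation and nonempty, so
  connectedness makes it everything.\<close>

lemma diff_id_imp_id: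
  assumes "DIM('b) = 3" "connected (UNIV :: 'a set)" and \<phi>: "smooth_hom \<phi>" and d: "\<And>x. diff \<phi> x = x"
  shows "\<phi> g = g"
proof -
  have fix_one_param: "\<phi> (\<gamma> t) = \<gamma> t" if "one_param x \<gamma>" for x \<gamma> t
    using one_param_unique[OF that] smooth_hom_one_param[OF \<phi> that] d by metis
  obtain N where N: "open N" "\<one> \<in> N"
    "\<And>g. g \<in> N \<Longrightarrow> \<exists>x y z \<alpha> \<beta> \<gamma> r s t. one_param x \<alpha> \<and> one_param y \<beta> \<and> one_param z \<gamma> \<and> g = \<alpha> r \<otimes> \<beta> s \<otimes> \<gamma> t"
    using one_param_product_nbhd[OF assms(1)] by blast
  have fixN: "\<phi> g = g" if "g \<in> N" for g
    using N(3)[OF that] fix_one_param smooth_hom_mult[OF \<phi>] by metis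
  let ?H = "{g. \<phi> g = g}"
  have "closed ?H"
    by (rule closed_Collect_eq[OF smooth_hom_cont[OF \<phi>] continuous_on_id])
  moreover have "open ?H"
  proof (subst open_subopen, intro ballI)
    fix g assume g: "g \<in> ?H"
    let ?T = "{x. \<one> \<otimes> x \<otimes> inv g \<in> N}"
    have "x \<in> ?H" if "x \<in> ?T" for x
    proof -
      have "\<phi> (x \<otimes> inv g) = x \<otimes> inv g" using that by (intro fixN) simp
      then have "\<phi> x \<otimes> inv g = x \<otimes> inv g"
        using g by (simp add: smooth_hom_mult[OF \<phi>] smooth_hom_inv[OF \<phi>])
      then show ?thesis by simp
    qed
    then show "\<exists>T. open T \<and> g \<in> T \<and> T \<subseteq> ?H"
      using open_translate[OF N(1), of "\<one>" "inv g"] N(2) by (intro exI[of _ ?T]) auto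
  qed
  moreover have "?H \<noteq> {}" using smooth_hom_one[OF \<phi>] by blast
  ultimately have "?H = UNIV"
    using assms(2) connected_clopen[of "UNIV :: 'a set"] by auto
  then show ?thesis by blast
qed

section \<open>The adjoint representation and the bracket\<close>

definition Ad :: "'a \<Rightarrow> 'b \<Rightarrow> 'b" where
  "Ad g = diff (\<lambda>x. g \<otimes> x \<otimes> inv g)"

lemma smooth_hom_conj: "smooth_hom (\<lambda>x. g \<otimes> x \<otimes> inv g)"
  using smooth_map_conj by (auto simp: smooth_hom_def assoc)

lemma linear_Ad: "linear (Ad g)"
  unfolding Ad_def by (rule linear_diff[OF smooth_hom_conj])

lemma Ad_mult: "Ad (g \<otimes> h) x = Ad g (Ad h x)"
  unfolding Ad_def diff_comp[OF smooth_hom_conj smooth_hom_conj, symmetric]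
  by (simp add: inv_mult assoc)

lemma Ad_one: "Ad \<one> x = x"
  unfolding Ad_def by (simp add: diff_id)

text \<open>\<open>\<phi>\<close> carries conjugation by \<open>g\<close> to conjugation by
  \<open>\<phi> g\<close>; both sides are the differential of the same composite.\<close>

lemma diff_Ad:
  assumes \<phi>: "smooth_hom \<phi>" shows "diff \<phi> (Ad g x) = Ad (\<phi> g) (diff \<phi> x)"
  unfolding Ad_def diff_comp[OF \<phi> smooth_hom_conj, symmetric] diff_comp[OF smooth_hom_conj \<phi>, symmetric]
  by (simp add: smooth_hom_mult[OF \<phi>] smooth_hom_inv[OF \<phi>])

lemma Ck_on_Ad: "Ck_on k W (\<lambda>w. Ad (\<psi> w) y)"
proof -
  let ?F = "\<lambda>z. \<psi> (fst z) \<otimes> \<psi> (snd z) \<otimes> inv \<psi> (fst z)"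
  have F: "smooth_into A (W \<times> W) ?F"
    by (intro smooth_into_mult smooth_into_m_inv smooth_into_\<psi> open_Times open_W Ck_on_fst Ck_on_snd) auto
  have "Ck_on k W (\<lambda>w. frechet_derivative (\<lambda>y. c (?F (w, y))) (at p) y)"
  proof (rule Ck_on_partial2[OF smooth_intoD(3)[OF F chart] smooth_into_open[OF F open_U] open_W])
    show "(w, p) \<in> {z \<in> W \<times> W. ?F z \<in> U}" if "w \<in> W" for w
      using that p_W one_U by (simp add: assoc)
  qed
  then show ?thesis by (simp add: Ad_def diff_def)
qed

text \<open>\<open>M x y\<close> is the Lie bracket of \<open>x\<close> and \<open>y\<close>.\<close>

definition M :: "'b \<Rightarrow> 'b \<Rightarrow> 'b" where
  "M x y = frechet_derivative (\<lambda>w. Ad (\<psi> w) y) (at p) x"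

lemma M_has_derivative: "((\<lambda>w. Ad (\<psi> w) y) has_derivative (\<lambda>x. M x y)) (at p)"
  using Ck_on_has_derivative[OF Ck_on_Ad p_W] by (simp add: M_def)

lemma M_eqI: "((\<lambda>w. Ad (\<psi> w) y) has_derivative D) (at p) \<Longrightarrow> M x y = D x"
  using has_derivative_unique[OF M_has_derivative] by metis

lemma linear_M1: "linear (\<lambda>x. M x y)"
  using M_has_derivative has_derivative_linear by blast

lemma linear_M2: "linear (M x)"
proof (rule linearI)
  show "M x (y + z) = M x y + M x z" for y z
    using has_derivative_add[OF M_has_derivative[of y] M_has_derivative[of z]]
    by (intro M_eqI[where D="\<lambda>x. M x y + M x z"]) (simp add: linear_add[OF linear_Ad])
  show "M x (r *\<^sub>R y) = r *\<^sub>R M x y" for r y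
    using has_derivative_scaleR_right[OF M_has_derivative[of y], of r]
    by (intro M_eqI[where D="\<lambda>x. r *\<^sub>R M x y"]) (simp add: linear_cmul[OF linear_Ad])
qed

text \<open>This is \<open>diff_Ad\<close> differentiated in \<open>g\<close> at the unit: the
  differential of a smooth homomorphism preserves the bracket.\<close>

lemma diff_M:
  assumes \<phi>: "smooth_hom \<phi>" shows "diff \<phi> (M x y) = M (diff \<phi> x) (diff \<phi> y)"
proof -
  have "bounded_linear (diff \<phi>)" using linear_diff[OF \<phi>] by (rule linear_conv_bounded_linear[THEN iffD1])
  from bounded_linear.has_derivative[OF this M_has_derivative]
  have 1: "((\<lambda>w. Ad (\<phi> (\<psi> w)) (diff \<phi> y)) has_derivative (\<lambda>x. diff \<phi> (M x y))) (at p)"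
    by (simp add: diff_Ad[OF \<phi>])
  have "((\<lambda>w. Ad (\<psi> w) (diff \<phi> y)) has_derivative (\<lambda>x. M x (diff \<phi> y))) (at (c (\<phi> (\<psi> p))))"
    using M_has_derivative \<phi> by simp
  from diff_chain_at[OF diff_has_derivative[OF \<phi>] this]
  have "((\<lambda>w. Ad (\<psi> (c (\<phi> (\<psi> w)))) (diff \<phi> y)) has_derivative (\<lambda>x. M (diff \<phi> x) (diff \<phi> y))) (at p)"
    by (simp add: o_def)
  then have "((\<lambda>w. Ad (\<phi> (\<psi> w)) (diff \<phi> y)) has_derivative (\<lambda>x. M (diff \<phi> x) (diff \<phi> y))) (at p)"
    by (rule has_derivative_transform_within_open[OF _ smooth_hom_near[OF \<phi>]]) (simp add: \<psi>_c)
  from has_derivative_unique[OF 1 this] show ?thesis by metis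
qed

text \<open>Exhibits \<open>M x\<close> as the generator of the linear group
  \<open>Ad (\<gamma> t)\<close>, that is, as ad of \<open>x\<close>.\<close>

lemma Ad_one_param_derivative:
  assumes \<gamma>: "one_param x \<gamma>"
  shows "((\<lambda>t. Ad (\<gamma> t) y) has_vector_derivative M x (Ad (\<gamma> t) y)) (at t)"
proof (rule has_vector_derivative_shift)
  show "((\<lambda>s. Ad (\<gamma> (s + t)) y) has_vector_derivative M x (Ad (\<gamma> t) y)) (at 0)"
    using one_param_chain0[OF \<gamma> M_has_derivative[of "Ad (\<gamma> t) y"]]
    by (rule has_vector_derivative_transform_within_open[OF _ one_param_open_U[OF \<gamma>]])
      (use one_U in \<open>auto simp: one_param_0[OF \<gamma>] \<psi>_c one_param_add[OF \<gamma>] Ad_mult\<close>)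
qed

text \<open>Continuity bounds \<open>Ad\<close> near the unit; finitely many left translates of that
  neighbourhood cover the group, and multiplicativity of \<open>Ad\<close> does the rest. The
  summand 1 in the final constant only secures positivity.\<close>

lemma Ad_bounded:
  assumes "compact (UNIV :: 'a set)"
  obtains C where "C > 0" "\<And>g y. norm (Ad g y) \<le> C * norm y"
proof -
  define N where "N = {g \<in> U. \<forall>i\<in>Basis. norm (Ad g i) < 2}"
  have "N = (\<Inter>i\<in>Basis. U \<inter> c -` {w \<in> W. norm (Ad (\<psi> w) i) \<in> {..<2}})"
    using nonempty_Basis by (auto simp: N_def \<psi>_c)
  also have "open \<dots>"
  proof (intro open_INT finite_Basis ballI continuous_open_preimage[OF smooth_atlas_chart(4)[OF atlas chart] open_U])
    fix i :: 'b
    have "continuous_on W (\<lambda>w. norm (Ad (\<psi> w) i))"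
      by (intro continuous_on_norm Ck_on_imp_continuous_on[OF Ck_on_Ad[of 0]])
    from continuous_open_preimage[OF this open_W open_lessThan[of 2]]
    show "open {w \<in> W. norm (Ad (\<psi> w) i) \<in> {..<2}}" by (simp add: vimage_def Int_def)
  qed
  finally have oN: "open N" .
  have 1: "\<one> \<in> N" using one_U by (simp add: N_def Ad_one)
  define B where "B = (\<Sum>i\<in>(Basis::'b set). 2::real)"
  have NB: "norm (Ad g y) \<le> B * norm y" if "g \<in> N" for g y
    unfolding B_def by (rule norm_linear_le_Basis[OF linear_Ad]) (use that in \<open>auto simp: N_def\<close>)
  have "open {x. inv g \<otimes> x \<in> N}" for g
    using open_translate[OF oN, of "inv g" "\<one>"] by simp
  moreover have "UNIV \<subseteq> (\<Union>g. {x. inv g \<otimes> x \<in> N})"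
  proof
    fix x have "x \<in> {y. inv x \<otimes> y \<in> N}" using 1 by simp
    then show "x \<in> (\<Union>g. {x. inv g \<otimes> x \<in> N})" by blast
  qed
  ultimately have "\<exists>D\<subseteq>UNIV. finite D \<and> UNIV \<subseteq> (\<Union>g\<in>D. {x. inv g \<otimes> x \<in> N})"
    by (rule_tac compactE_image[OF assms, of UNIV "\<lambda>g. {x. inv g \<otimes> x \<in> N}"]) blast+
  then obtain D where D: "finite D" "\<And>x. \<exists>g\<in>D. inv g \<otimes> x \<in> N" by (auto simp: subset_eq)
  have "\<exists>b>0. \<forall>y. norm (Ad g y) \<le> b * norm y" for g
    using linear_bounded_pos[OF linear_Ad] by metis
  then obtain b where b: "\<And>g. b g > 0" "\<And>g y. norm (Ad g y) \<le> b g * norm y" by metis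
  let ?C = "1 + (\<Sum>g\<in>D. b g) * B"
  have B0: "B \<ge> 0" by (simp add: B_def)
  have "norm (Ad x y) \<le> ?C * norm y" for x y
  proof -
    obtain g where g: "g \<in> D" "inv g \<otimes> x \<in> N" using D by blast
    have "norm (Ad x y) = norm (Ad g (Ad (inv g \<otimes> x) y))" by (simp add: Ad_mult[symmetric])
    also have "\<dots> \<le> b g * (B * norm y)"
      using order_trans[OF b(2) mult_left_mono[OF NB[OF g(2)] less_imp_le[OF b(1)]]] .
    also have "\<dots> \<le> (\<Sum>g\<in>D. b g) * (B * norm y)"
      using B0 b(1) g D(1) by (intro mult_right_mono member_le_sum) (auto intro: less_imp_le)
    also have "\<dots> \<le> ?C * norm y" by (simp add: algebra_simps)
    finally show ?thesis .
  qed
  moreover have "?C > 0"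
    using B0 b(1) by (intro add_pos_nonneg mult_nonneg_nonneg sum_nonneg) (auto intro: less_imp_le)
  ultimately show ?thesis using that by blast
qed

text \<open>If the generator is 0, then \<open>Ad (\<gamma> t)\<close> does not vary with
  \<open>t\<close> and is the identity; conjugation by \<open>\<gamma> t\<close> then has identity
  differential and is trivial.\<close>

lemma M_zero_imp_central:
  assumes dim: "DIM('b) = 3" "connected (UNIV :: 'a set)" and M: "\<And>y. M x y = 0" and \<gamma>: "one_param x \<gamma>"
  shows "\<gamma> t \<otimes> g = g \<otimes> \<gamma> t"
proof -
  have "Ad (\<gamma> t) y = y" for y
  proof -
    have "((\<lambda>t. Ad (\<gamma> t) y) has_vector_derivative 0) (at t within UNIV)" for t
      using Ad_one_param_derivative[OF \<gamma>, of y t] by (simp add: M)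
    then obtain k where "\<And>t. Ad (\<gamma> t) y = k"
      using has_vector_derivative_zero_constant[of UNIV "\<lambda>t. Ad (\<gamma> t) y"] by auto
    then show ?thesis using Ad_one[of y] one_param_0[OF \<gamma>] by metis
  qed
  then have "\<gamma> t \<otimes> g \<otimes> inv (\<gamma> t) = g"
    using diff_id_imp_id[OF dim smooth_hom_conj[of "\<gamma> t"], of g] by (simp add: Ad_def)
  then have "\<gamma> t \<otimes> g \<otimes> inv (\<gamma> t) \<otimes> \<gamma> t = g \<otimes> \<gamma> t" by simp
  then show ?thesis by (simp add: assoc)
qed

text \<open>\<open>\<gamma>\<close> is central, so \<open>f\<close> along the product of
  \<open>\<gamma> t\<close>, \<open>\<eta> s\<close> and \<open>g\<close> can be differentiated in
  \<open>t\<close> first or in \<open>s\<close> first. The two orders give the two compositions of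
  the fields, which therefore agree. No general formula relating \<open>M\<close> to
  \<open>vf_bracket\<close> is involved.\<close>

lemma rfield_commute:
  assumes dim: "DIM('b) = 3" "connected (UNIV :: 'a set)" and M: "\<And>y. M x y = 0"
  shows "vf_bracket (rfield x) (rfield y) = 0" "vf_bracket (rfield y) (rfield x) = 0"
proof -
  obtain \<gamma> where \<gamma>: "one_param x \<gamma>" by (rule one_param_exists)
  obtain \<eta> where \<eta>: "one_param y \<eta>" by (rule one_param_exists)
  have central: "\<gamma> t \<otimes> g = g \<otimes> \<gamma> t" for t g by (rule M_zero_imp_central[OF dim M \<gamma>])
  have zero: "rfield z 0 g = 0" for z g
    using rfield_eqI[OF smooth_fun_const[OF atlas] has_derivative_const, of z 0 g] by (simp add: zero_fun_def)
  have "rfield x (rfield y f) g = rfield y (rfield x f) g" for f g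
  proof (cases "smooth_fun A f")
    case f: True
    note fx = smooth_fun_rfield[OF f, of x] and fy = smooth_fun_rfield[OF f, of y]
    note fxy = smooth_fun_rfield[OF fy, of x] and fyx = smooth_fun_rfield[OF fx, of y]
    let ?m = "\<lambda>t s. \<gamma> t \<otimes> (\<eta> s \<otimes> g)"
    have m: "?m t s = \<eta> s \<otimes> (\<gamma> t \<otimes> g)" for t s
      by (metis assoc central)
    have cont: "isCont (\<lambda>(t, s). h (?m t s)) (0, 0)" if "smooth_fun A h" for h
    proof -
      have "continuous_on UNIV (\<lambda>z. h (\<gamma> (fst z) \<otimes> (\<eta> (snd z) \<otimes> g)))"
        by (intro continuous_on_compose2[OF smooth_fun_continuous[OF that]] continuous_on_mult
            continuous_on_compose2[OF one_param_cont[OF \<gamma>]] continuous_on_compose2[OF one_param_cont[OF \<eta>]])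
          (auto intro!: continuous_intros)
      then show ?thesis by (simp add: continuous_on_eq_continuous_at split_def)
    qed
    have "rfield y (rfield x f) (?m 0 0) = rfield x (rfield y f) (?m 0 0)"
    proof (rule mixed_derivatives_eq[of "\<lambda>t s. f (?m t s)" "\<lambda>t s. rfield x f (?m t s)"
          "\<lambda>t s. rfield y (rfield x f) (?m t s)" "\<lambda>t s. rfield y f (?m t s)" "\<lambda>t s. rfield x (rfield y f) (?m t s)"])
      show "((\<lambda>t. f (?m t s)) has_real_derivative rfield x f (?m t s)) (at t)" for t s
        by (rule one_param_derivative[OF \<gamma> f])
      show "((\<lambda>s. rfield x f (?m t s)) has_real_derivative rfield y (rfield x f) (?m t s)) (at s)" for t s
        unfolding m by (rule one_param_derivative[OF \<eta> fx])
      show "((\<lambda>s. f (?m t s)) has_real_derivative rfield y f (?m t s)) (at s)" for t s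
        unfolding m by (rule one_param_derivative[OF \<eta> f])
      show "((\<lambda>t. rfield y f (?m t s)) has_real_derivative rfield x (rfield y f) (?m t s)) (at t)" for t s
        by (rule one_param_derivative[OF \<gamma> fy])
    qed (intro cont fyx fxy)+
    then show ?thesis by (simp add: one_param_0[OF \<gamma>] one_param_0[OF \<eta>])
  next
    case False
    then have "rfield z f = 0" for z by (simp add: rfield_def fun_eq_iff)
    then show ?thesis by (simp add: zero)
  qed
  then show "vf_bracket (rfield x) (rfield y) = 0" "vf_bracket (rfield y) (rfield x) = 0"
    by (auto simp: vf_bracket_def fun_eq_iff zero)
qed

text \<open>The fields \<open>rfield x\<close> with \<open>M x\<close> identically 0 form an ideal
  whose brackets with all invariant fields vanish. Its derived series reaches \<open>{0}\<close>
  after one step, so semisimplicity annihilates it.\<close>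

lemma semisimple_M_zero:
  assumes dim: "DIM('b) = 3" "connected (UNIV :: 'a set)" and ss: "semisimple G A" and M: "\<And>y. M x y = 0"
  shows "x = 0"
proof -
  interpret V: vector_space "vf_scale :: real \<Rightarrow> 'a vfield \<Rightarrow> 'a vfield" by (rule vector_space_vf_scale)
  define I where "I = rfield ` {x. \<forall>y. M x y = 0}"
  have br: "vf_bracket X Y = 0" if "X \<in> lie_algebra G A" "Y \<in> I" for X Y
    using that right_invariant_imp_rfield rfield_commute(2)[OF dim] unfolding I_def lie_algebra_def
    by (smt (verit) imageE mem_Collect_eq)
  have sub: "I \<subseteq> lie_algebra G A"
    using right_invariant_rfield by (auto simp: I_def lie_algebra_def)
  have zero: "0 \<in> I"
    unfolding I_def by (rule image_eqI[of _ _ 0]) (auto simp: rfield_zero linear_0[OF linear_M1])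
  have "V.subspace I"
    unfolding V.subspace_def
  proof (intro conjI zero ballI allI)
    fix X Y assume "X \<in> I" "Y \<in> I"
    then obtain x y where "X = rfield x" "Y = rfield y" "\<forall>z. M x z = 0" "\<forall>z. M y z = 0" by (auto simp: I_def)
    then show "X + Y \<in> I"
      unfolding I_def by (intro image_eqI[of _ _ "x + y"]) (auto simp: rfield_add linear_add[OF linear_M1])
  next
    fix r X assume "X \<in> I"
    then obtain x where "X = rfield x" "\<forall>z. M x z = 0" by (auto simp: I_def)
    then show "vf_scale r X \<in> I"
      unfolding I_def by (intro image_eqI[of _ _ "r *\<^sub>R x"]) (auto simp: rfield_scale linear_cmul[OF linear_M1])
  qed
  then have "lie_ideal G A I"
    using sub br zero by (simp add: lie_ideal_def)
  moreover have "solvable I"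
  proof -
    have "{vf_bracket X Y | X Y. X \<in> I \<and> Y \<in> I} = {0}"
      using br sub zero by force
    then have "derived_series I (Suc 0) = {0}" by simp
    then show ?thesis unfolding solvable_def by blast
  qed
  ultimately have "I = {0}" using ss by (simp add: semisimple_def)
  moreover have "rfield x \<in> I" using M by (auto simp: I_def)
  ultimately show ?thesis using rfield_eq_0_iff by auto
qed

text \<open>The map recording \<open>Ad\<close> on the three basis vectors has derivative
  \<open>?D\<close> at the unit, injective by \<open>semisimple_M_zero\<close>; a continuously
  differentiable map is then injective nearby.\<close>

lemma Ad_trivial_nbhd:
  assumes dim: "DIM('b) = 3" "connected (UNIV :: 'a set)" and ss: "semisimple G A"
  obtains N where "open N" "\<one> \<in> N" "\<And>g. g \<in> N \<Longrightarrow> (\<And>y. Ad g y = y) \<Longrightarrow> g = \<one>"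
proof -
  obtain i j k :: 'b where B: "Basis = {i, j, k}" using dim(1) by (auto simp: card_3_iff)
  define f where "f w = (Ad (\<psi> w) i, Ad (\<psi> w) j, Ad (\<psi> w) k)" for w
  have fs: "Ck_on l W f" for l
    unfolding f_def by (intro Ck_on_Pair open_W Ck_on_Ad)
  let ?D = "\<lambda>x. (M x i, M x j, M x k)"
  have D: "(f has_derivative ?D) (at p)"
    unfolding f_def by (intro has_derivative_Pair M_has_derivative)
  have lin: "linear ?D" using has_derivative_linear[OF D] .
  have "inj ?D"
  proof (subst linear_injective_0[OF lin], intro allI impI)
    fix x assume 0: "?D x = 0"
    have "M x y = 0" for y
      unfolding linear_expand_Basis[OF linear_M2, of x y] using 0 by (intro sum.neutral) (auto simp: B zero_prod_def)
    then show "x = 0" by (rule semisimple_M_zero[OF dim ss])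
  qed
  then obtain g' where g': "linear g'" "g' \<circ> ?D = id"
    using linear_injective_left_inverse[OF lin] by blast
  have Df: "frechet_derivative f (at p) = ?D" using frechet_derivative_at[OF D] by simp
  obtain r where r: "r > 0" "ball p r \<subseteq> W" "inj_on f (ball p r)"
  proof (rule has_derivative_locally_injective[OF p_W open_W, of g' "\<lambda>x. frechet_derivative f (at x)" f])
    show "bounded_linear g'" using g'(1) by (rule linear_conv_bounded_linear[THEN iffD1])
    show "g' \<circ> frechet_derivative f (at p) = id" using g'(2) by (simp add: Df)
    show "(f has_derivative frechet_derivative f (at x)) (at x)" if "x \<in> W" for x
      using Ck_on_has_derivative[OF fs that] .
    show "\<exists>d>0. \<forall>x. dist p x < d \<longrightarrow> onorm (\<lambda>v. frechet_derivative f (at x) v - frechet_derivative f (at p) v) < e"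
      if "e > 0" for e
      by (rule Ck_on_onorm_continuous[OF open_W fs p_W that])
  qed blast
  let ?N = "U \<inter> c -` ball p r"
  show ?thesis
  proof (rule that)
    show "open ?N"
      by (rule continuous_open_preimage[OF smooth_atlas_chart(4)[OF atlas chart] open_U open_ball])
    show "\<one> \<in> ?N" using r one_U by simp
    fix g assume g: "g \<in> ?N" "\<And>y. Ad g y = y"
    then have "f (c g) = f p" by (simp add: f_def \<psi>_c Ad_one)
    then have "c g = p" using r g(1) by (auto dest: inj_onD)
    then show "g = \<one>" using g(1) \<psi>_c \<psi>_p by (metis IntD1)
  qed
qed

end

section \<open>Bounded one-parameter groups of linear maps in dimension three\<close>

text \<open>Over a time \<open>T\<close> with \<open>T * e = 2 * B + 1\<close> the mean value
  theorem would give more growth than a range of length \<open>2 * B\<close> permits.\<close>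

lemma bounded_derivative_not_pos:
  fixes F :: "real \<Rightarrow> real"
  assumes d: "\<And>t. (F has_real_derivative F' t) (at t)" and e: "\<And>t. e \<le> F' t" and B: "\<And>t. \<bar>F t\<bar> \<le> B"
  shows "e \<le> 0"
proof (rule ccontr)
  assume "\<not> e \<le> 0"
  then have e0: "e > 0" by simp
  have B0: "B \<ge> 0" using B[of 0] by linarith
  define T where "T = (2 * B + 1) / e"
  have T: "T > 0" using e0 B0 by (simp add: T_def)
  obtain z where "F T - F 0 = (T - 0) * F' z" using MVT2[OF T, of F F'] d by blast
  then have "T * e \<le> F T - F 0" using e[of z] T by simp
  moreover have "T * e = 2 * B + 1" using e0 by (simp add: T_def)
  ultimately show False using B[of T] B[of 0] by linarith
qed

section \<open>Trace, second characteristic coefficient and Cayley-Hamilton\<close>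

definition trace_op :: "('a::euclidean_space \<Rightarrow> 'a) \<Rightarrow> real" where
  "trace_op h = (\<Sum>i\<in>Basis. h i \<bullet> i)"

text \<open>The coefficient $\sigma$ of the characteristic polynomial
  $\lambda^3 - \tau\lambda^2 + \sigma\lambda - \delta$ in dimension three.\<close>

definition quad_coeff :: "('a::euclidean_space \<Rightarrow> 'a) \<Rightarrow> real" where
  "quad_coeff h = ((trace_op h)\<^sup>2 - (\<Sum>i\<in>Basis. \<Sum>j\<in>Basis. (h i \<bullet> j) * (h j \<bullet> i))) / 2"

lemma inner_linear_Basis:
  fixes h :: "'a::euclidean_space \<Rightarrow> 'b::euclidean_space"
  assumes "linear h" shows "h v \<bullet> l = (\<Sum>m\<in>Basis. (v \<bullet> m) * (h m \<bullet> l))"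
  by (subst linear_expand_Basis[OF assms]) (simp add: inner_sum_left)

lemma trace_op_comp:
  fixes a b :: "'a::euclidean_space \<Rightarrow> 'a"
  assumes "linear a"
  shows "trace_op (\<lambda>x. a (b x)) = (\<Sum>i\<in>Basis. \<Sum>j\<in>Basis. (b i \<bullet> j) * (a j \<bullet> i))"
  unfolding trace_op_def by (intro sum.cong refl inner_linear_Basis assms)

lemma trace_op_commute:
  fixes a b :: "'a::euclidean_space \<Rightarrow> 'a"
  assumes "linear a" "linear b"
  shows "trace_op (\<lambda>x. a (b x)) = trace_op (\<lambda>x. b (a x))"
  unfolding trace_op_comp[OF assms(1)] trace_op_comp[OF assms(2)]
  by (subst sum.swap) (simp add: mult.commute)

lemma quad_coeff_eq: "linear h \<Longrightarrow> quad_coeff h = ((trace_op h)\<^sup>2 - trace_op (\<lambda>x. h (h x))) / 2"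
  by (simp add: quad_coeff_def trace_op_comp)

text \<open>\<open>quad_coeff\<close> is an expression in the traces of \<open>h\<close> and of its
  square, so invariance under conjugation is cyclicity of the trace.\<close>

lemma quad_coeff_conj:
  fixes h h' d d' :: "'a::euclidean_space \<Rightarrow> 'a"
  assumes lin: "linear h" "linear h'" "linear d" "linear d'"
    and conj: "\<And>x. h' (d x) = d (h x)" and inv: "\<And>x. d (d' x) = x" "\<And>x. d' (d x) = x"
  shows "quad_coeff h' = quad_coeff h"
proof -
  have h': "h' = (\<lambda>x. d (h (d' x)))" using conj inv(1) by (metis ext)
  have l: "linear (\<lambda>x. h (d' x))" "linear (\<lambda>x. h (h (d' x)))"
    using linear_compose[OF lin(4,1)] linear_compose[OF linear_compose[OF lin(4,1)] lin(1)] by (simp_all add: o_def)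
  have "trace_op h' = trace_op h"
    unfolding h' trace_op_commute[OF lin(3) l(1)] by (simp add: inv)
  moreover have "trace_op (\<lambda>x. h' (h' x)) = trace_op (\<lambda>x. h (h x))"
  proof -
    have "(\<lambda>x. h' (h' x)) = (\<lambda>x. d (h (h (d' x))))" by (simp add: h' inv)
    then show ?thesis using trace_op_commute[OF lin(3) l(2)] by (simp add: inv)
  qed
  ultimately show ?thesis by (simp add: quad_coeff_eq lin)
qed

lemma quad_coeff_scale: "quad_coeff (\<lambda>x. r *\<^sub>R h x) = r\<^sup>2 * quad_coeff h"
  by (simp add: quad_coeff_def trace_op_def sum_distrib_left[symmetric] power_mult_distrib power2_eq_square
      algebra_simps)

lemma continuous_on_quad_coeff:
  assumes "\<And>y. continuous_on S (\<lambda>x. F x y)"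
  shows "continuous_on S (\<lambda>x. quad_coeff (F x))"
  unfolding quad_coeff_def trace_op_def by (intro continuous_intros assms) simp

text \<open>Verified entrywise in the basis. Trace and \<open>quad_coeff\<close> are named because
  their values matter later; the determinant stays existential because it only has to be shown to
  vanish.\<close>

lemma cayley_hamilton_dim3:
  fixes h :: "'a::euclidean_space \<Rightarrow> 'a"
  assumes dim: "DIM('a) = 3" and lin: "linear h"
  obtains \<delta> where "\<And>y. h (h (h y)) = trace_op h *\<^sub>R h (h y) - quad_coeff h *\<^sub>R h y + \<delta> *\<^sub>R y"
proof -
  obtain i j k :: 'a where B: "Basis = {i, j, k}" "i \<noteq> j" "i \<noteq> k" "j \<noteq> k"
    using dim by (auto simp: card_3_iff)
  define a where "a m l = h m \<bullet> l" for m l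
  \<comment> \<open>The determinant of \<open>h\<close>, expanded by the cofactors of
    \<open>a i i\<close>, \<open>a j i\<close> and \<open>a k i\<close>.\<close>
  define \<delta> where "\<delta> = a i i * (a j j * a k k - a j k * a k j) - a j i * (a i j * a k k - a i k * a k j)
    + a k i * (a i j * a j k - a i k * a j j)"
  have hl: "h v \<bullet> l = (v \<bullet> i) * a i l + (v \<bullet> j) * a j l + (v \<bullet> k) * a k l" for v l
    using inner_linear_Basis[OF lin, of v l, unfolded B(1)] B(2-4) by (simp add: a_def)
  have t: "trace_op h = a i i + a j j + a k k" unfolding trace_op_def a_def B(1) using B(2-4) by simp
  have s: "quad_coeff h = a i i * a j j + a i i * a k k + a j j * a k k - a i j * a j i - a i k * a k i - a j k * a k j"
    unfolding quad_coeff_def t a_def[symmetric] B(1) using B(2-4)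
    by (simp add: power2_eq_square field_simps)
  have "h (h (h y)) = trace_op h *\<^sub>R h (h y) - quad_coeff h *\<^sub>R h y + \<delta> *\<^sub>R y" for y
  proof (rule euclidean_eqI)
    fix l :: 'a assume "l \<in> Basis"
    then have "l = i \<or> l = j \<or> l = k" using B by auto
    then show "h (h (h y)) \<bullet> l = (trace_op h *\<^sub>R h (h y) - quad_coeff h *\<^sub>R h y + \<delta> *\<^sub>R y) \<bullet> l"
      unfolding t s \<delta>_def
      by (elim disjE; simp add: inner_add_left inner_diff_left hl algebra_simps)
  qed
  then show ?thesis using that by blast
qed

lemma cubic_root:
  fixes a b c :: real
  obtains x where "- (x ^ 3) + a * x\<^sup>2 + b * x + c = 0"
proof -
  define f where "f x = - (x ^ 3) + a * x\<^sup>2 + b * x + c" for x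
  \<comment> \<open>Where \<open>\<bar>x\<bar> = K\<close>, the lower terms are at most
    \<open>K ^ 3\<close> in absolute value, so the cubic is nonpositive at \<open>K\<close> and
    nonnegative at \<open>-K\<close>.\<close>
  define K where "K = 1 + \<bar>a\<bar> + \<bar>b\<bar> + \<bar>c\<bar>"
  have K: "K \<ge> 1" by (simp add: K_def)
  have sq: "K \<le> K\<^sup>2" "1 \<le> K\<^sup>2" using K mult_mono[of 1 K 1 K] by (simp_all add: power2_eq_square)
  have bnd: "\<bar>a * x\<^sup>2 + b * x + c\<bar> \<le> K ^ 3" if x: "\<bar>x\<bar> = K" for x
  proof -
    have x2: "x\<^sup>2 = K\<^sup>2" using x by (metis power2_abs)
    have "\<bar>a * x\<^sup>2 + b * x + c\<bar> \<le> \<bar>a\<bar> * K\<^sup>2 + \<bar>b\<bar> * K + \<bar>c\<bar>"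
      using abs_triangle_ineq[of "a * x\<^sup>2 + b * x" c] abs_triangle_ineq[of "a * x\<^sup>2" "b * x"]
      by (simp add: abs_mult x x2)
    also have "\<dots> \<le> \<bar>a\<bar> * K\<^sup>2 + \<bar>b\<bar> * K\<^sup>2 + \<bar>c\<bar> * K\<^sup>2"
      using sq mult_left_mono[of K "K\<^sup>2" "\<bar>b\<bar>"] mult_left_mono[of 1 "K\<^sup>2" "\<bar>c\<bar>"] by simp
    also have "\<dots> \<le> K * K\<^sup>2"
      unfolding distrib_right[symmetric] by (intro mult_right_mono) (auto simp: K_def)
    finally show ?thesis by (simp add: power3_eq_cube power2_eq_square)
  qed
  have "\<exists>x\<ge>-K. x \<le> K \<and> f x = 0"
  proof (rule IVT2)
    show "f K \<le> 0" using bnd[of K] K by (simp add: f_def)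
    show "0 \<le> f (-K)" using bnd[of "-K"] K by (simp add: f_def power3_eq_cube)
    show "\<forall>x. -K \<le> x \<and> x \<le> K \<longrightarrow> isCont f x" unfolding f_def by (intro allI impI continuous_intros)
  qed (use K in simp)
  then show ?thesis using that unfolding f_def by blast
qed

text \<open>The characteristic polynomial is a cubic and has a real root. Determinants are taken of
  matrices, hence the transport to \<open>real ^ 3\<close>.\<close>

lemma eigenvector_dim3:
  fixes h :: "'a::euclidean_space \<Rightarrow> 'a"
  assumes dim: "DIM('a) = 3" and lin: "linear h"
  obtains \<mu> w where "w \<noteq> 0" "h w = \<mu> *\<^sub>R w"
proof -
  have "DIM('a) = DIM(real ^ 3)" using dim by simp
  then obtain J :: "'a \<Rightarrow> real ^ 3" and J' where J: "linear J" "linear J'" "\<And>x. J' (J x) = x" "\<And>x. J (J' x) = x"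
    using isomorphisms_UNIV_UNIV[where 'M = 'a and 'N = "real ^ 3"] by metis
  define g where "g x = J (h (J' x))" for x
  have lg: "linear g"
    using linear_compose[OF linear_compose[OF J(2) lin] J(1)] by (simp add: g_def[abs_def] o_def)
  define m where "m = matrix g"
  obtain a b c' where "\<And>x. det (m - x *\<^sub>R mat 1) = - (x ^ 3) + a * x\<^sup>2 + b * x + c'"
  proof -
    have "det (m - x *\<^sub>R mat 1) = - (x ^ 3) + (m$1$1 + m$2$2 + m$3$3) * x\<^sup>2
      + (m$1$2 * m$2$1 + m$1$3 * m$3$1 + m$2$3 * m$3$2 - m$1$1 * m$2$2 - m$1$1 * m$3$3 - m$2$2 * m$3$3) * x + det m" for x
      by (simp add: det_3 mat_def) algebra
    then show ?thesis using that by blast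
  qed
  then obtain \<mu> where "det (m - \<mu> *\<^sub>R mat 1) = 0" using cubic_root by metis
  moreover have "m - \<mu> *\<^sub>R mat 1 = matrix (\<lambda>x. g x - \<mu> *\<^sub>R x)"
    by (simp add: m_def matrix_def mat_def vec_eq_iff axis_def)
  moreover have l: "linear (\<lambda>x. g x - \<mu> *\<^sub>R x)"
    by (intro linear_compose_sub lg linear_scale_self)
  ultimately have "\<not> inj (\<lambda>x. g x - \<mu> *\<^sub>R x)"
    using det_nz_iff_inj[OF l] by simp
  then obtain v where v: "v \<noteq> 0" "g v = \<mu> *\<^sub>R v"
    using linear_injective_0[OF l] by auto
  have "J' v \<noteq> 0" using v(1) J(1,4) linear_0 by metis
  moreover have "h (J' v) = J' (g v)" by (simp add: g_def J)
  then have "h (J' v) = \<mu> *\<^sub>R J' v" by (simp add: v(2) linear_cmul[OF J(2)])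
  ultimately show ?thesis using that by blast
qed

text \<open>Two instances occur: \<open>Ad\<close> along a one-parameter subgroup, with
  \<open>h = M x\<close>, and the differentials of an automorphism flow. The bound covers negative
  times too, which keeps orbits of nonzero vectors away from 0.\<close>

locale bounded_flow =
  fixes E :: "real \<Rightarrow> 'a::euclidean_space \<Rightarrow> 'a" and h :: "'a \<Rightarrow> 'a" and C :: real
  assumes dim: "DIM('a) = 3" and lin: "linear h" and linE: "\<And>t. linear (E t)"
    and E_add: "\<And>s t y. E (s + t) y = E s (E t y)" and E_0: "\<And>y. E 0 y = y"
    and E_deriv: "\<And>t y. ((\<lambda>t. E t y) has_vector_derivative h (E t y)) (at t)"
    and C: "C > 0" and E_bound: "\<And>t y. norm (E t y) \<le> C * norm y"
begin

lemma E_lower: "norm y \<le> C * norm (E t y)"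
  using E_bound[of "-t" "E t y"] E_add[of "-t" t y] by (simp add: E_0)

lemma E_commute: "E t (h y) = h (E t y)"
proof -
  have "bounded_linear (E t)" using linE by (rule linear_conv_bounded_linear[THEN iffD1])
  from bounded_linear.has_vector_derivative[OF this E_deriv[of y 0]]
  have 1: "((\<lambda>s. E t (E s y)) has_vector_derivative E t (h y)) (at 0)" by (simp add: E_0)
  have "((\<lambda>s. E s (E t y)) has_vector_derivative h (E t y)) (at 0)"
    using E_deriv[of "E t y" 0] by (simp add: E_0)
  then have "((\<lambda>s. E t (E s y)) has_vector_derivative h (E t y)) (at 0)"
    by (simp add: E_add[symmetric] add.commute)
  from vector_derivative_unique_at[OF 1 this] show ?thesis .
qed

lemma E_deriv': "((\<lambda>t. E t y) has_vector_derivative E t (h y)) (at t)"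
  using E_deriv by (simp add: E_commute)

lemma inner_deriv:
  "((\<lambda>t. E t y \<bullet> E t z) has_real_derivative (E t y \<bullet> E t (h z) + E t (h y) \<bullet> E t z)) (at t)"
  using bounded_bilinear.has_vector_derivative[OF bounded_bilinear_inner E_deriv' E_deriv']
  by (simp add: has_real_derivative_iff_has_vector_derivative)

lemma inner_bound: "\<bar>E t y \<bullet> E t z\<bar> \<le> (C * norm y) * (C * norm z)"
  using Cauchy_Schwarz_ineq2[of "E t y" "E t z"] E_bound[of t y] E_bound[of t z] C
  by (meson mult_mono norm_ge_zero order_trans mult_nonneg_nonneg less_imp_le)

lemma inner_lower: "(norm y / C)\<^sup>2 \<le> E t y \<bullet> E t y"
proof -
  have "norm y / C \<le> norm (E t y)" using E_lower[of y t] C by (simp add: field_simps)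
  then have "(norm y / C)\<^sup>2 \<le> (norm (E t y))\<^sup>2" using C by (intro power_mono) auto
  then show ?thesis by (simp add: power2_norm_eq_inner)
qed

text \<open>The square norm of \<open>E t z\<close> is at least \<open>(norm z / C)\<^sup>2\<close>,
  so a nonzero \<open>z\<close> would give the bounded function \<open>F\<close> a derivative
  bounded below by a positive constant. Every exclusion below is an instance with a suitable
  \<open>F\<close>.\<close>

lemma zero_if_inner_growth:
  assumes d: "\<And>t. (F has_real_derivative F' t) (at t)" and a: "a > 0"
    and F': "\<And>t. a * (E t z \<bullet> E t z) \<le> F' t" and B: "\<And>t. \<bar>F t\<bar> \<le> B"
  shows "z = 0"
proof -
  have "a * (norm z / C)\<^sup>2 \<le> F' t" for t
    using order_trans[OF mult_left_mono[OF inner_lower[of z t]] F'] a by simp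
  from bounded_derivative_not_pos[OF d this B] have "a * (norm z / C)\<^sup>2 \<le> 0" .
  then show ?thesis using a C by (simp add: mult_le_0_iff power2_eq_square zero_le_mult_iff divide_le_0_iff)
qed

lemma eigenvalue_zero:
  assumes w: "w \<noteq> 0" "h w = \<mu> *\<^sub>R w" shows "\<mu> = 0"
proof (rule ccontr)
  assume \<mu>: "\<mu> \<noteq> 0"
  have "w = 0"
  proof (rule zero_if_inner_growth)
    show "((\<lambda>t. sgn \<mu> * (E t w \<bullet> E t w)) has_real_derivative
        sgn \<mu> * (E t w \<bullet> E t (h w) + E t (h w) \<bullet> E t w)) (at t)" for t
      by (intro DERIV_cmult inner_deriv)
    show "(2 * \<bar>\<mu>\<bar>) * (E t w \<bullet> E t w) \<le> sgn \<mu> * (E t w \<bullet> E t (h w) + E t (h w) \<bullet> E t w)" for t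
      by (simp add: w(2) linear_cmul[OF linE] abs_sgn algebra_simps)
    show "\<bar>sgn \<mu> * (E t w \<bullet> E t w)\<bar> \<le> (C * norm w) * (C * norm w)" for t
      using inner_bound[of t w w] \<mu> by (simp add: abs_mult abs_sgn_eq)
  qed (use \<mu> in simp)
  then show False using w by simp
qed

text \<open>A nilpotent generator would make \<open>E t y\<close> grow linearly; its inner product
  with \<open>E t (h y)\<close> has the square norm of \<open>E t (h y)\<close> as
  derivative.\<close>

lemma square_zero_imp_zero:
  assumes "\<And>y. h (h y) = 0" shows "h y = 0"
proof (rule zero_if_inner_growth[of "\<lambda>t. E t y \<bullet> E t (h y)" _ 1])
  show "((\<lambda>t. E t y \<bullet> E t (h y)) has_real_derivative
      (E t y \<bullet> E t (h (h y)) + E t (h y) \<bullet> E t (h y))) (at t)" for t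
    by (rule inner_deriv)
  show "\<bar>E t y \<bullet> E t (h y)\<bar> \<le> (C * norm y) * (C * norm (h y))" for t by (rule inner_bound)
qed (auto simp: assms linear_0[OF linE])

text \<open>With $w = h y$ along the flow, $w'' = \tau w' - \sigma w$. The bounded functions
  $\langle w, w'\rangle - \frac{\tau}{2}|w|^2$ and $|w'|^2 + \sigma|w|^2$ have the derivatives
  $|w'|^2 - \sigma|w|^2$ and $2\tau|w'|^2$, which excludes $\sigma \leq 0$ and $\tau \neq 0$.\<close>

lemma generator_cases:
  obtains "\<And>y. h y = 0" | "quad_coeff h > 0" "\<And>y. h (h (h y)) = - (quad_coeff h *\<^sub>R h y)"
proof (cases "\<forall>y. h y = 0")
  case False
  define \<tau> where "\<tau> = trace_op h"
  define \<sigma> where "\<sigma> = quad_coeff h"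
  obtain \<delta> where \<delta>: "\<And>y. h (h (h y)) = \<tau> *\<^sub>R h (h y) - \<sigma> *\<^sub>R h y + \<delta> *\<^sub>R y"
    using cayley_hamilton_dim3[OF dim lin] unfolding \<tau>_def \<sigma>_def by metis
  \<comment> \<open>Boundedness makes this real eigenvalue 0, and Cayley-Hamilton evaluated at its
    eigenvector leaves \<open>\<delta> *\<^sub>R w = 0\<close>.\<close>
  obtain \<mu> w where w: "w \<noteq> 0" "h w = \<mu> *\<^sub>R w" using eigenvector_dim3[OF dim lin] .
  have "h w = 0" using eigenvalue_zero[OF w] w(2) by simp
  then have "\<delta> = 0" using \<delta>[of w] w(1) by (simp add: linear_0[OF lin])
  then have h3: "h (h (h y)) = \<tau> *\<^sub>R h (h y) - \<sigma> *\<^sub>R h y" for y using \<delta> by simp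
  have E3: "E t (h (h (h y))) = \<tau> *\<^sub>R E t (h (h y)) - \<sigma> *\<^sub>R E t (h y)" for t y
    by (simp add: h3 linear_diff[OF linE] linear_cmul[OF linE])
  let ?b = "\<lambda>y z. (C * norm y) * (C * norm z)"
  have \<sigma>: "\<sigma> > 0"
  proof (rule ccontr)
    assume \<sigma>: "\<not> \<sigma> > 0"
    have "h (h y) = 0" for y
    proof (rule zero_if_inner_growth[where a=1])
      let ?w = "h y" and ?w' = "h (h y)"
      show "((\<lambda>t. E t ?w \<bullet> E t ?w' - \<tau> / 2 * (E t ?w \<bullet> E t ?w)) has_real_derivative
        ((E t ?w \<bullet> E t (h ?w') + E t (h ?w) \<bullet> E t ?w') - \<tau> / 2 * (E t ?w \<bullet> E t (h ?w) + E t (h ?w) \<bullet> E t ?w))) (at t)" for t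
        by (intro DERIV_diff DERIV_cmult inner_deriv)
      have "0 \<le> - \<sigma> * (E t ?w \<bullet> E t ?w)" for t using \<sigma> by (intro mult_nonneg_nonneg) auto
      then show "1 * (E t ?w' \<bullet> E t ?w') \<le> (E t ?w \<bullet> E t (h ?w') + E t (h ?w) \<bullet> E t ?w') - \<tau> / 2 * (E t ?w \<bullet> E t (h ?w) + E t (h ?w) \<bullet> E t ?w)" for t
        by (simp add: E3 inner_diff_right inner_commute algebra_simps)
      have "\<bar>E t ?w \<bullet> E t ?w' - \<tau> / 2 * (E t ?w \<bullet> E t ?w)\<bar> \<le> \<bar>E t ?w \<bullet> E t ?w'\<bar> + \<bar>\<tau> / 2\<bar> * \<bar>E t ?w \<bullet> E t ?w\<bar>" for t
        unfolding abs_mult[symmetric] by (rule abs_triangle_ineq4)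
      also have "\<dots> t \<le> ?b ?w ?w' + \<bar>\<tau> / 2\<bar> * ?b ?w ?w" for t
        by (intro add_mono mult_left_mono inner_bound) auto
      finally show "\<bar>E t ?w \<bullet> E t ?w' - \<tau> / 2 * (E t ?w \<bullet> E t ?w)\<bar> \<le> ?b ?w ?w' + \<bar>\<tau> / 2\<bar> * ?b ?w ?w" for t .
    qed simp
    then show False using square_zero_imp_zero False by blast
  qed
  have "\<tau> = 0"
  proof (rule ccontr)
    assume \<tau>: "\<tau> \<noteq> 0"
    have "h (h y) = 0" for y
    proof (rule zero_if_inner_growth[where a="2 * \<bar>\<tau>\<bar>"])
      let ?w = "h y" and ?w' = "h (h y)"
      show "((\<lambda>t. sgn \<tau> * (E t ?w' \<bullet> E t ?w' + \<sigma> * (E t ?w \<bullet> E t ?w))) has_real_derivative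
        sgn \<tau> * ((E t ?w' \<bullet> E t (h ?w') + E t (h ?w') \<bullet> E t ?w') + \<sigma> * (E t ?w \<bullet> E t (h ?w) + E t (h ?w) \<bullet> E t ?w))) (at t)" for t
        by (intro DERIV_add DERIV_cmult inner_deriv)
      show "2 * \<bar>\<tau>\<bar> * (E t ?w' \<bullet> E t ?w') \<le> sgn \<tau> * ((E t ?w' \<bullet> E t (h ?w') + E t (h ?w') \<bullet> E t ?w') + \<sigma> * (E t ?w \<bullet> E t (h ?w) + E t (h ?w) \<bullet> E t ?w))" for t
        by (simp add: E3 inner_diff_right inner_diff_left inner_commute abs_sgn algebra_simps)
      have "\<bar>sgn \<tau> * (E t ?w' \<bullet> E t ?w' + \<sigma> * (E t ?w \<bullet> E t ?w))\<bar> \<le> \<bar>E t ?w' \<bullet> E t ?w'\<bar> + \<sigma> * \<bar>E t ?w \<bullet> E t ?w\<bar>" for t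
        using \<tau> \<sigma> by (simp add: abs_mult abs_sgn_eq)
      also have "\<dots> t \<le> ?b ?w' ?w' + \<sigma> * ?b ?w ?w" for t
        using \<sigma> by (intro add_mono mult_left_mono inner_bound) auto
      finally show "\<bar>sgn \<tau> * (E t ?w' \<bullet> E t ?w' + \<sigma> * (E t ?w \<bullet> E t ?w))\<bar> \<le> ?b ?w' ?w' + \<sigma> * ?b ?w ?w" for t .
    qed (use \<tau> in simp)
    then show False using square_zero_imp_zero False by blast
  qed
  then show ?thesis using that(2) \<sigma> h3 by (simp add: \<sigma>_def)
qed (use that(1) in blast)

lemma solution_unique:
  assumes "\<And>t. (u has_vector_derivative h (u t)) (at t)" "u 0 = y"
  shows "u t = E t y"
proof -
  obtain K where K: "\<And>x. norm (h x) \<le> K * norm x" using linear_bounded[OF lin] by blast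
  have "u t - E t y = 0"
  proof (rule gronwall_zero[of UNIV "\<lambda>t. u t - E t y" "\<lambda>t. h (u t) - h (E t y)" K 0])
    show "((\<lambda>t. u t - E t y) has_vector_derivative h (u t) - h (E t y)) (at t)" for t
      by (intro has_vector_derivative_diff assms E_deriv)
    show "norm (h (u t) - h (E t y)) \<le> K * norm (u t - E t y)" for t
      using K[of "u t - E t y"] by (simp add: linear_diff[OF lin])
  qed (auto simp: assms E_0)
  then show ?thesis by simp
qed

lemma periodic:
  obtains s where "s > 0" "\<And>y. E s y = y"
proof (cases rule: generator_cases)
  case 1
  have "E 1 y = y" for y
    using solution_unique[of "\<lambda>t. y" y 1] 1 by simp
  then show ?thesis using that[of 1] by simp
next
  case 2
  define \<omega> where "\<omega> = sqrt (quad_coeff h)"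
  have \<omega>: "\<omega> > 0" "\<omega>\<^sup>2 = quad_coeff h" using 2(1) by (auto simp: \<omega>_def)
  \<comment> \<open>The exponential series summed by means of
    \<open>h (h (h y)) = - (\<omega>\<^sup>2 *\<^sub>R h y)\<close>, as in Rodrigues' rotation
    formula. Both coefficients vanish at \<open>2 * pi / \<omega>\<close>.\<close>
  have "y + (sin (\<omega> * t) / \<omega>) *\<^sub>R h y + ((1 - cos (\<omega> * t)) / \<omega>\<^sup>2) *\<^sub>R h (h y) = E t y" for y t
  proof (rule solution_unique)
    fix t
    have s: "((\<lambda>t. sin (\<omega> * t) / \<omega>) has_real_derivative cos (\<omega> * t)) (at t)"
      and c: "((\<lambda>t. (1 - cos (\<omega> * t)) / \<omega>\<^sup>2) has_real_derivative sin (\<omega> * t) / \<omega>) (at t)"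
      using \<omega>(1) by (auto intro!: derivative_eq_intros simp: power2_eq_square)
    have "((\<lambda>t. y + (sin (\<omega> * t) / \<omega>) *\<^sub>R h y + ((1 - cos (\<omega> * t)) / \<omega>\<^sup>2) *\<^sub>R h (h y)) has_vector_derivative
      (0 + ((sin (\<omega> * t) / \<omega>) *\<^sub>R 0 + cos (\<omega> * t) *\<^sub>R h y) + (((1 - cos (\<omega> * t)) / \<omega>\<^sup>2) *\<^sub>R 0 + (sin (\<omega> * t) / \<omega>) *\<^sub>R h (h y)))) (at t)"
      by (intro has_vector_derivative_add has_vector_derivative_const has_vector_derivative_scaleR s c)
    moreover have "h (y + (sin (\<omega> * t) / \<omega>) *\<^sub>R h y + ((1 - cos (\<omega> * t)) / \<omega>\<^sup>2) *\<^sub>R h (h y)) =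
      cos (\<omega> * t) *\<^sub>R h y + (sin (\<omega> * t) / \<omega>) *\<^sub>R h (h y)"
    proof -
      have "h (h (h y)) = - (\<omega>\<^sup>2 *\<^sub>R h y)" using 2(2) \<omega>(2) by simp
      then show ?thesis
        using \<omega>(1) by (simp add: linear_add[OF lin] linear_cmul[OF lin] scaleR_left_diff_distrib)
    qed
    ultimately show "((\<lambda>t. y + (sin (\<omega> * t) / \<omega>) *\<^sub>R h y + ((1 - cos (\<omega> * t)) / \<omega>\<^sup>2) *\<^sub>R h (h y)) has_vector_derivative
      h (y + (sin (\<omega> * t) / \<omega>) *\<^sub>R h y + ((1 - cos (\<omega> * t)) / \<omega>\<^sup>2) *\<^sub>R h (h y))) (at t)"
      by simp
  qed simp
  from this[of _ "2 * pi / \<omega>"] have "E (2 * pi / \<omega>) y = y" for y using \<omega>(1) by simp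
  then show ?thesis using that[of "2 * pi / \<omega>"] \<omega>(1) by simp
qed

end

text \<open>Averages of orbits over a short time window are differentiable in \<open>t\<close>. For
  a short enough window the averaging map \<open>Y\<close> is injective, hence onto in finite
  dimension, so every vector is such an average.\<close>

lemma continuous_group_generator:
  fixes E :: "real \<Rightarrow> 'a::euclidean_space \<Rightarrow> 'a"
  assumes linE: "\<And>t. linear (E t)" and E_add: "\<And>s t y. E (s + t) y = E s (E t y)" and E_0: "\<And>y. E 0 y = y"
    and cont: "\<And>y. continuous_on UNIV (\<lambda>t. E t y)"
  obtains h where "linear h" "\<And>t y. ((\<lambda>t. E t y) has_vector_derivative h (E t y)) (at t)"
proof -
  \<comment> \<open>Summed over the basis this gives the bound \<open>norm y / 2\<close> on
    \<open>E s y - y\<close>; a factor below 1 is what makes \<open>Y\<close> injective.\<close>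
  define b where "b = 1 / (2 * real (DIM('a)))"
  have b: "b > 0" by (simp add: b_def)
  have "\<exists>d>0. \<forall>s. \<bar>s\<bar> < d \<longrightarrow> norm (E s i - i) < b" for i
  proof -
    have "\<exists>d>0. \<forall>s\<in>UNIV. dist s 0 < d \<longrightarrow> dist (E s i) (E 0 i) < b"
      using cont[of i] b unfolding continuous_on_iff by blast
    then show ?thesis by (simp add: dist_norm E_0)
  qed
  then obtain d where d: "\<And>i. d i > 0" "\<And>i s. \<bar>s\<bar> < d i \<Longrightarrow> norm (E s i - i) < b" by metis
  \<comment> \<open>Halving the minimum keeps \<open>e\<close> strictly below each
    \<open>d i\<close> with \<open>i\<close> in the basis; the bound 1 keeps \<open>s + t\<close>
    between -1 and 2, where \<open>H\<close> is differentiated.\<close>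
  define e where "e = min 1 (Min (d ` Basis) / 2)"
  have e: "e > 0" "e \<le> 1" unfolding e_def using d(1) by (auto simp: Min_gr_iff)
  have ei: "e < d i" if "i \<in> Basis" for i
  proof -
    have "Min (d ` Basis) \<le> d i" using that by simp
    moreover have "e \<le> Min (d ` Basis) / 2" unfolding e_def by (rule min.cobounded2)
    ultimately show ?thesis using d(1)[of i] by linarith
  qed
  have near: "norm (E s y - y) \<le> norm y / 2" if "s \<in> {0..e}" for s y
  proof -
    have "linear (\<lambda>y. E s y - y)" by (intro linear_compose_sub linE linear_ident)
    from norm_linear_le_Basis[OF this, of "\<lambda>i. b" y]
    have "norm (E s y - y) \<le> (\<Sum>i\<in>(Basis::'a set). b) * norm y"
      using d(2) ei that by (smt (verit) atLeastAtMost_iff)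
    then show ?thesis by (simp add: b_def)
  qed
  define Y where "Y y = integral {0..e} (\<lambda>s. E s y)" for y
  have int: "(\<lambda>s. E s y) integrable_on {a..b}" for y a b
    by (intro integrable_continuous_interval continuous_on_subset[OF cont]) simp
  have linY: "linear Y"
    by (rule linearI) (simp_all add: Y_def linear_add[OF linE] linear_cmul[OF linE] integral_add int)
  have "inj Y"
  proof (subst linear_injective_0[OF linY], intro allI impI)
    fix y assume "Y y = 0"
    moreover have "integral {0..e} (\<lambda>s. E s y - y) = Y y - integral {0..e} (\<lambda>s. y)"
      unfolding Y_def by (rule integral_diff[OF int integrable_const_ivl])
    ultimately have "integral {0..e} (\<lambda>s. E s y - y) = - (e *\<^sub>R y)"
      using e by simp
    moreover have "norm (integral {0..e} (\<lambda>s. E s y - y)) \<le> (norm y / 2) * (e - 0)"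
      by (rule integral_bound) (use near e in \<open>auto intro!: continuous_intros continuous_on_subset[OF cont]\<close>)
    ultimately have "e * norm y \<le> e * (norm y / 2)" using e by simp
    then show "y = 0" using e by simp
  qed
  then have surj: "surj Y" using linear_injective_imp_surjective[OF linY] by blast
  have "\<exists>v. ((\<lambda>t. E t z) has_vector_derivative v) (at 0)" for z
  proof -
    obtain y where z: "z = Y y" using surj by blast
    define H where "H t = integral {-1..t} (\<lambda>s. E s y)" for t
    have H: "(H has_vector_derivative E t y) (at t)" if "t \<in> {-1<..<2}" for t
    proof -
      have "(H has_vector_derivative E t y) (at t within {-1..2})"
        unfolding H_def by (rule integral_has_vector_derivative) (use that in \<open>auto intro: continuous_on_subset[OF cont]\<close>)
      moreover have "at t within {-1..2} = at t" using that by (intro at_within_interior) auto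
      ultimately show ?thesis by simp
    qed
    \<comment> \<open>Applying \<open>E t\<close> to an average only shifts its window, so the
      dependence on \<open>t\<close> sits in the two endpoints of an integral.\<close>
    have eq: "E t z = H (e + t) - H (0 + t)" if "\<bar>t\<bar> < 1/2" for t
    proof -
      have "((\<lambda>s. E (s + t) y) has_integral H (e + t) - H (0 + t)) {0..e}"
      proof (rule fundamental_theorem_of_calculus)
        fix s assume "s \<in> {0..e}"
        then have "s + t \<in> {-1<..<2}" using e that by auto
        then have 1: "(H has_vector_derivative E (s + t) y) (at (s + t))" by (rule H)
        have 2: "((\<lambda>s. s + t) has_vector_derivative 1) (at s)" by (auto intro!: derivative_eq_intros)
        show "((\<lambda>s. H (s + t)) has_vector_derivative E (s + t) y) (at s within {0..e})"
          using vector_diff_chain_at[OF 2 1] by (auto simp: o_def intro: has_vector_derivative_at_within)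
      qed (use e in simp)
      then have "integral {0..e} (\<lambda>s. E t (E s y)) = H (e + t) - H (0 + t)"
        by (simp add: integral_unique E_add[symmetric] add.commute)
      moreover have "integral {0..e} (E t \<circ> (\<lambda>s. E s y)) = E t (integral {0..e} (\<lambda>s. E s y))"
        by (rule integral_linear[OF int linE[THEN linear_conv_bounded_linear[THEN iffD1]]])
      ultimately show ?thesis by (simp add: z Y_def o_def)
    qed
    have 1: "((\<lambda>t. e + t) has_vector_derivative 1) (at 0)" "((\<lambda>t. 0 + t) has_vector_derivative 1) (at (0::real))"
      by (auto intro!: derivative_eq_intros)
    have "(H has_vector_derivative E e y) (at (e + 0))" "(H has_vector_derivative E 0 y) (at (0 + 0))"
      using H[of e] H[of 0] e by simp_all
    from has_vector_derivative_diff[OF vector_diff_chain_at[OF 1(1) this(1)] vector_diff_chain_at[OF 1(2) this(2)]]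
    have "((\<lambda>t. H (e + t) - H (0 + t)) has_vector_derivative 1 *\<^sub>R E e y - 1 *\<^sub>R E 0 y) (at 0)" by (simp add: o_def)
    then have "((\<lambda>t. E t z) has_vector_derivative 1 *\<^sub>R E e y - 1 *\<^sub>R E 0 y) (at 0)"
      by (rule has_vector_derivative_transform_within_open[of _ _ _ "{-1/2<..<1/2}"])
        (auto simp: eq abs_less_iff)
    then show ?thesis by blast
  qed
  then obtain h where h: "\<And>z. ((\<lambda>t. E t z) has_vector_derivative h z) (at 0)" by metis
  have "linear h"
  proof (rule linearI)
    fix x y :: 'a and r :: real
    have "((\<lambda>t. E t (x + y)) has_vector_derivative h x + h y) (at 0)"
      using has_vector_derivative_add[OF h[of x] h[of y]] by (simp add: linear_add[OF linE])
    from vector_derivative_unique_at[OF h this] show "h (x + y) = h x + h y" .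
    have "((\<lambda>t. E t (r *\<^sub>R x)) has_vector_derivative r *\<^sub>R h x) (at 0)"
      using bounded_linear.has_vector_derivative[OF bounded_linear_scaleR_right h[of x], of r]
      by (simp add: linear_cmul[OF linE])
    from vector_derivative_unique_at[OF h this] show "h (r *\<^sub>R x) = r *\<^sub>R h x" .
  qed
  moreover have "((\<lambda>t. E t y) has_vector_derivative h (E t y)) (at t)" for t y
  proof -
    have 1: "((\<lambda>s. s - t) has_vector_derivative 1) (at t)"
      by (auto intro!: derivative_eq_intros)
    have 2: "((\<lambda>s. E s (E t y)) has_vector_derivative h (E t y)) (at (t - t))" using h by simp
    from vector_diff_chain_at[OF 1 2] show ?thesis by (simp add: o_def E_add[symmetric])
  qed
  ultimately show ?thesis using that by blast
qed

lemma homogeneous_bounds: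
  fixes q :: "'a::euclidean_space \<Rightarrow> real"
  assumes cont: "continuous_on UNIV q" and hom: "\<And>r x. q (r *\<^sub>R x) = r\<^sup>2 * q x" and pos: "\<And>x. x \<noteq> 0 \<Longrightarrow> q x > 0"
  obtains a b where "a > 0" "b > 0" "\<And>x. a * (norm x)\<^sup>2 \<le> q x" "\<And>x. q x \<le> b * (norm x)\<^sup>2"
proof -
  let ?S = "sphere (0::'a) 1"
  obtain i :: 'a where "i \<in> Basis" using nonempty_Basis by blast
  then have ne: "?S \<noteq> {}" by (auto intro!: exI[of _ i])
  have c: "continuous_on ?S q" using cont continuous_on_subset by blast
  obtain x where x: "x \<in> ?S" "\<And>y. y \<in> ?S \<Longrightarrow> q x \<le> q y"
    using continuous_attains_inf[OF compact_sphere ne c] by blast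
  obtain z where z: "z \<in> ?S" "\<And>y. y \<in> ?S \<Longrightarrow> q y \<le> q z"
    using continuous_attains_sup[OF compact_sphere ne c] by blast
  have q: "q y = (norm y)\<^sup>2 * q (sgn y)" for y
    using hom[of "norm y" "sgn y"] by (cases "y = 0") (simp_all add: sgn_div_norm)
  have q0: "q 0 = 0" using hom[of 0 0] by simp
  have "q x * (norm y)\<^sup>2 \<le> q y \<and> q y \<le> q z * (norm y)\<^sup>2" for y
  proof (cases "y = 0")
    case False
    then have "sgn y \<in> ?S" by (simp add: norm_sgn)
    then show ?thesis using x(2)[of "sgn y"] z(2)[of "sgn y"]
      unfolding q[of y] mult.commute[of "(norm y)\<^sup>2"] by (intro conjI mult_right_mono) auto
  qed (simp add: q0)
  moreover have "q x > 0" "q z > 0" using x(1) z(1) by (auto intro!: pos)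
  ultimately show ?thesis using that by blast
qed

section \<open>Periodicity\<close>

context lie_chart
begin

text \<open>\<open>Ad (\<gamma> t)\<close> is a bounded group with generator \<open>M x\<close>. Of
  the two alternatives for such a generator, \<open>M x = 0\<close> is excluded by the trivial
  centre; the other one contains the claim.\<close>

lemma quad_coeff_M_pos:
  assumes dim: "DIM('b) = 3" "connected (UNIV :: 'a set)" and "compact (UNIV :: 'a set)"
    and ss: "semisimple G A" and x: "x \<noteq> 0"
  shows "quad_coeff (M x) > 0"
proof -
  obtain \<gamma> where \<gamma>: "one_param x \<gamma>" by (rule one_param_exists)
  obtain C where C: "C > 0" "\<And>g y. norm (Ad g y) \<le> C * norm y" using Ad_bounded[OF assms(3)] by blast
  interpret F: bounded_flow "\<lambda>t. Ad (\<gamma> t)" "M x" C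
    by (rule bounded_flow.intro)
      (simp_all add: dim linear_M2 linear_Ad one_param_add[OF \<gamma>] Ad_mult one_param_0[OF \<gamma>] Ad_one Ad_one_param_derivative[OF \<gamma>] C)
  show ?thesis
  proof (cases rule: F.generator_cases)
    case 1
    then show ?thesis using semisimple_M_zero[OF dim ss] x by blast
  qed
qed

text \<open>Continuity is asked only along each orbit, so that the result applies both to a linear
  flow and to conjugation by a one-parameter subgroup.\<close>

lemma automorphism_flow_periodic:
  fixes \<Phi> :: "real \<Rightarrow> 'a \<Rightarrow> 'a"
  assumes dim: "DIM('b) = 3" "connected (UNIV :: 'a set)" and comp: "compact (UNIV :: 'a set)"
    and ss: "semisimple G A"
    and hom: "\<And>t. smooth_hom (\<Phi> t)" and \<Phi>_add: "\<And>s t g. \<Phi> (s + t) g = \<Phi> s (\<Phi> t g)" and \<Phi>_0: "\<And>g. \<Phi> 0 g = g"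
    and cont: "\<And>g. continuous_on UNIV (\<lambda>t. \<Phi> t g)"
  obtains s where "s > 0" "\<And>g. \<Phi> s g = g"
proof -
  define E where "E t = diff (\<Phi> t)" for t
  have linE: "linear (E t)" for t unfolding E_def by (rule linear_diff[OF hom])
  have E_add: "E (s + t) y = E s (E t y)" for s t y
    unfolding E_def by (simp add: diff_comp[OF hom hom, symmetric] \<Phi>_add[symmetric])
  have E_0: "E 0 y = y" for y
  proof -
    have "\<Phi> 0 = (\<lambda>g. g)" using \<Phi>_0 by blast
    then show ?thesis by (simp add: E_def diff_id)
  qed
  have E_inv: "E t (E (- t) y) = y" "E (- t) (E t y) = y" for t y
    using E_add[of t "-t" y] E_add[of "-t" t y] by (simp_all add: E_0)

  let ?q = "\<lambda>x. quad_coeff (M x)"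
  have "continuous_on UNIV ?q"
    by (rule continuous_on_quad_coeff) (rule linear_continuous_on[OF linear_conv_bounded_linear[THEN iffD1, OF linear_M1]])
  moreover have "?q (r *\<^sub>R x) = r\<^sup>2 * ?q x" for r x
  proof -
    have "M (r *\<^sub>R x) = (\<lambda>y. r *\<^sub>R M x y)" by (simp add: linear_cmul[OF linear_M1] fun_eq_iff)
    then show ?thesis by (simp add: quad_coeff_scale)
  qed
  ultimately obtain a b where ab: "a > 0" "b > 0" "\<And>x. a * (norm x)\<^sup>2 \<le> ?q x" "\<And>x. ?q x \<le> b * (norm x)\<^sup>2"
    using homogeneous_bounds[of ?q] quad_coeff_M_pos[OF dim comp ss] by blast
  \<comment> \<open>The quadratic form is invariant and lies between \<open>a\<close> and
    \<open>b\<close> times the square norm, so one constant serves all \<open>t\<close>.\<close>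
  define C where "C = sqrt (b / a)"
  have C: "C > 0" using ab by (simp add: C_def)
  have E_bound: "norm (E t y) \<le> C * norm y" for t y
  proof -
    \<comment> \<open>\<open>E t\<close> preserves the bracket, so \<open>M (E t y)\<close> is the
      conjugate of \<open>M y\<close> by \<open>E t\<close>, with inverse
      \<open>E (- t)\<close>.\<close>
    have "?q (E t y) = ?q y"
    proof (rule quad_coeff_conj[OF linear_M2 linear_M2 linE linE])
      show "M (E t y) (E t x) = E t (M y x)" for x
        unfolding E_def by (rule diff_M[OF hom, symmetric])
    qed (rule E_inv)+
    then have "a * (norm (E t y))\<^sup>2 \<le> b * (norm y)\<^sup>2" using ab(3)[of "E t y"] ab(4)[of y] by simp
    then have "(norm (E t y))\<^sup>2 \<le> b / a * (norm y)\<^sup>2" using ab(1) by (simp add: field_simps)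
    also have "\<dots> = (C * norm y)\<^sup>2" using ab by (simp add: C_def power_mult_distrib)
    finally show ?thesis by (rule power2_le_imp_le) (use C in simp)
  qed

  \<comment> \<open>Continuity of \<open>E\<close>: \<open>c (\<Phi> t (\<gamma> s))\<close> is continuous in \<open>t\<close> and differs from
    \<open>p + s *\<^sub>R E t y\<close> by \<open>O(s\<^sup>2)\<close> uniformly in \<open>t\<close>.\<close>
  obtain T K where TK: "T > 0" "K \<ge> 0"
    "\<And>x. norm x \<le> 1 \<Longrightarrow> \<exists>\<gamma>. one_param x \<gamma> \<and> (\<forall>t. \<bar>t\<bar> < T \<longrightarrow> \<gamma> t \<in> U \<and> norm (c (\<gamma> t) - p - t *\<^sub>R x) \<le> K * t\<^sup>2)"
    using one_param_exists_uniform by blast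
  \<comment> \<open>The bound \<open>1 / C\<close> puts every \<open>E t y\<close> into the unit
    ball, where the uniform remainder is available.\<close>
  have E_cont1: "continuous_on UNIV (\<lambda>t. E t y)" if y: "norm y \<le> min 1 (1 / C)" for y
  proof -
    obtain \<gamma> where \<gamma>: "one_param y \<gamma>" using one_param_exists by blast
    have est: "\<Phi> t (\<gamma> s) \<in> U" "norm (c (\<Phi> t (\<gamma> s)) - p - s *\<^sub>R E t y) \<le> K * s\<^sup>2" if s: "\<bar>s\<bar> < T" for s t
    proof -
      have "norm (E t y) \<le> C * (1 / C)"
        using order_trans[OF E_bound mult_left_mono[of "norm y" "1 / C" C]] y C by simp
      then have "norm (E t y) \<le> 1" using C by simp
      then obtain \<eta> where \<eta>: "one_param (E t y) \<eta>"
        "\<And>s. \<bar>s\<bar> < T \<Longrightarrow> \<eta> s \<in> U \<and> norm (c (\<eta> s) - p - s *\<^sub>R E t y) \<le> K * s\<^sup>2"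
        using TK(3) by metis
      have "one_param (E t y) (\<lambda>s. \<Phi> t (\<gamma> s))" unfolding E_def by (rule smooth_hom_one_param[OF hom \<gamma>])
      from one_param_unique[OF this \<eta>(1)] have "\<Phi> t (\<gamma> s) = \<eta> s" by metis
      then show "\<Phi> t (\<gamma> s) \<in> U" "norm (c (\<Phi> t (\<gamma> s)) - p - s *\<^sub>R E t y) \<le> K * s\<^sup>2"
        using \<eta>(2)[OF s] by auto
    qed
    show ?thesis
      unfolding continuous_on_iff
    proof (intro ballI allI impI)
      fix t0 and e :: real assume e: "e > 0"
      \<comment> \<open>The two remainders then cost at most \<open>s * e / 2\<close> together, the
        variation of \<open>c (\<Phi> t (\<gamma> s))\<close> the other half; dividing by
        \<open>s\<close> leaves \<open>e\<close>.\<close>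
      define s where "s = min (T / 2) (e / (4 * (K + 1)))"
      have s: "s > 0" "\<bar>s\<bar> < T" using TK(1,2) e by (auto simp: s_def)
      have "K * s \<le> K * (e / (4 * (K + 1)))"
        using TK(2) by (intro mult_left_mono) (auto simp: s_def)
      also have "\<dots> \<le> e / 4" using TK(2) e by (simp add: field_simps)
      finally have Ks: "K * s \<le> e / 4" .
      have "continuous_on UNIV (\<lambda>t. c (\<Phi> t (\<gamma> s)))"
        by (rule continuous_on_compose2[OF smooth_atlas_chart(4)[OF atlas chart] cont]) (use est(1)[OF s(2)] in auto)
      then obtain d where d: "d > 0" "\<And>t. dist t t0 < d \<Longrightarrow> dist (c (\<Phi> t (\<gamma> s))) (c (\<Phi> t0 (\<gamma> s))) < s * (e / 2)"
        unfolding continuous_on_iff using s e by (metis UNIV_I half_gt_zero mult_pos_pos)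
      have "dist (E t y) (E t0 y) < e" if t: "dist t t0 < d" for t
      proof -
        let ?f = "\<lambda>t. c (\<Phi> t (\<gamma> s))"
        have "s *\<^sub>R (E t y - E t0 y) = (?f t - ?f t0) - (?f t - p - s *\<^sub>R E t y) + (?f t0 - p - s *\<^sub>R E t0 y)"
          by (simp add: scaleR_diff_right)
        then have "norm (s *\<^sub>R (E t y - E t0 y)) \<le> norm (?f t - ?f t0) + norm (?f t - p - s *\<^sub>R E t y) + norm (?f t0 - p - s *\<^sub>R E t0 y)"
          using norm_triangle_ineq[of "(?f t - ?f t0) - (?f t - p - s *\<^sub>R E t y)" "?f t0 - p - s *\<^sub>R E t0 y"]
            norm_triangle_ineq4[of "?f t - ?f t0" "?f t - p - s *\<^sub>R E t y"] by simp
        also have "\<dots> < s * (e / 2) + K * s\<^sup>2 + K * s\<^sup>2"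
          using d(2)[OF t] est(2)[OF s(2), of t] est(2)[OF s(2), of t0] by (simp add: dist_norm)
        also have "\<dots> \<le> s * e"
        proof -
          have "s * (K * s) \<le> s * (e / 4)" using mult_left_mono[OF Ks, of s] s by simp
          then have "K * s\<^sup>2 \<le> s * e / 4" by (simp only: power2_eq_square mult_ac times_divide_eq_right)
          moreover have "s * (e / 2) = s * e / 2" by simp
          ultimately show ?thesis by linarith
        qed
        finally have "s * norm (E t y - E t0 y) < s * e" using s by simp
        then show ?thesis using s(1) by (simp add: dist_norm)
      qed
      then show "\<exists>d>0. \<forall>t\<in>UNIV. dist t t0 < d \<longrightarrow> dist (E t y) (E t0 y) < e" using d(1) by blast
    qed
  qed
  have E_cont: "continuous_on UNIV (\<lambda>t. E t y)" for y
  proof -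
    define m where "m = min 1 (1 / C)"
    have m: "m > 0" using C by (simp add: m_def)
    define r where "r = m / (norm y + 1)"
    have r: "r > 0" using m by (simp add: r_def add_nonneg_pos)
    have "norm y * m \<le> m * (norm y + 1)" using m by (simp add: algebra_simps)
    then have "norm (r *\<^sub>R y) \<le> m" using m by (simp add: r_def divide_le_eq add_nonneg_pos mult.commute)
    then have "continuous_on UNIV (\<lambda>t. (1 / r) *\<^sub>R E t (r *\<^sub>R y))"
      by (intro continuous_intros E_cont1) (simp add: m_def)
    then show ?thesis using r by (simp add: linear_cmul[OF linE])
  qed

  obtain h where h: "linear h" "\<And>t y. ((\<lambda>t. E t y) has_vector_derivative h (E t y)) (at t)"
    using continuous_group_generator[OF linE E_add E_0 E_cont] by blast
  interpret F: bounded_flow E h C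
    by (rule bounded_flow.intro) (simp_all add: dim h linE E_add E_0 C E_bound)
  obtain s where s: "s > 0" "\<And>y. E s y = y" using F.periodic by blast
  have "\<Phi> s g = g" for g
    by (rule diff_id_imp_id[OF dim hom]) (use s(2) in \<open>simp add: E_def\<close>)
  then show ?thesis using that s(1) by blast
qed

lemma one_param_periodic:
  assumes dim: "DIM('b) = 3" "connected (UNIV :: 'a set)" and comp: "compact (UNIV :: 'a set)"
    and ss: "semisimple G A" and \<gamma>: "one_param x \<gamma>"
  obtains s where "s > 0" "\<gamma> s = \<one>"
proof -
  let ?\<Phi> = "\<lambda>t g. \<gamma> t \<otimes> g \<otimes> inv (\<gamma> t)"
  have add: "?\<Phi> (s + t) g = ?\<Phi> s (?\<Phi> t g)" for s t g
    by (simp add: one_param_add[OF \<gamma>] inv_mult assoc)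
  have cont: "continuous_on UNIV (\<lambda>t. ?\<Phi> t g)" for g
  proof -
    have "continuous_on UNIV (\<lambda>t. \<gamma> (- t))"
      by (rule continuous_on_compose2[OF one_param_cont[OF \<gamma>]]) (auto intro!: continuous_intros)
    then show ?thesis
      by (intro continuous_on_mult one_param_cont[OF \<gamma>] continuous_on_const) (simp add: one_param_minus[OF \<gamma>])
  qed
  obtain s where s: "s > 0" "\<And>g. \<gamma> s \<otimes> g \<otimes> inv (\<gamma> s) = g"
    by (rule automorphism_flow_periodic[OF dim comp ss, of ?\<Phi>])
      (use smooth_hom_conj add cont in \<open>auto simp: one_param_0[OF \<gamma>]\<close>)
  \<comment> \<open>Conjugation by \<open>\<gamma> s\<close> is the identity map, so
    \<open>\<gamma> s\<close> and all its powers act trivially through \<open>Ad\<close>.\<close>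
  have "Ad (\<gamma> s) y = y" for y
    unfolding Ad_def s(2) diff_id ..
  then have Adpow: "Ad (\<gamma> s [^] n) y = y" for n :: nat and y
    by (induction n) (simp_all add: Ad_one Ad_mult)
  obtain N where N: "open N" "\<one> \<in> N" "\<And>g. g \<in> N \<Longrightarrow> (\<And>y. Ad g y = y) \<Longrightarrow> g = \<one>"
    using Ad_trivial_nbhd[OF dim ss] by blast
  let ?a = "\<lambda>n. \<gamma> (real n * s)"
  obtain l r where r: "strict_mono r" "(?a \<circ> r) \<longlonglongrightarrow> l"
    using compact_imp_seq_compact[OF comp] unfolding seq_compact_def by (metis UNIV_I)
  have r1: "(\<lambda>k. ?a (r k)) \<longlonglongrightarrow> l" using r(2) by (simp add: o_def)
  \<comment> \<open>Consecutive quotients along a convergent subsequence tend to the unit. They are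
    powers of \<open>\<gamma> s\<close> with positive exponent, so one of them lies in
    \<open>N\<close> and equals the unit; this is how finiteness of the discrete centre
    enters.\<close>
  have "(\<lambda>k. ?a (r (Suc k)) \<otimes> inv (?a (r k))) \<longlonglongrightarrow> l \<otimes> inv l"
  proof -
    have c: "continuous_on UNIV (\<lambda>z::'a \<times> 'a. fst z \<otimes> inv (snd z))"
    proof (rule continuous_on_mult[OF continuous_on_fst[OF continuous_on_id]])
      have "continuous_on UNIV (\<lambda>x. inv x)" using smooth_map_inv by (simp add: smooth_map_def)
      then show "continuous_on UNIV (\<lambda>z::'a \<times> 'a. inv (snd z))"
        by (rule continuous_on_compose2[OF _ continuous_on_snd[OF continuous_on_id]]) simp
    qed
    have "(\<lambda>k. (?a (r (Suc k)), ?a (r k))) \<longlonglongrightarrow> (l, l)"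
      by (rule tendsto_Pair[OF LIMSEQ_Suc[OF r1] r1])
    from continuous_on_tendsto_compose[OF c this] show ?thesis by simp
  qed
  then have "eventually (\<lambda>k. ?a (r (Suc k)) \<otimes> inv (?a (r k)) \<in> N) sequentially"
    using N(1,2) by (simp add: topological_tendstoD)
  then obtain k where k: "?a (r (Suc k)) \<otimes> inv (?a (r k)) \<in> N"
    using eventually_happens by force
  define n where "n = r (Suc k) - r k"
  have lt: "r k < r (Suc k)" using r(1) by (simp add: strict_mono_def)
  then have n: "n > 0" "real n = real (r (Suc k)) - real (r k)" by (auto simp: n_def of_nat_diff)
  have "?a (r (Suc k)) \<otimes> inv (?a (r k)) = ?a n"
    using one_param_add[OF \<gamma>, of "real (r (Suc k)) * s" "- (real (r k) * s)"]
    by (simp add: one_param_minus[OF \<gamma>] n(2) algebra_simps)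
  then have "?a n \<in> N" using k by simp
  then have "?a n = \<one>" by (rule N(3)) (simp add: one_param_power[OF \<gamma>] Adpow)
  then show ?thesis using that[of "real n * s"] n(1) s(1) by simp
qed

end

theorem corollary4p3:
  fixes G :: "'a::{t2_space, second_countable_topology} monoid"
    and A :: "('a, 'b::euclidean_space) chart set"
  assumes "lie_group G A"
    and "DIM('b) = 3"
    and "connected (UNIV :: 'a set)"
    and "compact (UNIV :: 'a set)"
    and "semisimple G A"
  shows "(\<forall>X g. right_invariant G A X \<longrightarrow> \<not> fixed_point (invariant_flow G A X) g \<longrightarrow>
            periodic_orbit (invariant_flow G A X) g) \<and>
         (\<forall>X \<phi> g. linear_vector_field G A X \<longrightarrow> is_flow A X \<phi> \<longrightarrow> \<not> fixed_point \<phi> g \<longrightarrow>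
            periodic_orbit \<phi> g)"
proof -
  have "smooth_atlas A" using assms(1) by (simp add: lie_group_def)
  then obtain U c where "(U, c) \<in> A" "\<one>\<^bsub>G\<^esub> \<in> U" by (rule smooth_atlas_cover)
  then interpret lie_chart G A U c using assms(1) by unfold_locales
  show ?thesis
  proof (intro conjI allI impI)
    fix X g assume "right_invariant G A X"
    then obtain x where X: "X = rfield x" by (rule right_invariant_imp_rfield)
    obtain \<gamma> where \<gamma>: "one_param x \<gamma>" by (rule one_param_exists)
    obtain s where s: "s > 0" "\<gamma> s = \<one>\<^bsub>G\<^esub>" using one_param_periodic[OF assms(2-5) \<gamma>] .
    show "periodic_orbit (invariant_flow G A X) g"
      unfolding periodic_orbit_def X invariant_flow_one_param[OF \<gamma>] one_param_add[OF \<gamma>]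
      using s by (intro exI[of _ s]) simp
  next
    fix X \<phi> g assume X: "linear_vector_field G A X" and \<phi>: "is_flow A X \<phi>"
    \<comment> \<open>The automorphism property is known for some flow of \<open>X\<close>, whereas
      \<open>\<phi>\<close> is an arbitrary one; uniqueness of integral curves identifies the
      two.\<close>
    then obtain \<phi>' where vf: "vector_field A X" and \<phi>': "is_flow A X \<phi>'" "\<And>t. lie_automorphism G A (\<phi>' t)"
      by (auto simp: linear_vector_field_def)
    have unique: "\<gamma> t = \<eta> t" if "weak_curve A X UNIV \<gamma>" "weak_curve A X UNIV \<eta>" "\<gamma> 0 = \<eta> 0" for \<gamma> \<eta> t
      by (rule weak_curve_unique[OF atlas vf open_UNIV connected_UNIV that(1,2) _ that(3)]) simp_all
    have curve: "weak_curve A X UNIV (\<lambda>t. \<phi> t g)" "weak_curve A X UNIV (\<lambda>t. \<phi>' t g)" for g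
      using \<phi> \<phi>'(1) by (auto simp: is_flow_def intro: integral_curve_imp_weak_curve)
    have \<phi>_0: "\<phi> 0 g = g" for g using \<phi> by (simp add: is_flow_def)
    have "\<phi> t g = \<phi>' t g" for t g
      by (rule unique[OF curve]) (use \<phi> \<phi>'(1) in \<open>simp add: is_flow_def\<close>)
    then have "\<phi> = \<phi>'" by blast
    then have hom: "smooth_hom (\<phi> t)" for t
      using \<phi>'(2)[of t] by (auto simp: lie_automorphism_def smooth_hom_def iso_def hom_def)
    \<comment> \<open>As functions of \<open>s\<close> both sides are integral curves of the same
      field, and they agree at \<open>s = 0\<close>.\<close>
    have \<phi>_add: "\<phi> (s + t) g = \<phi> s (\<phi> t g)" for s t g
    proof (rule unique[of "\<lambda>s. \<phi> (s + t) g" "\<lambda>s. \<phi> s (\<phi> t g)"])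
      show "weak_curve A X UNIV (\<lambda>s. \<phi> (s + t) g)" using weak_curve_shift[OF curve(1), of t g] by simp
      show "weak_curve A X UNIV (\<lambda>s. \<phi> s (\<phi> t g))" by (rule curve(1))
    qed (simp add: \<phi>_0)
    have cont: "continuous_on UNIV (\<lambda>t. \<phi> t g)" for g using curve(1) by (simp add: weak_curve_def)
    obtain s where s: "s > 0" "\<And>g. \<phi> s g = g"
      by (rule automorphism_flow_periodic[OF assms(2-5) hom \<phi>_add \<phi>_0 cont]) (blast intro: that)
    show "periodic_orbit \<phi> g"
      unfolding periodic_orbit_def \<phi>_add using s by (intro exI[of _ s]) simp
  qed
qed

end
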